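(* Let $\Gamma=\langle g_1,\ldots,g_n\rangle$ be a discrete group, let $J\in U_n$ be a unitary matrix, and let $G=\widehat{\Gamma}$ be viewed as a quantum subgroup of $U_n^+$ via the morphism $C(U_n^+)\to C^*(\Gamma)$, $u\mapsto JDJ^*$, where $D=\mathrm{diag}(g_1,\ldots,g_n)$. Let $k\leq n$ and $H=G\cap U_k^+$. Then the inclusion $C_\times(G/H)\subset C(G/H)$ is an isomorphism (i.e. an equality) if and only if $\Lambda\triangleleft\Gamma$, where $\Lambda\subset\Gamma$ is the subgroup $$\Lambda=\langle g_r\mid \exists\, i>k,\ J_{ir}\neq 0\rangle .$$
   Context: A compact quantum group $G$ is given by a unital $C^*$-algebra $C(G)$ with a coassociative, cobisimplifiable comultiplication $\Delta:C(G)\to C(G)\otimes C(G)$ (Woronowicz; $\otimes$ is the minimal tensor product). A quantum subgroup $H\subset G$ is a surjective morphism of $C^*$-algebras $\pi:C(G)\to C(H)$ intertwining comultiplications. For a discrete group $\Gamma$, the compact quantum group $\widehat\Gamma$ is given by $C(\widehat{\Gamma})=C^*(\Gamma)$ (full group $C^*$-algebra), $\Delta(g)=g\otimes g$. A matrix $u$ is biunitary if $u$ and $u^t=(u_{ji})$ are unitary. $C(U_n^+)$ is the universal unital $C^*$-algebra generated by the entries of an $n\times n$ biunitary matrix $u=(u_{ij})$, with $\Delta(u_{ij})=\sum_k u_{ik}\otimes u_{kj}$. For $0\le k\leq n$, $U_k^+\subset U_n^+$ is given by $u\mapsto \mathrm{diag}(v,1_{n-k})$, $v$ being the fundamental corepresentation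 of $U_k^+$. If $H,H'\subset G$ are quantum subgroups, $H\cap H'\subset G$ is the quantum subgroup $K$ such that $\ker(C(G)\to C(K))$ is the sum of the ideals $\ker(C(G)\to C(H))$ and $\ker(C(G)\to C(H'))$. For a quantum subgroup $G\subset U_n^+$, also denote by $u_{ij}\in C(G)$ the images of the standard generators. With $H=G\cap U_k^+$ and $\pi:C(G)\to C(H)$ the corresponding surjection, set $C(G/H)=\{f\in C(G)\mid(\pi\otimes id)\Delta f=1\otimes f\}$, and let $C_\times(G/H)\subset C(G/H)$ be the unital $C^*$-subalgebra generated by $\{u_{ij}\mid i>k,\ 1\leq j\leq n\}$. *)

theory Defs
  imports
    "HOL-Analysis.Analysis"
    "HOL-Algebra.Coset"
    "HOL-Algebra.Generated_Groups"
    "HOL-Library.Poly_Mapping"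
    "Jordan_Normal_Form.Matrix"
begin

section \<open>Unital C*-algebras\<close>

class star =
  fixes star :: "'a \<Rightarrow> 'a"

text \<open>The norm and the completeness come from the real structure; the requirement
  \<open>norm 1 = 1\<close> of \<^class>\<open>real_normed_algebra_1\<close> only excludes the zero algebra.\<close>

class cstar_algebra = real_normed_algebra_1 + complete_space + star +
  fixes scaleC :: "complex \<Rightarrow> 'a \<Rightarrow> 'a"  (infixr \<open>*\<^sub>C\<close> 75)
  assumes scaleC_of_real: "complex_of_real r *\<^sub>C x = r *\<^sub>R x"
    and scaleC_add_right: "a *\<^sub>C (x + y) = a *\<^sub>C x + a *\<^sub>C y"
    and scaleC_add_left: "(a + b) *\<^sub>C x = a *\<^sub>C x + b *\<^sub>C x"
    and scaleC_scaleC: "a *\<^sub>C b *\<^sub>C x = (a * b) *\<^sub>C x"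
    and mult_scaleC_left: "(a *\<^sub>C x) * y = a *\<^sub>C (x * y)"
    and mult_scaleC_right: "x * (a *\<^sub>C y) = a *\<^sub>C (x * y)"
    and norm_scaleC: "norm (a *\<^sub>C x) = cmod a * norm x"
    and star_star: "star (star x) = x"
    and star_add: "star (x + y) = star x + star y"
    and star_scaleC: "star (a *\<^sub>C x) = cnj a *\<^sub>C star x"
    and star_mult: "star (x * y) = star y * star x"
    and norm_star_mult: "norm (star x * x) = (norm x)\<^sup>2"

instantiation complex :: cstar_algebra
begin

definition star_complex :: "complex \<Rightarrow> complex" where
  "star_complex = cnj"

definition scaleC_complex :: "complex \<Rightarrow> complex \<Rightarrow> complex" where
  "scaleC_complex = (*)"

instance
  by standard
    (auto simp: star_complex_def scaleC_complex_def scaleR_conv_of_real algebra_simps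
      norm_mult power2_eq_square)

end

definition star_hom :: "('a::cstar_algebra \<Rightarrow> 'b::cstar_algebra) \<Rightarrow> bool" where
  "star_hom f \<longleftrightarrow>
     (\<forall>x y. f (x + y) = f x + f y) \<and>
     (\<forall>a x. f (a *\<^sub>C x) = a *\<^sub>C f x) \<and>
     (\<forall>x y. f (x * y) = f x * f y) \<and>
     (\<forall>x. f (star x) = star (f x)) \<and>
     f 1 = 1"

definition csubspace :: "'a::cstar_algebra set \<Rightarrow> bool" where
  "csubspace S \<longleftrightarrow>
     0 \<in> S \<and> (\<forall>x\<in>S. \<forall>y\<in>S. x + y \<in> S) \<and> (\<forall>a. \<forall>x\<in>S. a *\<^sub>C x \<in> S)"

definition closed_cspan :: "'a::cstar_algebra set \<Rightarrow> 'a set" where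
  "closed_cspan S = \<Inter> {B. csubspace B \<and> closed B \<and> S \<subseteq> B}"

definition cstar_subalgebra :: "'a::cstar_algebra set \<Rightarrow> bool" where
  "cstar_subalgebra B \<longleftrightarrow>
     csubspace B \<and> closed B \<and> 1 \<in> B \<and>
     (\<forall>x\<in>B. \<forall>y\<in>B. x * y \<in> B) \<and> (\<forall>x\<in>B. star x \<in> B)"

definition generated_cstar :: "'a::cstar_algebra set \<Rightarrow> 'a set" where
  "generated_cstar S = \<Inter> {B. cstar_subalgebra B \<and> S \<subseteq> B}"

definition state :: "('a::cstar_algebra \<Rightarrow> complex) \<Rightarrow> bool" where
  "state \<phi> \<longleftrightarrow>
     (\<forall>x y. \<phi> (x + y) = \<phi> x + \<phi> y) \<and>
     (\<forall>a x. \<phi> (a *\<^sub>C x) = a * \<phi> x) \<and>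
     (\<forall>x. \<phi> (star x * x) \<in> \<real>\<^sub>\<ge>\<^sub>0) \<and>
     \<phi> 1 = 1"


section \<open>Universal C*-algebras\<close>

text \<open>The free unital *-algebra on a type of generators is the monoid algebra of the free
  monoid on the generators \<open>(x, False)\<close> and their formal adjoints \<open>(x, True)\<close>.\<close>

datatype 'x word = Word (letters: "('x \<times> bool) list")

instantiation word :: (type) monoid_add
begin

definition zero_word :: "'a word" where
  "zero_word = Word []"

definition plus_word :: "'a word \<Rightarrow> 'a word \<Rightarrow> 'a word" where
  "plus_word v w = Word (letters v @ letters w)"

instance
  by standard (auto simp: zero_word_def plus_word_def)

end

instantiation word :: (type) star
begin

definition star_word :: "'a word \<Rightarrow> 'a word" where
  "star_word w = Word (rev (map (\<lambda>(x, b). (x, \<not> b)) (letters w)))"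

instance ..

end

type_synonym 'x star_poly = "'x word \<Rightarrow>\<^sub>0 complex"

text \<open>On words \<^const>\<open>star\<close> is an involution, so that the coefficient of \<open>star p\<close> at \<open>w\<close> is the
  conjugate of the coefficient of \<open>p\<close> at \<open>star w\<close>.\<close>

instantiation poly_mapping :: (star, "{zero, star}") star
begin

definition star_poly_mapping :: "('a \<Rightarrow>\<^sub>0 'b) \<Rightarrow> ('a \<Rightarrow>\<^sub>0 'b)" where
  "star_poly_mapping p = Poly_Mapping.map star (Poly_Mapping.map_key star p)"

instance ..

end

definition Gen :: "'x \<Rightarrow> 'x star_poly" where
  "Gen x = Poly_Mapping.single (Word [(x, False)]) 1"

definition Scal :: "complex \<Rightarrow> 'x star_poly" where
  "Scal c = Poly_Mapping.single 0 c"

definition poly_vars :: "'x star_poly \<Rightarrow> 'x set" where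
  "poly_vars p = (\<Union>w\<in>Poly_Mapping.keys p. fst ` set (letters w))"

definition eval_word :: "('x \<Rightarrow> 'a::cstar_algebra) \<Rightarrow> 'x word \<Rightarrow> 'a" where
  "eval_word a w = prod_list (map (\<lambda>(x, b). if b then star (a x) else a x) (letters w))"

definition eval_poly :: "('x \<Rightarrow> 'a::cstar_algebra) \<Rightarrow> 'x star_poly \<Rightarrow> 'a" where
  "eval_poly a p = (\<Sum>w\<in>Poly_Mapping.keys p. Poly_Mapping.lookup p w *\<^sub>C eval_word a w)"

definition cstar_seminorm :: "('x star_poly \<Rightarrow> real) \<Rightarrow> bool" where
  "cstar_seminorm s \<longleftrightarrow>
     (\<forall>p. 0 \<le> s p) \<and>
     (\<forall>p q. s (p + q) \<le> s p + s q) \<and>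
     (\<forall>c p. s (Scal c * p) = cmod c * s p) \<and>
     (\<forall>p q. s (p * q) \<le> s p * s q) \<and>
     (\<forall>p. s (star p * p) = (s p)\<^sup>2)"

text \<open>The universal unital C*-algebra on generators \<open>X\<close> and relations \<open>r = 0\<close> (\<open>r \<in> R\<close>, where
  \<open>R\<close> only involves variables from \<open>X\<close>) is the completion of the free unital *-algebra on \<open>X\<close>
  with respect to its greatest C*-seminorm vanishing on \<open>R\<close>. Since HOL cannot quantify
  over all C*-algebras \<open>B\<close>, the C*-seminorms take the place of the families in \<open>B\<close> satisfying
  the relations: each such family \<open>b\<close> gives the C*-seminorm \<open>\<lambda>p. norm (eval_poly b p)\<close>, and each
  C*-seminorm arises in this way from its Hausdorff completion. By the first two
  conditions the last one says that \<open>norm (eval_poly a p)\<close> is the greatest value of these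
  seminorms at \<open>p\<close>. Letting \<open>s\<close> be defined also on polynomials in variables outside \<open>X\<close> makes
  no difference, as a C*-seminorm extends by substituting 0 for those variables.\<close>

definition universal_cstar_algebra ::
    "'x set \<Rightarrow> 'x star_poly set \<Rightarrow> ('x \<Rightarrow> 'a::cstar_algebra) \<Rightarrow> bool" where
  "universal_cstar_algebra X R a \<longleftrightarrow>
     (\<forall>r\<in>R. eval_poly a r = 0) \<and>
     generated_cstar (a ` X) = UNIV \<and>
     (\<forall>s. cstar_seminorm s \<and> (\<forall>r\<in>R. s r = 0) \<longrightarrow>
        (\<forall>p. poly_vars p \<subseteq> X \<longrightarrow> s p \<le> norm (eval_poly a p)))"


section \<open>Minimal tensor products\<close>

text \<open>A list \<open>[(a\<^sub>1, b\<^sub>1), \<dots>]\<close> represents the element \<open>a\<^sub>1 \<otimes> b\<^sub>1 + \<dots>\<close> of the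
  algebraic tensor product.\<close>

definition tmult :: "('a::cstar_algebra \<times> 'b::cstar_algebra) list \<Rightarrow> ('a \<times> 'b) list \<Rightarrow> ('a \<times> 'b) list" where
  "tmult xs ys = [(a * a', b * b'). (a, b) \<leftarrow> xs, (a', b') \<leftarrow> ys]"

definition tstar :: "('a::cstar_algebra \<times> 'b::cstar_algebra) list \<Rightarrow> ('a \<times> 'b) list" where
  "tstar xs = [(star a, star b). (a, b) \<leftarrow> xs]"

definition product_functional ::
    "('a \<Rightarrow> complex) \<Rightarrow> ('b \<Rightarrow> complex) \<Rightarrow> ('a \<times> 'b) list \<Rightarrow> complex" where
  "product_functional \<phi> \<psi> xs = (\<Sum>(a, b)\<leftarrow>xs. \<phi> a * \<psi> b)"

text \<open>The spatial (minimal) norm of \<open>x\<close> is the supremum of the operator norms of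
  \<open>(\<pi>\<^sub>\<phi> \<otimes> \<pi>\<^sub>\<psi>) x\<close> over the GNS representations of all states \<open>\<phi>\<close>, \<open>\<psi>\<close> of the two factors. The
  elements \<open>y\<close> of the algebraic tensor product define a dense subspace of the Hilbert
  space of this representation, on which the vector of \<open>y\<close> has squared norm
  \<open>(\<phi> \<otimes> \<psi>) (y* y)\<close>.\<close>

definition spatial_norm :: "('a::cstar_algebra \<times> 'b::cstar_algebra) list \<Rightarrow> real" where
  "spatial_norm xs = sqrt (Sup
     {Re (product_functional \<phi> \<psi> (tmult (tstar (tmult xs ys)) (tmult xs ys)))
        / Re (product_functional \<phi> \<psi> (tmult (tstar ys) ys))
      | \<phi> \<psi> ys. state \<phi> \<and> state \<psi> \<and> product_functional \<phi> \<psi> (tmult (tstar ys) ys) \<noteq> 0})"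

text \<open>The type \<open>'t\<close>, with \<open>t a b\<close> in the role of \<open>a \<otimes> b\<close>, is the minimal tensor product
  of \<open>'a\<close> and \<open>'b\<close>.\<close>

definition min_tensor ::
    "('a::cstar_algebra \<Rightarrow> 'b::cstar_algebra \<Rightarrow> 't::cstar_algebra) \<Rightarrow> bool" where
  "min_tensor t \<longleftrightarrow>
     (\<forall>a a' b. t (a + a') b = t a b + t a' b) \<and>
     (\<forall>a b b'. t a (b + b') = t a b + t a b') \<and>
     (\<forall>c a b. t (c *\<^sub>C a) b = c *\<^sub>C t a b) \<and>
     (\<forall>c a b. t a (c *\<^sub>C b) = c *\<^sub>C t a b) \<and>
     (\<forall>a a' b b'. t a b * t a' b' = t (a * a') (b * b')) \<and>
     (\<forall>a b. star (t a b) = t (star a) (star b)) \<and>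
     t 1 1 = 1 \<and>
     closed_cspan {t a b | a b. True} = UNIV \<and>
     (\<forall>xs. norm (\<Sum>(a, b)\<leftarrow>xs. t a b) = spatial_norm xs)"

text \<open>\<open>h\<close> is the morphism \<open>f \<otimes> g\<close> of tensor products.\<close>

definition tensor_map ::
    "('a::cstar_algebra \<Rightarrow> 'b::cstar_algebra \<Rightarrow> 't::cstar_algebra) \<Rightarrow>
     ('c::cstar_algebra \<Rightarrow> 'd::cstar_algebra \<Rightarrow> 'r::cstar_algebra) \<Rightarrow>
     ('a \<Rightarrow> 'c) \<Rightarrow> ('b \<Rightarrow> 'd) \<Rightarrow> ('t \<Rightarrow> 'r) \<Rightarrow> bool" where
  "tensor_map t r f g h \<longleftrightarrow> star_hom h \<and> (\<forall>a b. h (t a b) = r (f a) (g b))"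


section \<open>Compact quantum groups\<close>

text \<open>Here \<open>'a\<close> is \<open>C(G)\<close>, while \<open>'b\<close> and \<open>'c\<close> are its second and third tensor powers; the
  latter is presented both as \<open>(A \<otimes> A) \<otimes> A\<close> and as \<open>A \<otimes> (A \<otimes> A)\<close>.\<close>

record ('a, 'b, 'c) cqg =
  tens :: "'a \<Rightarrow> 'a \<Rightarrow> 'b"
  tens_left :: "'b \<Rightarrow> 'a \<Rightarrow> 'c"
  tens_right :: "'a \<Rightarrow> 'b \<Rightarrow> 'c"
  comult :: "'a \<Rightarrow> 'b"

definition compact_quantum_group ::
    "('a::cstar_algebra, 'b::cstar_algebra, 'c::cstar_algebra) cqg \<Rightarrow> bool" where
  "compact_quantum_group G \<longleftrightarrow>
     min_tensor (tens G) \<and> min_tensor (tens_left G) \<and> min_tensor (tens_right G) \<and>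
     (\<forall>x y z. tens_left G (tens G x y) z = tens_right G x (tens G y z)) \<and>
     star_hom (comult G) \<and>
     (\<exists>l r. tensor_map (tens G) (tens_left G) (comult G) id l \<and>
            tensor_map (tens G) (tens_right G) id (comult G) r \<and>
            (\<forall>x. l (comult G x) = r (comult G x))) \<and>
     closed_cspan {comult G x * tens G y 1 | x y. True} = UNIV \<and>
     closed_cspan {comult G x * tens G 1 y | x y. True} = UNIV"

definition quantum_subgroup ::
    "('h::cstar_algebra, 'hh::cstar_algebra, 'hhh::cstar_algebra) cqg \<Rightarrow>
     ('a::cstar_algebra, 'aa::cstar_algebra, 'aaa::cstar_algebra) cqg \<Rightarrow> ('a \<Rightarrow> 'h) \<Rightarrow> bool" where
  "quantum_subgroup H G \<pi> \<longleftrightarrow>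
     compact_quantum_group H \<and> compact_quantum_group G \<and>
     star_hom \<pi> \<and> surj \<pi> \<and>
     (\<exists>\<pi>\<pi>. tensor_map (tens G) (tens H) \<pi> \<pi> \<pi>\<pi> \<and> (\<forall>x. \<pi>\<pi> (comult G x) = comult H (\<pi> x)))"

definition hom_kernel :: "('a \<Rightarrow> 'b::zero) \<Rightarrow> 'a set" where
  "hom_kernel f = {x. f x = 0}"

text \<open>\<open>K\<close>, embedded into \<open>G\<close> by \<open>\<rho>\<close>, is the intersection of the quantum subgroups \<open>H\<^sub>1\<close>, \<open>H\<^sub>2\<close>
  of \<open>G\<close> given by \<open>\<pi>\<^sub>1\<close>, \<open>\<pi>\<^sub>2\<close>.\<close>

definition quantum_intersection ::
    "('k::cstar_algebra, 'kk::cstar_algebra, 'kkk::cstar_algebra) cqg \<Rightarrow>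
     ('a::cstar_algebra, 'aa::cstar_algebra, 'aaa::cstar_algebra) cqg \<Rightarrow>
     ('a \<Rightarrow> 'k) \<Rightarrow> ('a \<Rightarrow> 'h1::zero) \<Rightarrow> ('a \<Rightarrow> 'h2::zero) \<Rightarrow> bool" where
  "quantum_intersection K G \<rho> \<pi>\<^sub>1 \<pi>\<^sub>2 \<longleftrightarrow>
     quantum_subgroup K G \<rho> \<and>
     hom_kernel \<rho> = {x + y | x y. x \<in> hom_kernel \<pi>\<^sub>1 \<and> y \<in> hom_kernel \<pi>\<^sub>2}"

definition group_relations :: "('g, 'm) monoid_scheme \<Rightarrow> 'g star_poly set" where
  "group_relations \<Gamma> =
     {Gen \<one>\<^bsub>\<Gamma>\<^esub> - 1} \<union>
     {Gen g * Gen h - Gen (g \<otimes>\<^bsub>\<Gamma>\<^esub> h) | g h. g \<in> carrier \<Gamma> \<and> h \<in> carrier \<Gamma>} \<union>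
     {star (Gen g) - Gen (inv\<^bsub>\<Gamma>\<^esub> g) | g. g \<in> carrier \<Gamma>}"

text \<open>\<open>G\<close> is the dual of the discrete group \<open>\<Gamma>\<close>: its algebra is the full group C*-algebra,
  with canonical unitaries \<open>\<iota> g\<close>.\<close>

definition dual_quantum_group ::
    "('g, 'm) monoid_scheme \<Rightarrow>
     ('a::cstar_algebra, 'aa::cstar_algebra, 'aaa::cstar_algebra) cqg \<Rightarrow> ('g \<Rightarrow> 'a) \<Rightarrow> bool" where
  "dual_quantum_group \<Gamma> G \<iota> \<longleftrightarrow>
     compact_quantum_group G \<and>
     universal_cstar_algebra (carrier \<Gamma>) (group_relations \<Gamma>) \<iota> \<and>
     (\<forall>g\<in>carrier \<Gamma>. comult G (\<iota> g) = tens G (\<iota> g) (\<iota> g))"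

definition adjoint_mat :: "'a::star mat \<Rightarrow> 'a mat" where
  "adjoint_mat A = mat (dim_col A) (dim_row A) (\<lambda>(i, j). star (A $$ (j, i)))"

definition unitary_mat :: "nat \<Rightarrow> 'a::cstar_algebra mat \<Rightarrow> bool" where
  "unitary_mat n A \<longleftrightarrow>
     A \<in> carrier_mat n n \<and> A * adjoint_mat A = 1\<^sub>m n \<and> adjoint_mat A * A = 1\<^sub>m n"

text \<open>The entries of the following differences say that the matrix of generators \<open>Gen (i, j)\<close>
  and its transpose are unitary.\<close>

definition biunitary_relations :: "nat \<Rightarrow> (nat \<times> nat) star_poly set" where
  "biunitary_relations n =
     (let u = mat n n Gen in
      \<Union>w\<in>{u, transpose_mat u}.
        elements_mat (w * adjoint_mat w - 1\<^sub>m n) \<union> elements_mat (adjoint_mat w * w - 1\<^sub>m n))"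

definition free_unitary_quantum_group ::
    "nat \<Rightarrow> ('a::cstar_algebra, 'aa::cstar_algebra, 'aaa::cstar_algebra) cqg \<Rightarrow> 'a mat \<Rightarrow> bool" where
  "free_unitary_quantum_group n U u \<longleftrightarrow>
     compact_quantum_group U \<and>
     u \<in> carrier_mat n n \<and>
     universal_cstar_algebra ({..<n} \<times> {..<n}) (biunitary_relations n) (\<lambda>ij. u $$ ij) \<and>
     (\<forall>i<n. \<forall>j<n. comult U (u $$ (i, j)) = (\<Sum>l<n. tens U (u $$ (i, l)) (u $$ (l, j))))"

text \<open>Block matrix \<open>diag(v, 1\<^bsub>n - k\<^esub>)\<close> for a \<open>k \<times> k\<close> matrix \<open>v\<close> with \<open>k \<le> n\<close>.\<close>

definition extend_mat :: "nat \<Rightarrow> nat \<Rightarrow> 'a::cstar_algebra mat \<Rightarrow> 'a mat" where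
  "extend_mat k n v = four_block_mat v (0\<^sub>m k (n - k)) (0\<^sub>m (n - k) k) (1\<^sub>m (n - k))"

definition scalar_mat :: "complex mat \<Rightarrow> 'a::cstar_algebra mat" where
  "scalar_mat J = map_mat (\<lambda>c. c *\<^sub>C 1) J"

text \<open>The fixed-point algebra \<open>C(G/H)\<close>; \<open>t\<close> is the tensor product \<open>C(H) \<otimes> C(G)\<close> and
  \<open>\<pi>id\<close> is \<open>\<pi> \<otimes> id\<close>.\<close>

definition quotient_algebra ::
    "('a::cstar_algebra, 'aa::cstar_algebra, 'aaa::cstar_algebra) cqg \<Rightarrow>
     ('h::cstar_algebra \<Rightarrow> 'a \<Rightarrow> 't::cstar_algebra) \<Rightarrow> ('aa \<Rightarrow> 't) \<Rightarrow> 'a set" where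
  "quotient_algebra G t \<pi>id = {f. \<pi>id (comult G f) = t 1 f}"

text \<open>\<open>C\<^sub>\<times>(G/H)\<close>, for the fundamental matrix \<open>w\<close> of \<open>G\<close>. Matrix indices start at 0, so that the
  last \<open>n - k\<close> rows are those with index \<open>k \<le> i < n\<close>.\<close>

definition row_algebra :: "nat \<Rightarrow> nat \<Rightarrow> 'a::cstar_algebra mat \<Rightarrow> 'a set" where
  "row_algebra k n w = generated_cstar {w $$ (i, j) | i j. k \<le> i \<and> i < n \<and> j < n}"

end

theory Submission
  imports Defs
begin

text \<open>
  Let \<open>\<iota> g\<close> be the canonical unitaries of \<open>C(G) = C*(\<Gamma>)\<close>. Since \<open>J\<close> is unitary, \<open>C\<^sub>\<times>(G/H)\<close> is the
  closed span of \<open>\<iota> g\<close> for \<open>g \<in> \<Lambda>\<close>, and \<open>\<pi> (\<iota> g) = 1\<close> in \<open>C(H)\<close> for all \<open>g\<close> in the normal closure of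
  \<open>\<Lambda>\<close>, so that \<open>\<iota> g \<in> C(G/H)\<close> for these \<open>g\<close>. For every subgroup \<open>K\<close> there is a state of \<open>C*(\<Gamma>)\<close>
  with \<open>\<iota> g \<mapsto> [g \<in> K]\<close>. Taking \<open>K = \<Lambda>\<close>, it shows that no \<open>\<iota> g\<close> with \<open>g \<notin> \<Lambda>\<close> lies in the closed span
  of \<open>\<Lambda>\<close>, so equality forces \<open>\<Lambda>\<close> to be normal. If \<open>\<Lambda>\<close> is normal, then modulo the null ideal of this
  state the fundamental matrix of \<open>G\<close> has the form \<open>diag(v, 1)\<close>, hence by the universality of \<open>U\<^sub>k\<^sup>+\<close> the
  state descends to \<open>\<omega>\<close> on \<open>C(H)\<close>. The slice map \<open>(\<omega> \<otimes> id) (\<pi> \<otimes> id) \<Delta>\<close> is the identity on \<open>C(G/H)\<close>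
  and takes values in the closed span of \<open>\<Lambda>\<close>.

  This uses that *-homomorphisms and slice maps are contractive, which rests on the existence of
  norming states. Positivity is treated without spectral theory: \<open>a\<close> is positive if \<open>a\<close> is
  selfadjoint and \<open>\<parallel>t - a\<parallel> \<le> t\<close> for some \<open>t\<close>, equivalently if it is the square of a selfadjoint
  element, by the power series of the square root.
\<close>

section \<open>Positive elements of C*-algebras\<close>

text \<open>The universal properties are given through C*-seminorms on polynomials, so a state is
  transported by the operator seminorm of its GNS representation, computed without forming a Hilbert
  space or a quotient algebra. If this seminorm kills the relations, it lies below the universal
  norm.

  \<open>C(H)\<close> is never identified with a group C*-algebra. It is known only through the
  kernel of \<open>\<rho>\<close>, used in both directions: it contains the kernel of
  \<open>\<pi>\<^sub>V\<close>, which trivialises the generators of \<open>\<Lambda>\<close>, and it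
  is no larger than the sum of the two kernels, which lets the state descend.

  Normality decides whether \<open>\<iota> h - 1\<close> is in the null ideal. For any subgroup
  containing \<open>h\<close> it is in the left kernel of the state, but its operator seminorm
  vanishes only if this persists after multiplication by arbitrary elements on the right, which
  amounts to invariance under conjugation.

  The slice map is estimated on finite sums only. Elements of \<open>C(G/H)\<close> are approximated
  by such sums, so no slice map on the completed tensor product is constructed.\<close>

instance cstar_algebra \<subseteq> banach ..

section \<open>Calculus of the involution and of complex scalars\<close>

lemma star_zero [simp]: "star (0::'a::cstar_algebra) = 0"
  using star_add[of "0::'a" 0] by simp

lemma star_uminus [simp]: "star (- x) = - star (x::'a::cstar_algebra)"
  using star_add[of x "- x"] by (simp add: minus_unique)

lemma star_diff: "star (x - y) = star x - star (y::'a::cstar_algebra)"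
  using star_add[of x "- y"] by simp

lemma star_one [simp]: "star (1::'a::cstar_algebra) = 1"
  using star_mult[of 1 "star (1::'a)"] by (simp add: star_star)

lemma star_scaleR: "star (r *\<^sub>R x) = r *\<^sub>R star (x::'a::cstar_algebra)"
  using star_scaleC[of "complex_of_real r" x] by (simp add: scaleC_of_real)

lemma star_of_real [simp]: "star (of_real r) = (of_real r :: 'a::cstar_algebra)"
  by (simp add: of_real_def star_scaleR)

lemma scaleC_one [simp]: "1 *\<^sub>C x = (x::'a::cstar_algebra)"
  using scaleC_of_real[of 1 x] by simp

lemma scaleC_zero_left [simp]: "0 *\<^sub>C x = (0::'a::cstar_algebra)"
  using scaleC_of_real[of 0 x] by simp

lemma scaleC_zero_right [simp]: "a *\<^sub>C 0 = (0::'a::cstar_algebra)"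
  using scaleC_add_right[of a "0::'a" 0] by simp

lemma scaleC_minus_right: "a *\<^sub>C (- x) = - (a *\<^sub>C (x::'a::cstar_algebra))"
  using scaleC_add_right[of a x "- x"] by (simp add: minus_unique)

lemma scaleC_minus_left: "(- a) *\<^sub>C x = - (a *\<^sub>C (x::'a::cstar_algebra))"
  using scaleC_add_left[of a "- a" x] by (simp add: minus_unique)

lemma scaleC_diff_right: "a *\<^sub>C (x - y) = a *\<^sub>C x - a *\<^sub>C (y::'a::cstar_algebra)"
  using scaleC_add_right[of a x "- y"] by (simp add: scaleC_minus_right)

lemma norm_star [simp]: "norm (star x) = norm (x::'a::cstar_algebra)"
proof -
  have le: "norm y \<le> norm (star y)" for y :: 'a
  proof -
    have "norm y * norm y \<le> norm (star y) * norm y"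
      using norm_star_mult[of y] norm_mult_ineq[of "star y" y] by (simp add: power2_eq_square)
    then show ?thesis
      by (cases "norm y = 0") auto
  qed
  show ?thesis
    using le[of x] le[of "star x"] by (simp add: star_star)
qed

lemma bounded_linear_star: "bounded_linear (star :: 'a::cstar_algebra \<Rightarrow> 'a)"
  by (rule bounded_linear_intro[of _ 1]) (auto simp: star_add star_scaleR)

lemma norm_square_selfadjoint: "star h = h \<Longrightarrow> norm (h * h) = (norm (h::'a::cstar_algebra))\<^sup>2"
  using norm_star_mult[of h] by simp

lemma norm_mult_star: "norm (x * star x) = (norm (x::'a::cstar_algebra))\<^sup>2"
  using norm_star_mult[of "star x"] by (simp add: star_star)

lemma star_power: "star (x ^ m) = star (x::'a::cstar_algebra) ^ m"
  by (induction m) (auto simp: star_mult power_commutes)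

text \<open>The Taylor coefficients of \<open>1 - sqrt (1 - z)\<close>, which solves \<open>y = (z + y\<^sup>2) / 2\<close>.\<close>

fun sqrt_coeff :: "nat \<Rightarrow> real" where
  "sqrt_coeff 0 = 0"
| "sqrt_coeff (Suc 0) = 1 / 2"
| "sqrt_coeff (Suc (Suc m)) = (\<Sum>i\<le>m. sqrt_coeff (Suc i) * sqrt_coeff (Suc (m - i))) / 2"

text \<open>Comparison of coefficients in \<open>y\<^sup>2 = 2 y - z\<close>; the exception at
  \<open>m = 1\<close> is the term \<open>z\<close>.\<close>

lemma sqrt_coeff_convolution:
  "(\<Sum>i\<le>m. sqrt_coeff i * sqrt_coeff (m - i)) = 2 * sqrt_coeff m - (if m = 1 then 1 else 0)"
proof (cases m rule: sqrt_coeff.cases)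
  case (3 l)
  have "(\<Sum>i\<le>Suc (Suc l). sqrt_coeff i * sqrt_coeff (Suc (Suc l) - i)) =
      (\<Sum>i\<le>Suc l. sqrt_coeff (Suc i) * sqrt_coeff (Suc l - i))"
    by (subst sum.atMost_Suc_shift) simp
  also have "\<dots> = (\<Sum>i\<le>l. sqrt_coeff (Suc i) * sqrt_coeff (Suc (l - i)))"
    by (auto intro!: sum.cong simp: Suc_diff_le)
  finally show ?thesis
    using 3 by simp
qed auto

lemma sqrt_coeff_nonneg: "0 \<le> sqrt_coeff m"
  by (induction m rule: sqrt_coeff.induct) (auto intro!: sum_nonneg)

text \<open>The partial sums satisfy \<open>2 S' \<le> S\<^sup>2 + 1\<close>, where
  \<open>S'\<close> follows \<open>S\<close>, so the bound 1 propagates. It is the value of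
  \<open>1 - sqrt (1 - z)\<close> at \<open>z = 1\<close>.\<close>

lemma sqrt_coeff_sum_le: "(\<Sum>i\<le>m. sqrt_coeff i) \<le> 1"
proof (induction m)
  case (Suc m)
  let ?b = sqrt_coeff and ?S = "\<Sum>i\<le>m. sqrt_coeff i"
  have "2 * (\<Sum>i\<le>Suc m. ?b i) = (\<Sum>l\<le>Suc m. (\<Sum>i\<le>l. ?b i * ?b (l - i))) + 1"
    by (simp only: sqrt_coeff_convolution sum_subtractf sum_distrib_left[symmetric]) simp
  also have "(\<Sum>l\<le>Suc m. (\<Sum>i\<le>l. ?b i * ?b (l - i))) =
      (\<Sum>(l, i)\<in>(SIGMA l:{..Suc m}. {..l}). ?b i * ?b (l - i))"
    by (rule sum.Sigma) auto
  \<comment> \<open>The terms with \<open>i = 0\<close> or \<open>i = l\<close> vanish because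
    \<open>sqrt_coeff 0 = 0\<close>. Without them both \<open>i\<close> and \<open>l - i\<close> are
    at most \<open>m\<close>, so the triangle embeds into the square of the previous partial
    sum.\<close>
  also have "\<dots> = (\<Sum>(l, i)\<in>{(l, i). l \<le> Suc m \<and> 0 < i \<and> i < l}. ?b i * ?b (l - i))"
  proof (rule sum.mono_neutral_right)
    have z: "?b i * ?b (l - i) = 0" if "i \<le> l" "\<not> (0 < i \<and> i < l)" for i l
      using that by (cases "i = 0") auto
    show "\<forall>x\<in>(SIGMA l:{..Suc m}. {..l}) - {(l, i). l \<le> Suc m \<and> 0 < i \<and> i < l}.
        (\<lambda>(l, i). ?b i * ?b (l - i)) x = 0"
      unfolding split_beta by (intro ballI z) auto
  qed auto
  also have "\<dots> = (\<Sum>(i, j)\<in>(\<lambda>(l, i). (i, l - i)) ` {(l, i). l \<le> Suc m \<and> 0 < i \<and> i < l}. ?b i * ?b j)"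
    by (subst sum.reindex) (auto simp: inj_on_def case_prod_beta)
  also have "\<dots> \<le> (\<Sum>(i, j)\<in>{..m} \<times> {..m}. ?b i * ?b j)"
    by (rule sum_mono2) (auto simp: sqrt_coeff_nonneg)
  also have "\<dots> = ?S * ?S"
    by (simp add: sum_product sum.cartesian_product)
  also have "\<dots> \<le> 1 * 1"
    by (rule mult_mono) (use Suc in \<open>auto intro!: sum_nonneg sqrt_coeff_nonneg\<close>)
  finally show ?case
    by simp
qed simp

lemma summable_sqrt_coeff: "summable sqrt_coeff"
  by (rule bounded_imp_summable[OF sqrt_coeff_nonneg sqrt_coeff_sum_le])

lemma suminf_sqrt_coeff_le: "suminf sqrt_coeff \<le> 1"
proof (rule suminf_le_const[OF summable_sqrt_coeff])
  show "sum sqrt_coeff {..<m} \<le> 1" for m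
    using sqrt_coeff_sum_le[of "m - 1"] by (cases m) (auto simp: lessThan_Suc_atMost)
qed

section \<open>The cone of positive elements and square roots\<close>

definition pos :: "'a::cstar_algebra \<Rightarrow> bool" where
  "pos a \<longleftrightarrow> star a = a \<and> (\<exists>t. norm (of_real t - a) \<le> t)"

lemma pos_selfadjoint: "pos a \<Longrightarrow> star a = a"
  by (simp add: pos_def)

text \<open>This is the advantage of the norm criterion: witnesses simply add up in the triangle
  inequality, whereas a sum of squares is not visibly a square.\<close>

lemma pos_add: "pos a \<Longrightarrow> pos b \<Longrightarrow> pos (a + b)"
proof (unfold pos_def, safe)
  fix t s assume "norm (of_real t - a) \<le> t" "norm (of_real s - b) \<le> s"
  then have "norm (of_real (t + s) - (a + b)) \<le> t + s"
    using norm_triangle_ineq[of "of_real t - a" "of_real s - b"] by (simp add: algebra_simps)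
  then show "\<exists>t. norm (of_real t - (a + b)) \<le> t"
    by blast
qed (simp_all add: star_add)

lemma pos_scaleR: "pos a \<Longrightarrow> 0 \<le> r \<Longrightarrow> pos (r *\<^sub>R a)"
proof (unfold pos_def, safe)
  fix t assume r: "0 \<le> r" and "norm (of_real t - a) \<le> t"
  then have "norm (r *\<^sub>R (of_real t - a)) \<le> r * t"
    by (simp add: mult_left_mono)
  then have "norm (of_real (r * t) - r *\<^sub>R a) \<le> r * t"
    by (simp add: scaleR_diff_right of_real_def)
  then show "\<exists>t. norm (of_real t - r *\<^sub>R a) \<le> t"
    by blast
qed (simp_all add: star_scaleR)

lemma pos_of_real_iff: "pos (of_real r :: 'a::cstar_algebra) \<longleftrightarrow> 0 \<le> r"
proof -
  have "norm (of_real t - of_real r :: 'a) = \<bar>t - r\<bar>" for t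
    by (metis norm_of_real of_real_diff)
  then show ?thesis
    unfolding pos_def by (auto intro!: exI[of _ r])
qed

lemma pos_diff_of_norm_le:
  assumes "star a = a" "norm a \<le> r"
  shows "pos (of_real r - a)"
proof -
  have "star (of_real r - a) = of_real r - a" "norm (of_real r - (of_real r - a)) \<le> r"
    using assms by (simp_all add: star_diff)
  then show ?thesis
    unfolding pos_def by blast
qed

text \<open>The root is \<open>1 - y\<close> with \<open>y\<close> the power series at
  \<open>x = 1 - a\<close>. It converges absolutely on the closed unit ball because the coefficients
  are summable, and as a limit of polynomials in \<open>a\<close> it commutes with whatever commutes
  with \<open>a\<close>.\<close>

lemma sqrt_aux:
  fixes a :: "'a::cstar_algebra"
  assumes a: "star a = a" "norm (1 - a) \<le> 1"
  shows "\<exists>h. pos h \<and> h * h = a \<and> (\<forall>z. z * a = a * z \<longrightarrow> z * h = h * z)"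
proof -
  define x where "x = 1 - a"
  define f where "f = (\<lambda>m. sqrt_coeff m *\<^sub>R x ^ m)"
  have x: "star x = x" "norm x \<le> 1"
    using a by (auto simp: x_def star_diff)
  have f_le: "norm (f m) \<le> sqrt_coeff m" for m
  proof -
    have "norm (x ^ m) \<le> 1"
      using norm_power_ineq[of x m] power_le_one[of "norm x" m] x(2) by simp
    then show ?thesis
      by (simp add: f_def sqrt_coeff_nonneg mult_left_le)
  qed
  have nf: "summable (\<lambda>m. norm (f m))"
    by (rule summable_comparison_test'[OF summable_sqrt_coeff, of 0]) (use f_le in auto)
  then have sf: "summable f"
    by (rule summable_norm_cancel)
  define y where "y = suminf f"
  have norm_y: "norm y \<le> 1"
  proof -
    have "norm y \<le> suminf (\<lambda>m. norm (f m))"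
      unfolding y_def by (rule summable_norm[OF nf])
    also have "\<dots> \<le> suminf sqrt_coeff"
      by (rule suminf_le[OF f_le nf summable_sqrt_coeff])
    finally show ?thesis
      using suminf_sqrt_coeff_le by simp
  qed
  have "star y = suminf (\<lambda>m. star (f m))"
    unfolding y_def by (rule bounded_linear.suminf[OF bounded_linear_star sf])
  then have star_y: "star y = y"
    by (simp add: y_def f_def star_scaleR star_power x)
  have "y * y = suminf (\<lambda>m. \<Sum>i\<le>m. f i * f (m - i))"
    unfolding y_def by (rule Cauchy_product[OF nf nf])
  also have "(\<lambda>m. \<Sum>i\<le>m. f i * f (m - i)) = (\<lambda>m. 2 *\<^sub>R f m - (if m = 1 then x else 0))"
  proof
    fix m
    have "(\<Sum>i\<le>m. f i * f (m - i)) = (\<Sum>i\<le>m. (sqrt_coeff i * sqrt_coeff (m - i)) *\<^sub>R x ^ m)"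
      by (rule sum.cong) (auto simp: f_def power_add[symmetric])
    also have "\<dots> = (2 * sqrt_coeff m - (if m = 1 then 1 else 0)) *\<^sub>R x ^ m"
      by (simp add: sqrt_coeff_convolution flip: scaleR_sum_left)
    finally show "(\<Sum>i\<le>m. f i * f (m - i)) = 2 *\<^sub>R f m - (if m = 1 then x else 0)"
      by (auto simp: f_def scaleR_diff_left)
  qed
  also have "suminf \<dots> = 2 *\<^sub>R y - x"
  proof (rule sums_unique[symmetric], rule sums_diff)
    show "(\<lambda>m. 2 *\<^sub>R f m) sums (2 *\<^sub>R y)"
      unfolding y_def by (intro sums_scaleR_right summable_sums sf)
    show "(\<lambda>m. if m = 1 then x else 0) sums x"
      using sums_single[of 1 "\<lambda>_. x"] by simp
  qed
  finally have yy: "y * y = 2 *\<^sub>R y - x" .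
  \<comment> \<open>The witness is \<open>t = 1\<close>, since \<open>1 - (1 - y) = y\<close> has
    norm at most 1.\<close>
  have "pos (1 - y)"
    unfolding pos_def using norm_y star_y by
      (metis star_diff star_one diff_diff_eq2 add_diff_cancel_left' of_real_1)
  moreover have "(1 - y) * (1 - y) = a"
    by (simp add: algebra_simps yy x_def scaleR_2)
  moreover have "z * (1 - y) = (1 - y) * z" if "z * a = a * z" for z
  proof -
    have zx: "z * x = x * z"
      using that by (simp add: x_def algebra_simps)
    have zxm: "z * x ^ m = x ^ m * z" for m
      by (induction m) (simp_all add: zx, metis mult.assoc zx)
    have "z * y = suminf (\<lambda>m. z * f m)"
      unfolding y_def by (rule suminf_mult[OF sf, symmetric])
    also have "\<dots> = suminf (\<lambda>m. f m * z)"
      by (simp add: f_def zxm)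
    also have "\<dots> = y * z"
      unfolding y_def by (rule suminf_mult2[OF sf, symmetric])
    finally show ?thesis
      by (simp add: algebra_simps)
  qed
  ultimately show ?thesis
    by blast
qed

text \<open>Rescaling by the witness \<open>t\<close> leads to the unit ball. The commutation clause
  takes the place of functional calculus: it makes roots commute with each other later.\<close>

lemma pos_sqrt:
  fixes a :: "'a::cstar_algebra"
  assumes "pos a"
  obtains h where "pos h" "h * h = a" "\<And>z. z * a = a * z \<Longrightarrow> z * h = h * z"
proof -
  obtain t where t: "norm (of_real t - a) \<le> t" and sa: "star a = a"
    using assms by (auto simp: pos_def)
  have "0 \<le> t"
    using t norm_ge_zero order_trans by blast
  show ?thesis
  proof (cases "t = 0")
    case True
    then have "a = 0"
      using t by simp
    then show ?thesis
      using that[of 0] pos_of_real_iff[of 0, where 'a='a] by simp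
  next
    case False
    with \<open>0 \<le> t\<close> have "0 < t"
      by simp
    define b where "b = (1 / t) *\<^sub>R a"
    have "norm ((1 / t) *\<^sub>R (of_real t - a)) \<le> 1"
      using t \<open>0 < t\<close> by simp
    then have "norm (1 - b) \<le> 1"
      using \<open>0 < t\<close> by (simp add: b_def scaleR_diff_right of_real_def)
    moreover have "star b = b"
      by (simp add: b_def star_scaleR sa)
    ultimately obtain h where h: "pos h" "h * h = b" "\<And>z. z * b = b * z \<Longrightarrow> z * h = h * z"
      using sqrt_aux by blast
    show ?thesis
    proof (rule that[of "sqrt t *\<^sub>R h"])
      show "pos (sqrt t *\<^sub>R h)"
        using h(1) \<open>0 < t\<close> by (simp add: pos_scaleR)
      show "(sqrt t *\<^sub>R h) * (sqrt t *\<^sub>R h) = a"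
        using \<open>0 < t\<close> by (simp add: h(2) b_def)
      show "z * (sqrt t *\<^sub>R h) = (sqrt t *\<^sub>R h) * z" if "z * a = a * z" for z
        using h(3)[of z] that by (simp add: b_def)
    qed
  qed
qed

text \<open>This follows from \<open>(h + \<i> k)* (h + \<i> k) = h\<^sup>2 + k\<^sup>2\<close>.\<close>

lemma norm_le_sum_squares:
  fixes h k :: "'a::cstar_algebra"
  assumes "star h = h" "star k = k" "h * k = k * h"
  shows "(norm h)\<^sup>2 \<le> norm (h * h + k * k)"
proof -
  define u where "u = h + \<i> *\<^sub>C k"
  have star_u: "star u = h - \<i> *\<^sub>C k"
    by (simp add: u_def star_add star_scaleC assms scaleC_minus_left)
  have "star u * u = h * h + k * k"
    unfolding star_u
    by (simp add: u_def algebra_simps mult_scaleC_left mult_scaleC_right scaleC_scaleC assms(3)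
        scaleC_minus_left scaleC_diff_right scaleC_add_right)
  then have nu: "(norm u)\<^sup>2 = norm (h * h + k * k)"
    using norm_star_mult[of u] by simp
  have "2 *\<^sub>R h = u + star u"
    by (simp add: star_u) (simp add: u_def scaleR_2)
  then have "2 * norm h \<le> norm u + norm (star u)"
    by (metis norm_scaleR norm_triangle_ineq abs_numeral)
  then have "norm h \<le> norm u"
    by simp
  then show ?thesis
    using nu by (metis norm_ge_zero power_mono)
qed

text \<open>Converse to \<open>pos_sqrt\<close>: \<open>t - h * h\<close> has a root
  \<open>k\<close> commuting with \<open>h\<close>, and \<open>norm_le_sum_squares\<close> bounds
  the norm of \<open>k * k\<close> by that of \<open>k * k + h * h = t\<close>.\<close>

lemma norm_diff_square_le:
  fixes h :: "'a::cstar_algebra"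
  assumes "star h = h" "(norm h)\<^sup>2 \<le> t"
  shows "norm (of_real t - h * h) \<le> t"
proof (cases "t = 0")
  case False
  then have t: "0 < t"
    using assms(2) zero_le_power2[of "norm h"] by linarith
  have "pos (of_real t - h * h)"
    using pos_diff_of_norm_le[of "h * h" t] assms by (simp add: star_mult norm_square_selfadjoint)
  then obtain k where k: "pos k" "k * k = of_real t - h * h"
    "\<And>z. z * (of_real t - h * h) = (of_real t - h * h) * z \<Longrightarrow> z * k = k * z"
    using pos_sqrt by blast
  have "h * k = k * h"
    by (rule k(3)) (simp add: algebra_simps of_real_def)
  then have "(norm k)\<^sup>2 \<le> norm (k * k + h * h)"
    using norm_le_sum_squares[of k h] assms k(1) by (auto simp: pos_def)
  then show ?thesis
    using k(2) t norm_square_selfadjoint[OF pos_selfadjoint[OF k(1)]] by simp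
qed (use assms in auto)

lemma pos_square:
  fixes h :: "'a::cstar_algebra"
  assumes "star h = h"
  shows "pos (h * h)"
proof -
  have "star (h * h) = h * h"
    by (simp add: star_mult assms)
  moreover have "norm (of_real ((norm h)\<^sup>2) - h * h) \<le> (norm h)\<^sup>2"
    by (rule norm_diff_square_le[OF assms order_refl])
  ultimately show ?thesis
    unfolding pos_def by blast
qed

text \<open>So the norm itself always serves as the witness in \<open>pos\<close>.\<close>

lemma pos_norm_diff_le:
  fixes a :: "'a::cstar_algebra"
  assumes "pos a"
  shows "norm (of_real (norm a) - a) \<le> norm a"
proof -
  obtain h where h: "pos h" "h * h = a"
    using pos_sqrt[OF assms] by blast
  then have "norm a = (norm h)\<^sup>2"
    using norm_square_selfadjoint[OF pos_selfadjoint[OF h(1)]] by simp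
  then show ?thesis
    using norm_diff_square_le[OF pos_selfadjoint[OF h(1)], of "norm a"] h(2) by simp
qed

text \<open>Roots of commuting positive elements commute, by the commutation clause used once for
  each of them, so this is \<open>norm_le_sum_squares\<close> for the roots.\<close>

lemma pos_norm_mono:
  fixes a b :: "'a::cstar_algebra"
  assumes "pos a" "pos b" "a * b = b * a"
  shows "norm a \<le> norm (a + b)"
proof -
  obtain h where h: "pos h" "h * h = a" "\<And>z. z * a = a * z \<Longrightarrow> z * h = h * z"
    using pos_sqrt assms by blast
  obtain k where k: "pos k" "k * k = b" "\<And>z. z * b = b * z \<Longrightarrow> z * k = k * z"
    using pos_sqrt assms by blast
  have "b * h = h * b"
    using h(3) assms(3) by metis
  then have "h * k = k * h"
    using k(3) by metis
  then show ?thesis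
    using norm_le_sum_squares[of h k] norm_square_selfadjoint[OF pos_selfadjoint[OF h(1)]]
      pos_selfadjoint[OF h(1)] pos_selfadjoint[OF k(1)] by (simp add: h(2) k(2))
qed

lemma norm_le_if_pos_diff:
  fixes a :: "'a::cstar_algebra"
  assumes "pos a" "pos (of_real r - a)"
  shows "norm a \<le> r"
proof -
  have "pos (of_real r :: 'a)"
    using pos_add[OF assms] by simp
  then have "0 \<le> r"
    by (simp add: pos_of_real_iff)
  then show ?thesis
    using pos_norm_mono[OF assms] by (simp add: algebra_simps of_real_def)
qed

text \<open>The spectrum of \<open>y* y\<close> would be negative and that of \<open>y y*\<close> positive. Instead of comparing
  the spectra, we compare the norms of \<open>p (y* y) y* y\<close> and \<open>y* p (y y*) y\<close> for \<open>p z = t - z\<close>.\<close>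

lemma star_mult_eq_zero_if_neg:
  fixes y :: "'a::cstar_algebra"
  assumes a: "pos a" and y: "star y * y = - a" and yy: "pos (y * star y)"
  shows "y = 0"
proof -
  define t where "t = (norm y)\<^sup>2"
  have "0 \<le> t"
    by (simp add: t_def)
  have norm_a: "norm a = t"
    using norm_star_mult[of y] y by (simp add: t_def)
  have "norm (of_real t - y * star y) \<le> t"
    using pos_norm_diff_le[OF yy] by (simp add: norm_mult_star t_def)
  then have "norm (star y * (of_real t - y * star y) * y) \<le> norm y * t * norm y"
    by (intro order_trans[OF norm_mult_ineq] mult_mono) (auto simp: t_def)
  also have "norm y * t * norm y = t\<^sup>2"
    by (simp add: t_def power2_eq_square)
  \<comment> \<open>Moving \<open>y\<close> through the polynomial turns the estimate for
    \<open>y * star y\<close> into one for \<open>star y * y = - a\<close>, where it is too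
    strong.\<close>
  also have "star y * (of_real t - y * star y) * y = t *\<^sub>R (star y * y) - (star y * y) * (star y * y)"
    by (simp add: algebra_simps of_real_def)
  also have "\<dots> = - (t *\<^sub>R a + a * a)"
    by (simp add: y)
  finally have le: "norm (t *\<^sub>R a + a * a) \<le> t\<^sup>2"
    by (simp only: norm_minus_cancel)
  \<comment> \<open>Completing the square: \<open>b * b\<close> is
    \<open>t *\<^sub>R a + a * a\<close> plus \<open>t\<^sup>2 / 4\<close>, so its norm is at most
    \<open>5/4 t\<^sup>2\<close>. On the other hand \<open>norm a = t\<close> with \<open>a\<close>
    positive forces \<open>norm b \<ge> 3/2 t\<close>, hence
    \<open>9/4 t\<^sup>2 \<le> 5/4 t\<^sup>2\<close>.\<close>
  define b where "b = a + of_real (t / 2)"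
  have b: "star b = b"
    by (simp add: b_def star_add pos_selfadjoint[OF a] del: of_real_divide)
  have "b * b = (t *\<^sub>R a + a * a) + of_real (t\<^sup>2 / 4)"
    by (simp add: b_def of_real_def algebra_simps power2_eq_square flip: scaleR_add_left)
  then have "norm (b * b) \<le> t\<^sup>2 + norm (of_real (t\<^sup>2 / 4) :: 'a)"
    using norm_triangle_ineq[of "t *\<^sub>R a + a * a" "of_real (t\<^sup>2 / 4)"] le by (simp del: of_real_divide)
  then have nb: "(norm b)\<^sup>2 \<le> 5 / 4 * t\<^sup>2"
    by (simp add: norm_square_selfadjoint[OF b] del: of_real_divide)
  have "pos (of_real (norm b - t / 2) - a)"
    using pos_diff_of_norm_le[OF b order_refl] by (simp add: b_def algebra_simps)
  then have "t \<le> norm b - t / 2"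
    using norm_le_if_pos_diff[OF a] norm_a by metis
  then have "(3 / 2 * t)\<^sup>2 \<le> (norm b)\<^sup>2"
    using \<open>0 \<le> t\<close> by (intro power_mono) auto
  with nb have "t\<^sup>2 \<le> 0"
    by (simp add: power2_eq_square)
  then show ?thesis
    by (simp add: t_def)
qed

text \<open>Kaplansky's argument. With \<open>k\<close> the absolute value of
  \<open>h = star x * x\<close>, the element \<open>c = k - h\<close> is twice the negative part of
  \<open>h\<close>. For \<open>y = x * c\<close> the product \<open>star y * y\<close> is minus a
  square, so \<open>y = 0\<close>, and this forces \<open>c = 0\<close>, that is
  \<open>h = k\<close>.\<close>

theorem pos_star_mult: "pos (star x * (x::'a::cstar_algebra))"
proof -
  define h where "h = star x * x"
  have sh: "star h = h"
    by (simp add: h_def star_mult star_star)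
  obtain k where k: "pos k" "k * k = h * h" "\<And>z. z * (h * h) = h * h * z \<Longrightarrow> z * k = k * z"
    using pos_sqrt[OF pos_square[OF sh]] by blast
  \<comment> \<open>The root \<open>m\<close> of \<open>k\<close> is needed to write
    \<open>c * k * c\<close> as the square of the selfadjoint element \<open>m * c\<close>.\<close>
  obtain m where m: "pos m" "m * m = k" "\<And>z. z * k = k * z \<Longrightarrow> z * m = m * z"
    using pos_sqrt[OF k(1)] by blast
  have hk: "h * k = k * h"
    by (rule k(3)) (simp add: mult.assoc)
  define c where "c = k - h"
  have sc: "star c = c"
    by (simp add: c_def star_diff sh pos_selfadjoint[OF k(1)])
  have ck: "c * k = k * c"
    by (simp add: c_def algebra_simps hk)
  then have cm: "c * m = m * c"
    by (rule m(3))
  have hc: "h * c = - (k * c)"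
    by (simp add: c_def algebra_simps hk k(2))
  define d where "d = m * c"
  have sd: "star d = d"
    by (simp add: d_def star_mult sc pos_selfadjoint[OF m(1)] cm)
  define y where "y = x * c"
  have "star y * y = c * h * c"
    by (simp add: y_def star_mult sc h_def mult.assoc)
  also have "\<dots> = - (c * k * c)"
    by (simp add: mult.assoc hc)
  also have "c * k * c = d * d"
    by (simp add: d_def m(2)[symmetric] mult.assoc) (metis cm mult.assoc)
  finally have yy: "star y * y = - (d * d)" .
  \<comment> \<open>Twice the real and the imaginary part of \<open>y\<close>:
    \<open>p * p + q * q\<close> is twice the sum of \<open>y * star y\<close> and
    \<open>star y * y\<close>. As \<open>star y * y\<close> is \<open>- (d * d)\<close>, this
    displays \<open>y * star y\<close> as a sum of squares.\<close>
  define p where "p = y + star y"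
  define q where "q = \<i> *\<^sub>C (star y - y)"
  have pq: "star p = p" "star q = q"
    by (simp_all add: p_def q_def star_add star_diff star_scaleC star_star add.commute
        scaleC_minus_left flip: scaleC_minus_right)
  have "q * q = - ((star y - y) * (star y - y))"
    by (simp add: q_def mult_scaleC_left mult_scaleC_right scaleC_scaleC scaleC_minus_left)
  then have "p * p + q * q = 2 *\<^sub>R (y * star y) + 2 *\<^sub>R (star y * y)"
    by (simp add: p_def algebra_simps scaleR_2)
  then have "y * star y = (1 / 2) *\<^sub>R (p * p + q * q) + d * d"
    by (simp add: yy scaleR_diff_right)
  then have "pos (y * star y)"
    using pos_square[OF pq(1)] pos_square[OF pq(2)] pos_square[OF sd]
    by (simp add: pos_add pos_scaleR del: scaleR_add_right)
  then have "y = 0"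
    using star_mult_eq_zero_if_neg[OF pos_square[OF sd] yy] by blast
  then have "d * d = 0"
    using yy by simp
  then have "d = 0"
    using norm_square_selfadjoint[OF sd] by simp
  then have "k * c = 0"
    by (simp add: m(2)[symmetric] mult.assoc d_def)
  moreover from this hc have "h * c = 0"
    by simp
  ultimately have "c * c = 0"
    by (simp add: c_def algebra_simps)
  then have "c = 0"
    using norm_square_selfadjoint[OF sc] by simp
  then show ?thesis
    using k(1) by (simp add: c_def h_def)
qed

section \<open>The Hahn-Banach theorem and states\<close>

definition sublinear :: "('a::real_vector \<Rightarrow> real) \<Rightarrow> bool" where
  "sublinear q \<longleftrightarrow> (\<forall>x y. q (x + y) \<le> q x + q y) \<and> (\<forall>r>0. \<forall>x. q (r *\<^sub>R x) \<le> r * q x)"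

lemma sublinear_scaleR:
  assumes "sublinear q" "0 \<le> r"
  shows "q (r *\<^sub>R x) = r * q x"
proof -
  have pos: "q (r *\<^sub>R x) = r * q x" if "0 < r" for r x
  proof (rule antisym)
    have "q ((1 / r) *\<^sub>R r *\<^sub>R x) \<le> 1 / r * q (r *\<^sub>R x)"
      using assms(1) that unfolding sublinear_def by (metis zero_less_divide_1_iff)
    then show "r * q x \<le> q (r *\<^sub>R x)"
      using that by (simp add: field_simps)
  qed (use assms that in \<open>auto simp: sublinear_def\<close>)
  have "q 0 = 0"
    using pos[of 2 0] by simp
  then show ?thesis
    using pos[of r x] assms(2) by (cases "r = 0") auto
qed

lemma sublinear_zero: "sublinear q \<Longrightarrow> q 0 = 0"
  using sublinear_scaleR[of q 0 0] by simp

lemma sublinear_neg: "sublinear q \<Longrightarrow> - q (- x) \<le> q x"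
  using sublinear_zero[of q] unfolding sublinear_def by (metis add.right_inverse minus_le_iff
      le_minus_iff add_increasing2 diff_ge_0_iff_ge diff_minus_eq_add)

text \<open>Lowers \<open>q\<close> so as to force the value at \<open>y\<close> of every linear functional below it to be at
  least \<open>s\<close>, for all \<open>(y, s)\<close> in the cone \<open>K\<close>.\<close>

lemma sublinear_lower:
  fixes q :: "'a::real_vector \<Rightarrow> real" and K :: "('a \<times> real) set"
  assumes q: "sublinear q" and K: "cone K" "\<And>u v. u \<in> K \<Longrightarrow> v \<in> K \<Longrightarrow> u + v \<in> K" "K \<noteq> {}"
    and le: "\<And>y s. (y, s) \<in> K \<Longrightarrow> s \<le> q y"
  shows "\<exists>Q. sublinear Q \<and> Q \<le> q \<and> (\<forall>(y, s)\<in>K. Q (- y) \<le> - s)"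
proof -
  \<comment> \<open>For linear \<open>f \<le> q\<close> with \<open>s \<le> f y\<close> one has
    \<open>f x = f (x + y) - f y \<le> q (x + y) - s\<close>; \<open>S x\<close> collects these
    bounds.\<close>
  define S where "S = (\<lambda>x. (\<lambda>(y, s). q (x + y) - s) ` K)"
  define Q where "Q = (\<lambda>x. Inf (S x))"
  have K0: "(0, 0) \<in> K"
    using K(3) cone_contains_0[OF K(1)] by (simp add: zero_prod_def)
  have ne: "S x \<noteq> {}" for x
    using K(3) by (auto simp: S_def)
  have lb: "- q (- x) \<le> z" if z: "z \<in> S x" for x z
  proof -
    obtain y s where ys: "(y, s) \<in> K" "z = q (x + y) - s"
      using z by (auto simp: S_def)
    have "q (- x + (x + y)) \<le> q (- x) + q (x + y)"
      using q unfolding sublinear_def by blast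
    then show ?thesis
      using le[OF ys(1)] ys(2) by simp
  qed
  have bdd: "bdd_below (S x)" for x
    using lb by (intro bdd_belowI)
  have upper: "Q x \<le> q (x + y) - s" if "(y, s) \<in> K" for x y s
    unfolding Q_def using that by (intro cInf_lower bdd) (auto simp: S_def)
  have "sublinear Q"
    unfolding sublinear_def
  proof (intro conjI allI impI)
    fix x x'
    have 1: "Q (x + x') - z' \<le> z" if zz: "z \<in> S x" "z' \<in> S x'" for z z'
    proof -
      obtain y s y' s' where ys: "(y, s) \<in> K" "z = q (x + y) - s"
        "(y', s') \<in> K" "z' = q (x' + y') - s'"
        using zz by (auto simp: S_def)
      have "(y + y', s + s') \<in> K"
        using K(2)[OF ys(1,3)] by simp
      then have "Q (x + x') \<le> q (x + x' + (y + y')) - (s + s')"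
        by (rule upper)
      moreover have "q ((x + y) + (x' + y')) \<le> q (x + y) + q (x' + y')"
        using q unfolding sublinear_def by blast
      ultimately show ?thesis
        using ys by (simp add: algebra_simps)
    qed
    have "Q (x + x') - z' \<le> Q x" if "z' \<in> S x'" for z'
      unfolding Q_def[of] using 1 that ne by (metis Q_def cInf_greatest)
    then have "Q (x + x') - Q x \<le> z'" if "z' \<in> S x'" for z'
      using that by (smt (verit))
    then have "Q (x + x') - Q x \<le> Q x'"
      using ne by (metis Q_def cInf_greatest)
    then show "Q (x + x') \<le> Q x + Q x'"
      by simp
  next
    fix r :: real and x assume r: "0 < r"
    have "Q (r *\<^sub>R x) / r \<le> z" if z: "z \<in> S x" for z
    proof -
      obtain y s where ys: "(y, s) \<in> K" "z = q (x + y) - s"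
        using z by (auto simp: S_def)
      have "r *\<^sub>R (y, s) \<in> K"
        using K(1) ys(1) r by (auto simp: cone_def)
      then have "Q (r *\<^sub>R x) \<le> q (r *\<^sub>R x + r *\<^sub>R y) - r * s"
        by (intro upper) simp
      also have "\<dots> = r * z"
        using sublinear_scaleR[OF q, of r "x + y"] r ys(2) by (simp add: scaleR_add_right right_diff_distrib)
      finally show ?thesis
        using r by (simp add: field_simps)
    qed
    then have "Q (r *\<^sub>R x) / r \<le> Q x"
      using ne by (metis Q_def cInf_greatest)
    then show "Q (r *\<^sub>R x) \<le> r * Q x"
      using r by (simp add: field_simps)
  qed
  moreover have "Q \<le> q"
    using upper[OF K0] by (auto simp: le_fun_def)
  moreover have "Q (- y) \<le> - s" if "(y, s) \<in> K" for y s
    using upper[OF that, of "- y"] sublinear_zero[OF q] by simp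
  ultimately show ?thesis
    by blast
qed

text \<open>Rays are the cones that prescribe a bound at a single point, as in the oddness of a
  minimal sublinear functional and in the construction of norming states.\<close>

lemma ray_cone:
  fixes u :: "'a::real_vector"
  defines "K \<equiv> {t *\<^sub>R u | t. 0 \<le> t}"
  shows "cone K" "\<And>v w. v \<in> K \<Longrightarrow> w \<in> K \<Longrightarrow> v + w \<in> K" "K \<noteq> {}" "u \<in> K"
proof -
  show "cone K"
    unfolding cone_def
  proof (intro ballI allI impI)
    fix v and c :: real assume "v \<in> K" "0 \<le> c"
    then obtain t where "v = t *\<^sub>R u" "0 \<le> t"
      by (auto simp: K_def)
    then have "c *\<^sub>R v = (c * t) *\<^sub>R u" "0 \<le> c * t"
      using \<open>0 \<le> c\<close> by auto
    then show "c *\<^sub>R v \<in> K"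
      unfolding K_def by blast
  qed
  show "v + w \<in> K" if vw: "v \<in> K" "w \<in> K" for v w
  proof -
    obtain t t' where "v = t *\<^sub>R u" "0 \<le> t" "w = t' *\<^sub>R u" "0 \<le> t'"
      using vw by (auto simp: K_def)
    then have "v + w = (t + t') *\<^sub>R u" "0 \<le> t + t'"
      by (auto simp: algebra_simps)
    then show ?thesis
      unfolding K_def by blast
  qed
  show "u \<in> K"
    unfolding K_def by (auto intro: exI[of _ 1])
  then show "K \<noteq> {}"
    by blast
qed

text \<open>The pointwise infimum works: \<open>- p (- x)\<close> bounds it from below, and it is
  subadditive because two members of a chain have a smaller one among them.\<close>

lemma sublinear_chain_lower_bound:
  fixes p :: "'a::real_vector \<Rightarrow> real"
  assumes C: "C \<noteq> {}" "\<And>q. q \<in> C \<Longrightarrow> sublinear q \<and> q \<le> p"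
    and chain: "\<And>q q'. q \<in> C \<Longrightarrow> q' \<in> C \<Longrightarrow> q \<le> q' \<or> q' \<le> q"
  shows "\<exists>m. sublinear m \<and> m \<le> p \<and> (\<forall>q\<in>C. m \<le> q)"
proof -
  define m where "m = (\<lambda>x. INF q\<in>C. q x)"
  have lb: "- p (- x) \<le> q x" if "q \<in> C" for q x
    using C(2)[OF that] sublinear_neg[of q x] by (auto simp: le_fun_def intro: order_trans[rotated])
  have bdd: "bdd_below ((\<lambda>q. q x) ` C)" for x
    using lb by (auto intro!: bdd_belowI)
  have lower: "m x \<le> q x" if "q \<in> C" for q x
    unfolding m_def using that by (intro cINF_lower bdd)
  have greatest: "c \<le> m x" if "\<And>q. q \<in> C \<Longrightarrow> c \<le> q x" for c x
    unfolding m_def using that C(1) by (intro cINF_greatest)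
  have "sublinear m"
    unfolding sublinear_def
  proof (intro conjI allI impI)
    fix x y
    have 1: "m (x + y) \<le> q x + q' y" if qq: "q \<in> C" "q' \<in> C" for q q'
    proof -
      obtain q'' where q'': "q'' \<in> C" "q'' \<le> q" "q'' \<le> q'"
        using chain[OF qq] qq by blast
      have "m (x + y) \<le> q'' x + q'' y"
        using lower[OF q''(1), of "x + y"] C(2)[OF q''(1)]
        unfolding sublinear_def by (meson order_trans)
      then show ?thesis
        using q''(2,3) by (meson add_mono le_funD order_trans)
    qed
    have "m (x + y) - q' y \<le> m x" if "q' \<in> C" for q'
      by (rule greatest) (use 1 that in \<open>simp add: diff_le_eq\<close>)
    then have "m (x + y) - m x \<le> m y"
      by (intro greatest) (simp add: algebra_simps)
    then show "m (x + y) \<le> m x + m y"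
      by simp
  next
    fix r :: real and x assume r: "0 < r"
    have "m (r *\<^sub>R x) / r \<le> q x" if "q \<in> C" for q
    proof -
      have "m (r *\<^sub>R x) \<le> r * q x"
        using lower[OF that, of "r *\<^sub>R x"] C(2)[OF that] r sublinear_scaleR[of q r x] by simp
      then show ?thesis
        using r by (simp add: field_simps)
    qed
    then have "m (r *\<^sub>R x) / r \<le> m x"
      by (rule greatest)
    then show "m (r *\<^sub>R x) \<le> r * m x"
      using r by (simp add: field_simps)
  qed
  moreover have "m \<le> p"
  proof -
    obtain q where "q \<in> C"
      using C(1) by blast
    then show ?thesis
      using C(2)[of q] lower[of q] by (auto simp: le_fun_def intro: order_trans)
  qed
  ultimately show ?thesis
    using lower by (auto simp: le_fun_def)
qed

text \<open>A minimal sublinear functional is odd, since lowering it along the ray through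
  \<open>(b, q b)\<close> cannot change it, and an odd sublinear functional is linear. A cone
  instead of a subspace covers both uses: the graph of a functional to be extended, and a ray for a
  norming functional.\<close>

theorem Hahn_Banach:
  fixes p :: "'a::real_vector \<Rightarrow> real" and K :: "('a \<times> real) set"
  assumes p: "sublinear p" and K: "cone K" "\<And>u v. u \<in> K \<Longrightarrow> v \<in> K \<Longrightarrow> u + v \<in> K" "K \<noteq> {}"
    and le: "\<And>y s. (y, s) \<in> K \<Longrightarrow> s \<le> p y"
  obtains f where "linear f" "\<And>x. f x \<le> p x" "\<And>y s. (y, s) \<in> K \<Longrightarrow> s \<le> f y"
proof -
  obtain Q where Q: "sublinear Q" "Q \<le> p" "\<forall>(y, s)\<in>K. Q (- y) \<le> - s"
    using sublinear_lower[OF assms] by blast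
  define X where "X = {q. sublinear q \<and> q \<le> Q}"
  \<comment> \<open>The order is reversed, so that the maximal element of Zorn's lemma is a minimal
    functional.\<close>
  define r where "r = {(q, q'). q \<in> X \<and> q' \<in> X \<and> q' \<le> q}"
  have field: "Field r = X"
    by (auto simp: r_def Field_def)
  have "\<exists>m\<in>Field r. \<forall>a\<in>Field r. (m, a) \<in> r \<longrightarrow> a = m"
  proof (rule Zorns_po_lemma)
    show "Partial_order r"
      unfolding partial_order_on_def preorder_on_def field
      by (auto simp: r_def refl_on_def trans_def antisym_def)
    fix C assume C: "C \<in> Chains r"
    show "\<exists>u\<in>Field r. \<forall>a\<in>C. (a, u) \<in> r"
    proof (cases "C = {}")
      case True
      then show ?thesis
        using Q(1) field X_def by blast
    next
      case False
      have "C \<subseteq> X" and "\<And>q q'. q \<in> C \<Longrightarrow> q' \<in> C \<Longrightarrow> q \<le> q' \<or> q' \<le> q"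
        using C unfolding Chains_def r_def by blast+
      then show ?thesis
        using sublinear_chain_lower_bound[OF False, of Q] unfolding field
        by (simp add: X_def r_def subset_iff)
    qed
  qed
  then obtain q where q: "sublinear q" "q \<le> Q"
    and min: "\<And>q'. sublinear q' \<Longrightarrow> q' \<le> q \<Longrightarrow> q' = q"
    unfolding field unfolding X_def r_def by (force intro: order_trans)
  have odd: "q (- b) = - q b" for b
  proof -
    define K' where "K' = {t *\<^sub>R (b, q b) | t. 0 \<le> t}"
    note ray = ray_cone[where u = "(b, q b)", folded K'_def]
    have "s \<le> q y" if "(y, s) \<in> K'" for y s
      using that sublinear_scaleR[OF q(1)] by (auto simp: K'_def)
    then obtain q' where q': "sublinear q'" "q' \<le> q" "\<forall>(y, s)\<in>K'. q' (- y) \<le> - s"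
      using sublinear_lower[OF q(1) ray(1,2,3)] by blast
    have "q' (- b) \<le> - q b"
      using q'(3) ray(4) by blast
    then have "q (- b) \<le> - q b"
      using min[OF q'(1,2)] by simp
    then show ?thesis
      using sublinear_neg[OF q(1), of b] by simp
  qed
  have "linear q"
  proof (rule linearI)
    fix x y
    have "q (- x + - y) \<le> q (- x) + q (- y)" and "q (x + y) \<le> q x + q y"
      using q(1) unfolding sublinear_def by blast+
    moreover have "- x + - y = - (x + y)"
      by simp
    ultimately show "q (x + y) = q x + q y"
      by (simp only: odd)
  next
    fix r :: real and x
    show "q (r *\<^sub>R x) = r *\<^sub>R q x"
    proof (cases "0 \<le> r")
      case False
      then have "q (- ((- r) *\<^sub>R x)) = - (- r * q x)"
        unfolding odd using sublinear_scaleR[OF q(1), of "- r" x] by simp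
      then show ?thesis
        by simp
    qed (simp add: sublinear_scaleR[OF q(1)])
  qed
  moreover have "q x \<le> p x" for x
    using q(2) Q(2) by (meson le_funD order_trans)
  moreover have "s \<le> q y" if "(y, s) \<in> K" for y s
    using Q(3) that q(2) odd[of y] by (force simp: le_fun_def dest: spec[of _ "- y"])
  ultimately show ?thesis
    using that by blast
qed

section \<open>Complex functionals from their real parts, and norming states\<close>

lemma scaleC_Complex: "a *\<^sub>C x = Re a *\<^sub>R x + Im a *\<^sub>R (\<i> *\<^sub>C (x::'a::cstar_algebra))"
proof -
  have "a = complex_of_real (Re a) + complex_of_real (Im a) * \<i>"
    by (simp add: complex_eq_iff)
  then show ?thesis
    by (metis scaleC_add_left scaleC_scaleC scaleC_of_real)
qed

text \<open>For real-linear \<open>f\<close> this is the unique complex-linear functional with real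
  part \<open>f\<close>.\<close>

definition complexify :: "('a::cstar_algebra \<Rightarrow> real) \<Rightarrow> 'a \<Rightarrow> complex" where
  "complexify f x = Complex (f x) (- f (\<i> *\<^sub>C x))"

lemma complexify_linear:
  fixes f :: "'a::cstar_algebra \<Rightarrow> real"
  assumes "linear f"
  shows "complexify f (x + y) = complexify f x + complexify f y"
    and "complexify f (a *\<^sub>C x) = a * complexify f x"
proof -
  interpret linear f by fact
  show "complexify f (x + y) = complexify f x + complexify f y"
    by (simp add: complexify_def complex_eq_iff scaleC_add_right add)
  have "\<i> *\<^sub>C a *\<^sub>C x = Re a *\<^sub>R (\<i> *\<^sub>C x) + Im a *\<^sub>R (- x)"
    using scaleC_Complex[of a "\<i> *\<^sub>C x"] by (simp add: scaleC_scaleC mult.commute scaleC_minus_left)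
  then have "f (\<i> *\<^sub>C a *\<^sub>C x) = Re a * f (\<i> *\<^sub>C x) - Im a * f x"
    by (simp add: add scale neg del: scaleR_minus_right)
  moreover have "f (a *\<^sub>C x) = Re a * f x + Im a * f (\<i> *\<^sub>C x)"
    by (simp add: scaleC_Complex[of a x] add scale)
  ultimately show "complexify f (a *\<^sub>C x) = a * complexify f x"
    by (simp add: complexify_def complex_eq_iff)
qed

text \<open>The real-linear functionals below \<open>upper_bound\<close> are the real parts of states.\<close>

definition upper_bound :: "'a::cstar_algebra \<Rightarrow> real" where
  "upper_bound x = Inf {r. pos (of_real r - (1 / 2) *\<^sub>R (x + star x))}"

text \<open>These facts make the infimum in \<open>upper_bound\<close> a genuine one; the lower
  bound is \<open>- norm x\<close>.\<close>

lemma upper_bound_set: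
  fixes x :: "'a::cstar_algebra"
  shows "norm x \<in> {r. pos (of_real r - (1 / 2) *\<^sub>R (x + star x))}"
    and "bdd_below {r. pos (of_real r - (1 / 2) *\<^sub>R (x + star x))}"
proof -
  define h where "h = (1 / 2) *\<^sub>R (x + star x)"
  have h: "star h = h"
    by (simp add: h_def star_scaleR star_add star_star add.commute)
  have nh: "norm h \<le> norm x"
    using norm_triangle_ineq[of x "star x"] by (simp add: h_def)
  show "norm x \<in> {r. pos (of_real r - (1 / 2) *\<^sub>R (x + star x))}"
    using pos_diff_of_norm_le[OF h nh] by (simp add: h_def)
  show "bdd_below {r. pos (of_real r - (1 / 2) *\<^sub>R (x + star x))}"
  proof (rule bdd_belowI)
    fix r assume "r \<in> {r. pos (of_real r - (1 / 2) *\<^sub>R (x + star x))}"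
    then have "pos (of_real r - h)"
      by (simp add: h_def)
    moreover have "pos (of_real (norm x) - (- h))"
      by (rule pos_diff_of_norm_le) (use h nh in auto)
    ultimately have "pos (of_real (r + norm x) :: 'a)"
      using pos_add by fastforce
    then show "- norm x \<le> r"
      by (simp only: pos_of_real_iff)
  qed
qed

lemma upper_bound_le: "pos (of_real r - (1 / 2) *\<^sub>R (x + star x)) \<Longrightarrow> upper_bound x \<le> r"
  unfolding upper_bound_def by (rule cInf_lower) (auto intro: upper_bound_set)

lemma upper_bound_greatest:
  "(\<And>r. pos (of_real r - (1 / 2) *\<^sub>R (x + star x)) \<Longrightarrow> c \<le> r) \<Longrightarrow> c \<le> upper_bound x"
  unfolding upper_bound_def by (rule cInf_greatest) (use upper_bound_set(1) in auto)

lemma sublinear_upper_bound: "sublinear (upper_bound :: 'a::cstar_algebra \<Rightarrow> real)"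
  unfolding sublinear_def
proof (intro conjI allI impI)
  fix x y :: 'a
  have 1: "upper_bound (x + y) \<le> r + s"
    if "pos (of_real r - (1 / 2) *\<^sub>R (x + star x))" "pos (of_real s - (1 / 2) *\<^sub>R (y + star y))" for r s
    using pos_add[OF that] by (intro upper_bound_le) (simp add: algebra_simps star_add)
  have "upper_bound (x + y) - s \<le> upper_bound x" if "pos (of_real s - (1 / 2) *\<^sub>R (y + star y))" for s
    by (rule upper_bound_greatest) (use 1 that in \<open>simp add: diff_le_eq\<close>)
  then have "upper_bound (x + y) - upper_bound x \<le> upper_bound y"
    by (intro upper_bound_greatest) (simp add: algebra_simps)
  then show "upper_bound (x + y) \<le> upper_bound x + upper_bound y"
    by simp
next
  fix c :: real and x :: 'a assume c: "0 < c"
  have "upper_bound (c *\<^sub>R x) / c \<le> r" if r: "pos (of_real r - (1 / 2) *\<^sub>R (x + star x))" for r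
  proof -
    have "c *\<^sub>R (of_real r - (1 / 2) *\<^sub>R (x + star x)) =
        of_real (c * r) - (1 / 2) *\<^sub>R (c *\<^sub>R x + star (c *\<^sub>R x))"
      by (simp add: algebra_simps star_scaleR of_real_def)
    then have "upper_bound (c *\<^sub>R x) \<le> c * r"
      using pos_scaleR[OF r, of c] c by (intro upper_bound_le) simp
    then show ?thesis
      using c by (simp add: field_simps)
  qed
  then have "upper_bound (c *\<^sub>R x) / c \<le> upper_bound x"
    by (rule upper_bound_greatest)
  then show "upper_bound (c *\<^sub>R x) \<le> c * upper_bound x"
    using c by (simp add: field_simps)
qed

text \<open>\<open>upper_bound\<close> sees only the selfadjoint part of its argument, so
  \<open>f\<close> vanishes on skew elements and the complexification is real on selfadjoint ones.
  Positivity and \<open>f 1 = 1\<close> come from the bounds at \<open>- x\<close> for positive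
  \<open>x\<close>, and at \<open>1\<close> and \<open>- 1\<close>.\<close>

lemma state_complexify:
  fixes f :: "'a::cstar_algebra \<Rightarrow> real"
  assumes f: "linear f" "\<And>x. f x \<le> upper_bound x"
  shows "state (complexify f)"
proof -
  interpret linear f by fact
  have nonneg: "0 \<le> f x" if x: "star x = x" "pos x" for x
  proof -
    have "upper_bound (- x) \<le> 0"
      by (rule upper_bound_le) (use x in \<open>simp add: scaleR_2[symmetric] flip: scaleR_add_right\<close>)
    then show ?thesis
      using f(2)[of "- x"] neg[of x] by simp
  qed
  have skew: "f x = 0" if x: "star x = - x" for x
  proof -
    have "pos (0::'a)"
      using pos_of_real_iff[of 0, where 'a='a] by simp
    then have "upper_bound x \<le> 0" "upper_bound (- x) \<le> 0"
      by (auto intro!: upper_bound_le simp: x)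
    then show ?thesis
      using f(2)[of x] f(2)[of "- x"] neg[of x] by simp
  qed
  have one: "f 1 = 1"
  proof -
    have "pos (of_real (- 1) - (1 / 2) *\<^sub>R (- 1 + star (- 1 :: 'a)))"
      "pos (of_real 1 - (1 / 2) *\<^sub>R (1 + star (1 :: 'a)))"
      using pos_of_real_iff[of 0, where 'a='a]
      by (auto simp flip: scaleR_2 scaleR_minus_right)
    then have "upper_bound (1::'a) \<le> 1" "upper_bound (- 1 :: 'a) \<le> - 1"
      by (auto intro: upper_bound_le)
    then show ?thesis
      using f(2)[of 1] f(2)[of "- 1"] neg[of 1] by simp
  qed
  have "complexify f (star x * x) \<in> \<real>\<^sub>\<ge>\<^sub>0" for x
    using nonneg[OF _ pos_star_mult] skew[of "\<i> *\<^sub>C (star x * x)"]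
    by (simp add: complexify_def complex_nonneg_Reals_iff star_mult star_star star_scaleC
        scaleC_minus_left)
  moreover have "complexify f 1 = 1"
    using one skew[of "\<i> *\<^sub>C 1"]
    by (simp add: complexify_def complex_eq_iff star_scaleC scaleC_minus_left)
  ultimately show ?thesis
    by (simp add: state_def complexify_linear[OF f(1)])
qed

text \<open>On the ray through \<open>(a, norm a)\<close> with \<open>a = star x * x\<close> the
  hypothesis of \<open>Hahn_Banach\<close> amounts to \<open>norm a \<le> upper_bound a\<close>,
  which is \<open>norm_le_if_pos_diff\<close>. This is where positivity of \<open>star x * x\<close>
  is indispensable.\<close>

theorem exists_norming_state:
  fixes x :: "'a::cstar_algebra"
  obtains \<phi> where "state \<phi>" "\<phi> (star x * x) = (norm x)\<^sup>2"
proof -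
  define a where "a = star x * x"
  have a: "pos a" "norm a = (norm x)\<^sup>2"
    by (simp_all add: a_def pos_star_mult norm_star_mult)
  have sa: "star a = a"
    by (rule pos_selfadjoint[OF a(1)])
  define K where "K = {t *\<^sub>R (a, norm a) | t. 0 \<le> t}"
  note ray = ray_cone[where u = "(a, norm a)", folded K_def]
  obtain f where f: "linear f" "\<And>x. f x \<le> upper_bound x" "\<And>y s. (y, s) \<in> K \<Longrightarrow> s \<le> f y"
  proof (rule Hahn_Banach[OF sublinear_upper_bound ray(1,2,3)])
    show "s \<le> upper_bound y" if ys: "(y, s) \<in> K" for y s
    proof -
      obtain t where t: "y = t *\<^sub>R a" "s = t * norm a" "0 \<le> t"
        using ys by (auto simp: K_def)
      show ?thesis
      proof (rule upper_bound_greatest)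
        fix r assume "pos (of_real r - (1 / 2) *\<^sub>R (y + star y))"
        then have "pos (of_real r - t *\<^sub>R a)"
          by (simp add: t star_scaleR sa flip: scaleR_2)
        then have "norm (t *\<^sub>R a) \<le> r"
          using norm_le_if_pos_diff pos_scaleR[OF a(1)] t(3) by blast
        then show "s \<le> r"
          using t by simp
      qed
    qed
  qed (assumption+, rule that)
  have st: "state (complexify f)"
    by (rule state_complexify[OF f(1,2)])
  have "norm a \<le> f a"
    by (rule f(3)[OF ray(4)])
  moreover have "f a \<le> norm a"
    using f(2)[of a] upper_bound_le[of "norm a" a] pos_diff_of_norm_le[OF sa order_refl]
    by (simp add: sa flip: scaleR_2)
  moreover have "Im (complexify f a) = 0"
    using st by (simp add: state_def a_def complex_nonneg_Reals_iff)
  ultimately have "complexify f a = (norm x)\<^sup>2"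
    by (simp add: complex_eq_iff complexify_def a(2))
  then show ?thesis
    using that st by (simp add: a_def)
qed

section \<open>The Gelfand-Naimark-Segal seminorm\<close>

text \<open>An abstract setting without a norm, to cover both C*-algebras with their states and the
  free *-algebra with the functional of a subgroup.\<close>

locale star_algebra =
  fixes sc :: "complex \<Rightarrow> 'b::ring_1 \<Rightarrow> 'b" and st :: "'b \<Rightarrow> 'b"
  assumes sc_add_left: "sc (a + b) x = sc a x + sc b x"
    and sc_add_right: "sc a (x + y) = sc a x + sc a y"
    and sc_sc: "sc a (sc b x) = sc (a * b) x"
    and sc_one: "sc 1 x = x"
    and mult_sc_left: "sc a x * y = sc a (x * y)"
    and mult_sc_right: "x * sc a y = sc a (x * y)"
    and st_st: "st (st x) = x"
    and st_add: "st (x + y) = st x + st y"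
    and st_sc: "st (sc a x) = sc (cnj a) (st x)"
    and st_mult: "st (x * y) = st y * st x"

locale positive_functional = star_algebra sc st
  for sc :: "complex \<Rightarrow> 'b::ring_1 \<Rightarrow> 'b" and st :: "'b \<Rightarrow> 'b" +
  fixes \<tau> :: "'b \<Rightarrow> complex"
  assumes tau_add: "\<tau> (x + y) = \<tau> x + \<tau> y"
    and tau_sc: "\<tau> (sc a x) = a * \<tau> x"
    and tau_pos: "\<tau> (st x * x) \<in> \<real>\<^sub>\<ge>\<^sub>0"
begin

lemma tau_zero [simp]: "\<tau> 0 = 0"
  using tau_add[of 0 0] by simp

lemma tau_uminus: "\<tau> (- x) = - \<tau> x"
  using tau_add[of x "- x"] by (simp add: minus_unique)

text \<open>The seminorm of the vector of \<open>x\<close> in the GNS space.\<close>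

definition nrm :: "'b \<Rightarrow> real" where
  "nrm x = sqrt (Re (\<tau> (st x * x)))"

lemma Re_nonneg: "0 \<le> Re (\<tau> (st x * x))" and Im_zero: "Im (\<tau> (st x * x)) = 0"
  using tau_pos[of x] by (auto simp: complex_nonneg_Reals_iff)

lemma nrm_nonneg: "0 \<le> nrm x"
  by (simp add: nrm_def Re_nonneg)

lemma nrm_square: "(nrm x)\<^sup>2 = Re (\<tau> (st x * x))"
  by (simp add: nrm_def Re_nonneg)

lemma tau_square_add:
  "\<tau> (st (x + sc c y) * (x + sc c y)) =
    \<tau> (st x * x) + c * \<tau> (st x * y) + cnj c * \<tau> (st y * x) + cnj c * c * \<tau> (st y * y)"
  by (simp add: st_add st_sc mult_sc_left mult_sc_right distrib_left distrib_right tau_add tau_sc)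

text \<open>Polarisation: \<open>\<tau> (st z * z)\<close> is real at \<open>z = x + y\<close> and
  at \<open>z = x + \<i> y\<close>, which yields the imaginary and the real part of the
  identity.\<close>

lemma hermitian: "\<tau> (st y * x) = cnj (\<tau> (st x * y))"
proof -
  have "Im (\<tau> (st x * y)) + Im (\<tau> (st y * x)) = 0"
    using Im_zero[of "x + sc 1 y"] Im_zero[of x] Im_zero[of y]
    by (simp only: tau_square_add) simp
  moreover have "Re (\<tau> (st x * y)) - Re (\<tau> (st y * x)) = 0"
    using Im_zero[of "x + sc \<i> y"] Im_zero[of x] Im_zero[of y]
    by (simp only: tau_square_add) simp
  ultimately show ?thesis
    by (simp add: complex_eq_iff)
qed

lemma Cauchy_Schwarz: "cmod (\<tau> (st x * y)) \<le> nrm x * nrm y"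
proof -
  define I where "I = \<tau> (st x * y)"
  define A where "A = Re (\<tau> (st x * x))"
  define B where "B = Re (\<tau> (st y * y))"
  have AB: "0 \<le> A" "0 \<le> B"
    by (simp_all add: A_def B_def Re_nonneg)
  \<comment> \<open>The direction \<open>c = s * cnj I\<close> makes the cross terms real, so that a
    real quadratic polynomial in \<open>s\<close> remains.\<close>
  have quad: "0 \<le> A + 2 * s * (cmod I)\<^sup>2 + s\<^sup>2 * (cmod I)\<^sup>2 * B" for s :: real
  proof -
    define c where "c = of_real s * cnj I"
    have cI: "c * I = of_real (s * (cmod I)\<^sup>2)" "cnj c * c = of_real (s\<^sup>2 * (cmod I)\<^sup>2)"
      using complex_norm_square[of I] by (simp_all add: c_def power2_eq_square mult_ac)
    have "0 \<le> Re (\<tau> (st (x + sc c y) * (x + sc c y)))"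
      by (rule Re_nonneg)
    also have "\<tau> (st (x + sc c y) * (x + sc c y)) =
        \<tau> (st x * x) + c * I + cnj (c * I) + cnj c * c * \<tau> (st y * y)"
      by (simp add: tau_square_add hermitian[of y x] I_def)
    also have "Re \<dots> = A + 2 * s * (cmod I)\<^sup>2 + s\<^sup>2 * (cmod I)\<^sup>2 * B"
      unfolding cI by (simp add: A_def B_def del: of_real_mult of_real_power)
    finally show ?thesis .
  qed
  \<comment> \<open>If \<open>B = 0\<close>, the polynomial is affine and the chosen
    \<open>s\<close> gives it the value \<open>- 1\<close> unless \<open>I = 0\<close>. Otherwise
    \<open>s = - 1 / B\<close> is its minimum.\<close>
  have "(cmod I)\<^sup>2 \<le> A * B"
  proof (cases "B = 0")
    case True
    have "I = 0"
    proof (rule ccontr)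
      assume "I \<noteq> 0"
      then have "0 < (cmod I)\<^sup>2"
        by simp
      then show False
        using quad[of "- (A + 1) / (2 * (cmod I)\<^sup>2)"] True AB by (simp add: field_simps)
    qed
    then show ?thesis
      using AB by simp
  next
    case False
    then have "0 < B"
      using AB by simp
    then have "0 \<le> A - (cmod I)\<^sup>2 / B"
      using quad[of "- 1 / B"] by (simp add: power2_eq_square field_simps)
    then show ?thesis
      using \<open>0 < B\<close> by (simp add: field_simps)
  qed
  then have "(cmod I)\<^sup>2 \<le> (nrm x * nrm y)\<^sup>2"
    by (simp add: power_mult_distrib nrm_square A_def B_def)
  then show ?thesis
    unfolding I_def by (rule power2_le_imp_le) (simp add: nrm_nonneg)
qed

lemma nrm_add: "nrm (x + y) \<le> nrm x + nrm y"
proof (rule power2_le_imp_le)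
  have "(nrm (x + y))\<^sup>2 = (nrm x)\<^sup>2 + 2 * Re (\<tau> (st x * y)) + (nrm y)\<^sup>2"
    using tau_square_add[of x 1 y] hermitian[of y x] by (simp add: nrm_square sc_one)
  also have "Re (\<tau> (st x * y)) \<le> nrm x * nrm y"
    using Cauchy_Schwarz[of x y] complex_Re_le_cmod order_trans by blast
  finally show "(nrm (x + y))\<^sup>2 \<le> (nrm x + nrm y)\<^sup>2"
    by (simp add: power2_sum)
qed (simp add: nrm_nonneg)

lemma nrm_sc: "nrm (sc c x) = cmod c * nrm x"
proof -
  have "cnj c * c = of_real ((cmod c)\<^sup>2)"
    by (simp add: complex_norm_square mult.commute del: of_real_power)
  moreover have "\<tau> (st (sc c x) * sc c x) = (cnj c * c) * \<tau> (st x * x)"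
    by (simp add: st_sc mult_sc_left mult_sc_right tau_sc sc_sc)
  ultimately have "Re (\<tau> (st (sc c x) * sc c x)) = (cmod c)\<^sup>2 * Re (\<tau> (st x * x))"
    by (simp del: of_real_power)
  then show ?thesis
    by (simp add: nrm_def real_sqrt_mult)
qed

end

text \<open>\<open>tau_bounded\<close> says that left multiplication by each \<open>x\<close> is a
  bounded operator on the GNS space.\<close>

locale bounded_positive_functional = positive_functional sc st \<tau>
  for sc :: "complex \<Rightarrow> 'b::ring_1 \<Rightarrow> 'b" and st :: "'b \<Rightarrow> 'b" and \<tau> :: "'b \<Rightarrow> complex" +
  assumes tau_one: "\<tau> 1 = 1"
    and tau_bounded: "\<exists>C. \<forall>y. Re (\<tau> (st (x * y) * (x * y))) \<le> C * Re (\<tau> (st y * y))"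
begin

text \<open>The operator norm of \<open>x\<close> in the GNS representation.\<close>

definition gns :: "'b \<Rightarrow> real" where
  "gns x = Inf {C. 0 \<le> C \<and> (\<forall>y. nrm (x * y) \<le> C * nrm y)}"

lemma gns_le: "0 \<le> C \<Longrightarrow> (\<And>y. nrm (x * y) \<le> C * nrm y) \<Longrightarrow> gns x \<le> C"
  unfolding gns_def by (rule cInf_lower) (auto intro: bdd_belowI)

lemma gns_set_nonempty: "{C. 0 \<le> C \<and> (\<forall>y. nrm (x * y) \<le> C * nrm y)} \<noteq> {}"
proof -
  obtain C where C: "\<And>y. Re (\<tau> (st (x * y) * (x * y))) \<le> C * Re (\<tau> (st y * y))"
    using tau_bounded by blast
  have "nrm (x * y) \<le> sqrt \<bar>C\<bar> * nrm y" for y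
  proof -
    have "Re (\<tau> (st (x * y) * (x * y))) \<le> \<bar>C\<bar> * Re (\<tau> (st y * y))"
      using C[of y] Re_nonneg[of y] by (meson abs_ge_self mult_right_mono order_trans)
    then show ?thesis
      unfolding nrm_def by (simp flip: real_sqrt_mult)
  qed
  then show ?thesis
    by (auto intro!: exI[of _ "sqrt \<bar>C\<bar>"])
qed

lemma gns_nonneg: "0 \<le> gns x"
  unfolding gns_def using gns_set_nonempty by (intro cInf_greatest) auto

lemma nrm_mult_le: "nrm (x * y) \<le> gns x * nrm y"
proof (cases "nrm y = 0")
  case True
  obtain C where "nrm (x * y) \<le> C * nrm y"
    using gns_set_nonempty[of x] by blast
  then show ?thesis
    by (simp add: True)
next
  case False
  then have y: "0 < nrm y"
    using nrm_nonneg[of y] by simp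
  have "nrm (x * y) / nrm y \<le> gns x"
    unfolding gns_def using gns_set_nonempty y by (intro cInf_greatest) (auto simp: field_simps)
  then show ?thesis
    using y by (simp add: field_simps)
qed

lemma gns_add: "gns (x + y) \<le> gns x + gns y"
proof (rule gns_le)
  fix z
  have "nrm ((x + y) * z) \<le> nrm (x * z) + nrm (y * z)"
    by (simp add: distrib_right nrm_add)
  then show "nrm ((x + y) * z) \<le> (gns x + gns y) * nrm z"
    using nrm_mult_le[of x z] nrm_mult_le[of y z] by (simp add: distrib_right)
qed (simp add: gns_nonneg)

lemma gns_mult: "gns (x * y) \<le> gns x * gns y"
proof (rule gns_le)
  fix z
  have "nrm (x * y * z) \<le> gns x * nrm (y * z)"
    by (simp add: mult.assoc nrm_mult_le)
  also have "\<dots> \<le> gns x * (gns y * nrm z)"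
    by (intro mult_left_mono nrm_mult_le gns_nonneg)
  finally show "nrm (x * y * z) \<le> gns x * gns y * nrm z"
    by (simp add: mult.assoc)
qed (simp add: gns_nonneg)

lemma gns_sc: "gns (sc c x) = cmod c * gns x"
proof -
  have le: "gns (sc c x) \<le> cmod c * gns x" for c x
  proof (rule gns_le)
    show "nrm (sc c x * y) \<le> cmod c * gns x * nrm y" for y
      using mult_left_mono[OF nrm_mult_le[of x y], of "cmod c"]
      by (simp add: mult_sc_left nrm_sc mult.assoc)
  qed (simp add: gns_nonneg)
  show ?thesis
  proof (cases "c = 0")
    case True
    then show ?thesis
      using le[of c x] gns_nonneg[of "sc c x"] by simp
  next
    case False
    have "gns (sc (1 / c) (sc c x)) \<le> cmod (1 / c) * gns (sc c x)"
      by (rule le)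
    then have "cmod c * gns x \<le> gns (sc c x)"
      using False by (simp add: sc_sc sc_one norm_divide field_simps)
    then show ?thesis
      using le[of c x] by simp
  qed
qed

text \<open>As for operators on a Hilbert space: Cauchy-Schwarz bounds the square of
  \<open>nrm (x * y)\<close>, which pairs \<open>y\<close> with \<open>st x * x * y\<close>, and the
  resulting inequality makes \<open>st\<close> isometric.\<close>

lemma gns_star_mult: "gns (st x * x) = (gns x)\<^sup>2"
proof -
  have ge: "(gns x)\<^sup>2 \<le> gns (st x * x)" for x
  proof -
    have "nrm (x * y) \<le> sqrt (gns (st x * x)) * nrm y" for y
    proof (rule power2_le_imp_le)
      have "(nrm (x * y))\<^sup>2 = Re (\<tau> (st y * (st x * x * y)))"
        by (simp add: nrm_square st_mult mult.assoc)
      also have "\<dots> \<le> nrm y * nrm (st x * x * y)"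
        using Cauchy_Schwarz[of y "st x * x * y"] complex_Re_le_cmod order_trans by blast
      also have "\<dots> \<le> nrm y * (gns (st x * x) * nrm y)"
        by (intro mult_left_mono nrm_mult_le nrm_nonneg)
      also have "\<dots> = (sqrt (gns (st x * x)) * nrm y)\<^sup>2"
        by (simp add: power_mult_distrib gns_nonneg power2_eq_square)
      finally show "(nrm (x * y))\<^sup>2 \<le> (sqrt (gns (st x * x)) * nrm y)\<^sup>2" .
    qed (simp add: nrm_nonneg gns_nonneg)
    then have "gns x \<le> sqrt (gns (st x * x))"
      by (intro gns_le) (auto simp: gns_nonneg)
    then show ?thesis
      using gns_nonneg[of x] gns_nonneg[of "st x * x"] by (metis power_mono real_sqrt_pow2)
  qed
  have star: "gns x \<le> gns (st x)" for x
  proof (cases "gns x = 0")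
    case False
    then have "0 < gns x"
      using gns_nonneg[of x] by simp
    moreover have "gns x * gns x \<le> gns (st x) * gns x"
      using ge[of x] gns_mult[of "st x" x] by (simp add: power2_eq_square)
    ultimately show ?thesis
      by simp
  qed (simp add: gns_nonneg)
  have "gns (st x * x) \<le> gns (st x) * gns x"
    by (rule gns_mult)
  also have "gns (st x) \<le> gns x"
    using star[of "st x"] by (simp add: st_st)
  finally show ?thesis
    using ge[of x] gns_nonneg[of x] by (simp add: power2_eq_square mult_right_mono)
qed

lemma st_one: "st 1 = 1"
  using st_mult[of 1 "st 1"] by (simp add: st_st)

lemma nrm_one: "nrm 1 = 1"
  by (simp add: nrm_def st_one tau_one)

lemma tau_le_gns: "cmod (\<tau> x) \<le> gns x"
  using Cauchy_Schwarz[of 1 x] nrm_mult_le[of x 1] by (simp add: st_one nrm_one)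

lemma gns_eq_zero: "(\<And>y. \<tau> (st (x * y) * (x * y)) = 0) \<Longrightarrow> gns x = 0"
  using gns_le[of 0 x] gns_nonneg[of x] by (simp add: nrm_def)

end

section \<open>States of C*-algebras and contractivity of *-homomorphisms\<close>

lemma star_algebra_cstar: "star_algebra scaleC (star :: 'a::cstar_algebra \<Rightarrow> 'a)"
  by unfold_locales (simp_all add: scaleC_add_left scaleC_add_right scaleC_scaleC mult_scaleC_left
      mult_scaleC_right star_star star_add star_scaleC star_mult)

lemma positive_functional_state: "state \<phi> \<Longrightarrow> positive_functional scaleC star \<phi>"
  using star_algebra_cstar
  by (simp add: positive_functional_def positive_functional_axioms_def state_def)

lemma state_diff: "state \<phi> \<Longrightarrow> \<phi> (x - y) = \<phi> x - \<phi> y"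
  unfolding state_def by (metis diff_add_cancel add_diff_cancel_right')

text \<open>With \<open>h\<close> the root of \<open>(norm x)\<^sup>2 - star x * x\<close>, the
  difference of the two sides is the value of \<open>\<phi>\<close> at
  \<open>star (h * y) * (h * y)\<close>.\<close>

lemma state_square_le:
  fixes x y :: "'a::cstar_algebra"
  assumes "state \<phi>"
  shows "Re (\<phi> (star (x * y) * (x * y))) \<le> (norm x)\<^sup>2 * Re (\<phi> (star y * y))"
proof -
  have "pos (of_real ((norm x)\<^sup>2) - star x * x)"
    by (rule pos_diff_of_norm_le) (simp_all add: star_mult star_star norm_star_mult)
  then obtain h where h: "pos h" "h * h = of_real ((norm x)\<^sup>2) - star x * x"
    using pos_sqrt by blast
  have "star (h * y) * (h * y) = star y * (h * h) * y"
    by (simp add: star_mult pos_selfadjoint[OF h(1)] mult.assoc)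
  also have "\<dots> = (norm x)\<^sup>2 *\<^sub>R (star y * y) - star (x * y) * (x * y)"
    by (simp only: h(2)) (simp add: of_real_def algebra_simps star_mult)
  finally have "\<phi> (star (h * y) * (h * y)) =
      of_real ((norm x)\<^sup>2) * \<phi> (star y * y) - \<phi> (star (x * y) * (x * y))"
    using assms by (simp add: state_diff scaleC_of_real[symmetric])
      (simp add: state_def)
  moreover have "0 \<le> Re (\<phi> (star (h * y) * (h * y)))"
    using assms by (simp add: state_def complex_nonneg_Reals_iff)
  ultimately show ?thesis
    by simp
qed

lemma bounded_positive_functional_state:
  "state \<phi> \<Longrightarrow> bounded_positive_functional scaleC star \<phi>"
  using positive_functional_state[of \<phi>] state_square_le[of \<phi>]
  unfolding bounded_positive_functional_def bounded_positive_functional_axioms_def state_def by blast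

lemma gns_le_norm:
  assumes "state \<phi>"
  shows "bounded_positive_functional.gns star \<phi> x \<le> norm x"
proof -
  interpret bounded_positive_functional scaleC star \<phi>
    by (rule bounded_positive_functional_state[OF assms])
  show ?thesis
  proof (rule gns_le)
    fix y
    have "sqrt (Re (\<phi> (star (x * y) * (x * y)))) \<le> sqrt ((norm x)\<^sup>2 * Re (\<phi> (star y * y)))"
      by (rule real_sqrt_le_mono[OF state_square_le[OF assms]])
    then show "nrm (x * y) \<le> norm x * nrm y"
      by (simp add: nrm_def real_sqrt_mult)
  qed simp
qed

lemma state_norm_le:
  assumes "state \<phi>"
  shows "cmod (\<phi> x) \<le> norm x"
proof -
  interpret bounded_positive_functional scaleC star \<phi>
    by (rule bounded_positive_functional_state[OF assms])
  show ?thesis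
    using tau_le_gns[of x] gns_le_norm[OF assms, of x] by simp
qed

lemma state_comp_star_hom: "state \<phi> \<Longrightarrow> star_hom f \<Longrightarrow> state (\<lambda>x. \<phi> (f x))"
  unfolding state_def star_hom_def by metis

text \<open>A *-homomorphism pulls back a norming state to a state.\<close>

theorem star_hom_norm_le:
  assumes "star_hom f"
  shows "norm (f x) \<le> norm x"
proof (rule power2_le_imp_le)
  obtain \<phi> where \<phi>: "state \<phi>" "\<phi> (star (f x) * f x) = (norm (f x))\<^sup>2"
    by (rule exists_norming_state)
  have "(norm (f x))\<^sup>2 = cmod (\<phi> (f (star x * x)))"
    using \<phi>(2) assms by (simp add: star_hom_def norm_power flip: of_real_power)
  also have "\<dots> \<le> norm (star x * x)"
    by (rule state_norm_le[OF state_comp_star_hom[OF \<phi>(1) assms]])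
  finally show "(norm (f x))\<^sup>2 \<le> (norm x)\<^sup>2"
    by (simp add: norm_star_mult)
qed simp

lemma star_hom_diff: "star_hom f \<Longrightarrow> f (x - y) = f x - f y"
  unfolding star_hom_def by (metis diff_add_cancel add_diff_cancel_right')

lemma star_hom_zero: "star_hom f \<Longrightarrow> f 0 = 0"
  using star_hom_diff[of f 0 0] by simp

lemma star_hom_continuous:
  assumes "star_hom f"
  shows "continuous_on UNIV f"
proof (rule bounded_linear.continuous_on[where f = f and g = "\<lambda>x. x"])
  show "bounded_linear f"
  proof (rule bounded_linear_intro[of f 1])
    show "f (r *\<^sub>R x) = r *\<^sub>R f x" for r x
      using assms by (simp add: star_hom_def scaleC_of_real[symmetric])
  qed (use assms star_hom_norm_le[OF assms] in \<open>auto simp: star_hom_def\<close>)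
qed (rule continuous_on_id)

section \<open>The free *-algebra\<close>

lemma star_word_star [simp]: "star (star w) = (w :: 'x word)"
  by (cases w) (simp add: star_word_def rev_map comp_def case_prod_unfold)

lemma star_word_add: "star (v + w) = star w + star (v :: 'x word)"
  by (simp add: star_word_def plus_word_def)

lemma star_word_zero [simp]: "star (0 :: 'x word) = 0"
  by (simp add: star_word_def zero_word_def)

text \<open>The coefficients of \<open>map_key\<close>, through which \<open>star\<close> is defined
  on polynomials, are available for injective maps only.\<close>

lemma inj_star_word: "inj (star :: 'x word \<Rightarrow> 'x word)"
  by (metis injI star_word_star)

lemma lookup_star: "Poly_Mapping.lookup (star p) w = cnj (Poly_Mapping.lookup p (star w))"
  for p :: "'x star_poly"
  by (simp add: star_poly_mapping_def map.rep_eq map_key.rep_eq[OF inj_star_word] when_def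
      star_complex_def)

lemma star_poly_single: "star (Poly_Mapping.single w c) = Poly_Mapping.single (star w) (cnj c)"
  for w :: "'x word"
  by (rule poly_mapping_eqI) (auto simp: lookup_star lookup_single when_def)

lemma star_poly_add: "star (p + q) = star p + star (q :: 'x star_poly)"
  by (rule poly_mapping_eqI) (simp add: lookup_star lookup_add)

lemma poly_mapping_sum_single:
  "p = (\<Sum>w\<in>Poly_Mapping.keys p. Poly_Mapping.single w (Poly_Mapping.lookup p w))"
proof (rule poly_mapping_eqI)
  fix k
  have "Poly_Mapping.lookup (\<Sum>w\<in>Poly_Mapping.keys p. Poly_Mapping.single w (Poly_Mapping.lookup p w)) k =
      (\<Sum>w\<in>Poly_Mapping.keys p. if w = k then Poly_Mapping.lookup p k else 0)"
    by (simp add: lookup_sum lookup_single when_def)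
  then show "Poly_Mapping.lookup p k =
      Poly_Mapping.lookup (\<Sum>w\<in>Poly_Mapping.keys p. Poly_Mapping.single w (Poly_Mapping.lookup p w)) k"
    by (simp add: in_keys_iff)
qed

lemma poly_mapping_induct_single [case_names single add]:
  fixes p :: "'w \<Rightarrow>\<^sub>0 'c::comm_monoid_add"
  assumes "\<And>w c. P (Poly_Mapping.single w c)" "\<And>p q. P p \<Longrightarrow> P q \<Longrightarrow> P (p + q)"
  shows "P p"
proof -
  have "P (\<Sum>w\<in>S. Poly_Mapping.single w (Poly_Mapping.lookup p w))" if "finite S" for S
    using that
  proof (induction S)
    case empty
    then show ?case
      using assms(1)[of undefined 0] by simp
  qed (simp add: assms)
  then show ?thesis
    using poly_mapping_sum_single[of p] by (metis finite_keys)
qed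

lemma star_poly_mult: "star (p * q) = star q * star (p :: 'x star_poly)"
proof (induction p rule: poly_mapping_induct_single)
  case (single w c)
  show ?case
    by (induction q rule: poly_mapping_induct_single)
      (simp_all add: mult_single star_poly_single star_word_add star_poly_add algebra_simps)
qed (simp add: algebra_simps star_poly_add)

lemma Scal_mult_commute: "p * Scal c = Scal c * (p :: 'x star_poly)"
  by (induction p rule: poly_mapping_induct_single)
    (simp_all add: Scal_def mult_single algebra_simps)

lemma star_Scal: "star (Scal c :: 'x star_poly) = Scal (cnj c)"
  by (simp add: Scal_def star_poly_single)

lemma star_algebra_star_poly: "star_algebra (\<lambda>c p. Scal c * p) (star :: 'x star_poly \<Rightarrow> _)"
proof
  fix a b :: complex and x y :: "'x star_poly"
  show "Scal (a + b) * x = Scal a * x + Scal b * x"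
    by (simp add: Scal_def single_add algebra_simps)
  show "Scal a * (Scal b * x) = Scal (a * b) * x"
    by (simp add: Scal_def mult_single flip: mult.assoc)
  show "x * (Scal a * y) = Scal a * (x * y)"
    by (simp only: Scal_mult_commute mult.assoc[symmetric])
  show "star (star x) = x"
    by (rule poly_mapping_eqI) (simp add: lookup_star)
  show "star (Scal a * x) = Scal (cnj a) * star x"
    by (simp only: star_poly_mult star_Scal Scal_mult_commute)
  show "Scal 1 * x = x"
    by (simp add: Scal_def)
qed (simp_all add: algebra_simps star_poly_add star_poly_mult)

section \<open>Evaluation of polynomials in a C*-algebra\<close>

context
  fixes a :: "'x \<Rightarrow> 'a::cstar_algebra"
begin

lemma eval_word_add: "eval_word a (v + w) = eval_word a v * eval_word a w"
  by (simp add: eval_word_def plus_word_def)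

lemma eval_word_star: "eval_word a (star w) = star (eval_word a w)"
proof -
  have "prod_list (map (\<lambda>(x, b). if b then star (a x) else a x) (rev (map (\<lambda>(x, b). (x, \<not> b)) l))) =
      star (prod_list (map (\<lambda>(x, b). if b then star (a x) else a x) l))" for l
    by (induction l) (auto simp: star_mult star_star)
  then show ?thesis
    by (simp add: eval_word_def star_word_def)
qed

lemma eval_poly_single [simp]: "eval_poly a (Poly_Mapping.single w c) = c *\<^sub>C eval_word a w"
  by (cases "c = 0") (simp_all add: eval_poly_def)

lemma eval_poly_add: "eval_poly a (p + q) = eval_poly a p + eval_poly a q"
  unfolding eval_poly_def
  by (rule setsum_keys_plus_distrib[where f = "\<lambda>w c. c *\<^sub>C eval_word a w"])
    (simp_all add: scaleC_add_left)

lemma eval_poly_mult: "eval_poly a (p * q) = eval_poly a p * eval_poly a q"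
proof (induction p rule: poly_mapping_induct_single)
  case (single w c)
  show ?case
    by (induction q rule: poly_mapping_induct_single)
      (simp_all add: mult_single eval_word_add eval_poly_add algebra_simps mult_scaleC_left
        mult_scaleC_right scaleC_scaleC)
qed (simp add: algebra_simps eval_poly_add)

lemma eval_poly_star: "eval_poly a (star p) = star (eval_poly a p)"
  by (induction p rule: poly_mapping_induct_single)
    (simp_all add: star_poly_single star_poly_add eval_poly_add eval_word_star star_scaleC star_add)

lemma eval_poly_Scal: "eval_poly a (Scal c) = c *\<^sub>C 1"
  by (simp add: Scal_def eval_word_def zero_word_def)

lemma eval_poly_one: "eval_poly a 1 = 1"
  using eval_poly_Scal[of 1] by (simp add: Scal_def)

lemma eval_poly_Gen: "eval_poly a (Gen x) = a x"
  by (simp add: Gen_def eval_word_def)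

lemma eval_poly_diff: "eval_poly a (p - q) = eval_poly a p - eval_poly a q"
  using eval_poly_add[of "p - q" q] by simp

lemma eval_poly_Scal_mult: "eval_poly a (Scal c * p) = c *\<^sub>C eval_poly a p"
  by (simp add: eval_poly_mult eval_poly_Scal mult_scaleC_left)

end

lemma eval_poly_star_hom:
  assumes "star_hom f"
  shows "f (eval_poly a p) = eval_poly (\<lambda>x. f (a x)) p"
proof -
  have "f (eval_word a (Word l)) = eval_word (\<lambda>x. f (a x)) (Word l)" for l
    using assms by (induction l) (auto simp: eval_word_def star_hom_def)
  then have "f (eval_word a w) = eval_word (\<lambda>x. f (a x)) w" for w
    by (cases w) simp
  then show ?thesis
    using assms by (induction p rule: poly_mapping_induct_single)
      (simp_all add: eval_poly_add star_hom_def)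
qed

lemma poly_vars_subset:
  "poly_vars (p + q) \<subseteq> poly_vars p \<union> poly_vars q"
  "poly_vars (p * q) \<subseteq> poly_vars p \<union> poly_vars q"
  "poly_vars (star p) \<subseteq> poly_vars p"
  "poly_vars (Scal c) = {}"
  "poly_vars (Gen x) \<subseteq> {x}"
  for p q :: "'x star_poly"
proof -
  show "poly_vars (p + q) \<subseteq> poly_vars p \<union> poly_vars q"
    using keys_add[of p q] by (auto simp: poly_vars_def)
  show "poly_vars (p * q) \<subseteq> poly_vars p \<union> poly_vars q"
    using keys_mult[of p q] by (fastforce simp: poly_vars_def plus_word_def)
  have "star w \<in> Poly_Mapping.keys p" if "w \<in> Poly_Mapping.keys (star p)" for w
    using that by (simp add: in_keys_iff lookup_star)
  moreover have "fst ` set (letters (star w)) = fst ` set (letters w)" for w :: "'x word"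
    by (force simp: star_word_def)
  ultimately show "poly_vars (star p) \<subseteq> poly_vars p"
    unfolding poly_vars_def by blast
qed (auto simp: poly_vars_def Scal_def Gen_def zero_word_def)

section \<open>States of universal C*-algebras and of group C*-algebras\<close>

definition star_subalgebra :: "'a::cstar_algebra set \<Rightarrow> bool" where
  "star_subalgebra B \<longleftrightarrow>
     csubspace B \<and> 1 \<in> B \<and> (\<forall>x\<in>B. \<forall>y\<in>B. x * y \<in> B) \<and> (\<forall>x\<in>B. star x \<in> B)"

lemma continuous_on_scaleC: "continuous_on S ((*\<^sub>C) a :: 'a::cstar_algebra \<Rightarrow> 'a)"
proof -
  have "bounded_linear ((*\<^sub>C) a :: 'a \<Rightarrow> 'a)"
    by (rule bounded_linear_intro[of _ "cmod a"])
      (auto simp: scaleC_add_right norm_scaleC scaleC_scaleC mult.commute scaleC_of_real[symmetric])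
  then show ?thesis
    by (rule linear_continuous_on)
qed

lemma continuous_on_star: "continuous_on S (star :: 'a::cstar_algebra \<Rightarrow> 'a)"
  by (rule linear_continuous_on[OF bounded_linear_star])

lemma cstar_subalgebra_closure:
  fixes B :: "'a::cstar_algebra set"
  assumes "star_subalgebra B"
  shows "cstar_subalgebra (closure B)"
proof -
  note B = assms[unfolded star_subalgebra_def csubspace_def]
  have binary: "f x y \<in> closure B"
    if "x \<in> closure B" "y \<in> closure B" "\<And>x y. x \<in> B \<Longrightarrow> y \<in> B \<Longrightarrow> f x y \<in> B"
      "continuous_on UNIV (\<lambda>(x, y). f x y)" for f :: "'a \<Rightarrow> 'a \<Rightarrow> 'a" and x y
  proof -
    have "(\<lambda>(x, y). f x y) ` closure (B \<times> B) \<subseteq> closure B"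
      by (rule image_closure_subset)
        (use that closure_subset in \<open>auto intro: continuous_on_subset[OF that(4)]\<close>)
    then show ?thesis
      using that by (auto simp: closure_Times)
  qed
  have unary: "f x \<in> closure B"
    if "x \<in> closure B" "\<And>x. x \<in> B \<Longrightarrow> f x \<in> B" "continuous_on (closure B) f" for f :: "'a \<Rightarrow> 'a" and x
    using image_closure_subset[of B f "closure B"] that closure_subset by blast
  show ?thesis
    unfolding cstar_subalgebra_def csubspace_def
  proof (intro conjI ballI allI)
    show "0 \<in> closure B" "1 \<in> closure B"
      using B closure_subset by blast+
    show "x + y \<in> closure B" if "x \<in> closure B" "y \<in> closure B" for x y
      by (rule binary[OF that]) (use B in \<open>auto simp: case_prod_unfold intro!: continuous_intros\<close>)
    show "x * y \<in> closure B" if "x \<in> closure B" "y \<in> closure B" for x y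
      by (rule binary[OF that]) (use B in \<open>auto simp: case_prod_unfold intro!: continuous_intros\<close>)
    show "a *\<^sub>C x \<in> closure B" if "x \<in> closure B" for a x
      by (rule unary[OF that]) (use B in \<open>auto intro: continuous_on_scaleC\<close>)
    show "star x \<in> closure B" if "x \<in> closure B" for x
      by (rule unary[OF that]) (use B in \<open>auto intro: continuous_on_star\<close>)
  qed simp
qed

lemma generated_cstar_subset: "cstar_subalgebra B \<Longrightarrow> S \<subseteq> B \<Longrightarrow> generated_cstar S \<subseteq> B"
  by (auto simp: generated_cstar_def)

lemma cstar_subalgebra_generated: "cstar_subalgebra (generated_cstar S)"
proof -
  let ?F = "{B. cstar_subalgebra B \<and> S \<subseteq> B}"
  have "closed (\<Inter> ?F)"
    by (rule closed_Inter) (simp add: cstar_subalgebra_def)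
  then show ?thesis
    unfolding generated_cstar_def cstar_subalgebra_def[of "\<Inter> ?F"] csubspace_def[of "\<Inter> ?F"]
    by (simp add: cstar_subalgebra_def csubspace_def)
qed

lemma generated_cstar_superset: "S \<subseteq> generated_cstar S"
  by (auto simp: generated_cstar_def)

lemma poly_vars_closed:
  "poly_vars p \<subseteq> X \<Longrightarrow> poly_vars q \<subseteq> X \<Longrightarrow> poly_vars (p + q) \<subseteq> X"
  "poly_vars p \<subseteq> X \<Longrightarrow> poly_vars q \<subseteq> X \<Longrightarrow> poly_vars (p * q) \<subseteq> X"
  "poly_vars p \<subseteq> X \<Longrightarrow> poly_vars (star p) \<subseteq> X"
  "poly_vars (Scal c) \<subseteq> X"
  "x \<in> X \<Longrightarrow> poly_vars (Gen x) \<subseteq> X"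
  for p q :: "'x star_poly"
proof -
  assume "poly_vars p \<subseteq> X" "poly_vars q \<subseteq> X"
  then show "poly_vars (p + q) \<subseteq> X" "poly_vars (p * q) \<subseteq> X"
    using poly_vars_subset(1,2)[of p q] by (meson Un_least order_trans)+
next
  assume "poly_vars p \<subseteq> X"
  then show "poly_vars (star p) \<subseteq> X"
    using poly_vars_subset(3)[of p] by (rule order_trans[rotated])
next
  assume "x \<in> X"
  then show "poly_vars (Gen x) \<subseteq> X"
    using poly_vars_subset(5)[of x] by (metis empty_subsetI insert_subset order_trans)
qed (simp add: poly_vars_subset(4))

lemma star_subalgebra_eval_poly: "star_subalgebra {eval_poly a p | p. poly_vars p \<subseteq> X}"
proof -
  let ?E = "{eval_poly a p | p. poly_vars p \<subseteq> X}"
  have E: "eval_poly a p \<in> ?E" if "poly_vars p \<subseteq> X" for p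
    using that by blast
  have scal: "c *\<^sub>C 1 \<in> ?E" for c
    using E[OF poly_vars_closed(4)] by (simp only: eval_poly_Scal)
  have binary: "x + y \<in> ?E \<and> x * y \<in> ?E" if xy: "x \<in> ?E" "y \<in> ?E" for x y
  proof -
    obtain p q where pq: "x = eval_poly a p" "poly_vars p \<subseteq> X" "y = eval_poly a q" "poly_vars q \<subseteq> X"
      using xy by blast
    show ?thesis
      using E[OF poly_vars_closed(1)[OF pq(2,4)]] E[OF poly_vars_closed(2)[OF pq(2,4)]]
      by (simp only: pq(1,3) eval_poly_add eval_poly_mult)
  qed
  have unary: "star x \<in> ?E \<and> c *\<^sub>C x \<in> ?E" if x: "x \<in> ?E" for c x
  proof -
    obtain p where p: "x = eval_poly a p" "poly_vars p \<subseteq> X"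
      using x by blast
    show ?thesis
      using E[OF poly_vars_closed(3)[OF p(2)]] E[OF poly_vars_closed(2)[OF poly_vars_closed(4) p(2)], of c]
      by (simp only: p(1) eval_poly_star eval_poly_Scal_mult)
  qed
  show ?thesis
    unfolding star_subalgebra_def csubspace_def
    using scal[of 0] scal[of 1] binary unary by simp
qed

lemma closure_eval_poly:
  assumes "universal_cstar_algebra X R a"
  shows "closure {eval_poly a p | p. poly_vars p \<subseteq> X} = UNIV"
proof -
  have "a ` X \<subseteq> {eval_poly a p | p. poly_vars p \<subseteq> X}"
  proof
    fix y assume "y \<in> a ` X"
    then obtain x where "x \<in> X" "y = eval_poly a (Gen x)"
      by (auto simp: eval_poly_Gen)
    then show "y \<in> {eval_poly a p | p. poly_vars p \<subseteq> X}"
      using poly_vars_closed(5)[OF \<open>x \<in> X\<close>] by blast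
  qed
  then have "generated_cstar (a ` X) \<subseteq> closure {eval_poly a p | p. poly_vars p \<subseteq> X}"
    using closure_subset
    by (intro generated_cstar_subset cstar_subalgebra_closure star_subalgebra_eval_poly) blast
  then show ?thesis
    using assms by (auto simp: universal_cstar_algebra_def)
qed

lemma closed_induct:
  assumes "x \<in> closure S" "closed {x. P x}" "\<And>x. x \<in> S \<Longrightarrow> P x"
  shows "P x"
  using closure_minimal[of S "{x. P x}"] assms by blast

text \<open>By maximality of the universal norm, \<open>gns\<close> and hence the modulus of
  \<open>\<tau>\<close> are bounded by \<open>norm (eval_poly a p)\<close>. So \<open>\<tau>\<close>
  factors through the evaluation as a contractive functional, and the Hahn-Banach theorem extends
  it.\<close>

theorem universal_cstar_algebra_state:
  fixes a :: "'x \<Rightarrow> 'a::cstar_algebra"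
  assumes univ: "universal_cstar_algebra X R a"
    and tau: "bounded_positive_functional (\<lambda>c p. Scal c * p) star \<tau>"
    and rel: "\<And>r. r \<in> R \<Longrightarrow> bounded_positive_functional.gns star \<tau> r = 0"
  obtains \<phi> where "state \<phi>" "\<And>p. poly_vars p \<subseteq> X \<Longrightarrow> \<phi> (eval_poly a p) = \<tau> p"
proof -
  interpret bounded_positive_functional "\<lambda>c p. Scal c * p" star \<tau> by fact
  define D where "D = {eval_poly a p | p. poly_vars p \<subseteq> X}"
  have D: "closure D = UNIV"
    unfolding D_def by (rule closure_eval_poly[OF univ])
  have "cstar_seminorm gns"
    unfolding cstar_seminorm_def
    using gns_nonneg gns_add gns_sc gns_mult gns_star_mult by blast
  then have le: "cmod (\<tau> p) \<le> norm (eval_poly a p)" if "poly_vars p \<subseteq> X" for p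
    using univ rel that tau_le_gns[of p] unfolding universal_cstar_algebra_def
    by (meson order_trans)
  \<comment> \<open>The graph of the real part of \<open>\<tau>\<close>. Since it is stable under
    negation, a linear \<open>f\<close> lying above it coincides with it.\<close>
  define K where "K = {(eval_poly a p, Re (\<tau> p)) | p. poly_vars p \<subseteq> X}"
  obtain f where f: "linear f" "\<And>x. f x \<le> norm x" "\<And>y s. (y, s) \<in> K \<Longrightarrow> s \<le> f y"
  proof (rule Hahn_Banach)
    show "sublinear (norm :: 'a \<Rightarrow> real)"
      by (simp add: sublinear_def norm_triangle_ineq)
    show "cone K"
      unfolding cone_def
    proof (intro ballI allI impI)
      fix v and c :: real assume "v \<in> K"
      then obtain p where p: "v = (eval_poly a p, Re (\<tau> p))" "poly_vars p \<subseteq> X"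
        by (auto simp: K_def)
      have "c *\<^sub>R v = (eval_poly a (Scal c * p), Re (\<tau> (Scal c * p)))"
        by (simp add: p(1) tau_sc eval_poly_Scal_mult scaleC_of_real)
      moreover have "poly_vars (Scal (complex_of_real c) * p) \<subseteq> X"
        using p(2) by (intro poly_vars_closed)
      ultimately show "c *\<^sub>R v \<in> K"
        unfolding K_def by blast
    qed
    show "v + w \<in> K" if vw: "v \<in> K" "w \<in> K" for v w
    proof -
      obtain p q where pq: "v = (eval_poly a p, Re (\<tau> p))" "poly_vars p \<subseteq> X"
        "w = (eval_poly a q, Re (\<tau> q))" "poly_vars q \<subseteq> X"
        using vw by (auto simp: K_def)
      have "v + w = (eval_poly a (p + q), Re (\<tau> (p + q)))"
        by (simp add: pq tau_add eval_poly_add)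
      moreover have "poly_vars (p + q) \<subseteq> X"
        using pq by (intro poly_vars_closed)
      ultimately show ?thesis
        unfolding K_def by blast
    qed
    show "K \<noteq> {}"
      unfolding K_def using poly_vars_closed(4)[of 0 X] by blast
    show "s \<le> norm y" if "(y, s) \<in> K" for y s
      using that le by (auto simp: K_def intro: order_trans[OF complex_Re_le_cmod])
  qed (rule that)
  interpret linear f by (rule f(1))
  have f_eval: "f (eval_poly a p) = Re (\<tau> p)" if "poly_vars p \<subseteq> X" for p
  proof (rule antisym)
    have "poly_vars (Scal (- 1) * p) \<subseteq> X"
      using that by (intro poly_vars_closed)
    then have "(eval_poly a (Scal (- 1) * p), Re (\<tau> (Scal (- 1) * p))) \<in> K"
      unfolding K_def by blast
    then have "Re (\<tau> (Scal (- 1) * p)) \<le> f (eval_poly a (Scal (- 1) * p))"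
      by (rule f(3))
    then show "f (eval_poly a p) \<le> Re (\<tau> p)"
      by (simp add: tau_sc eval_poly_Scal_mult scaleC_minus_left neg)
    show "Re (\<tau> p) \<le> f (eval_poly a p)"
      using that by (intro f(3)) (auto simp: K_def)
  qed
  define \<phi> where "\<phi> = complexify f"
  have phi_eval: "\<phi> (eval_poly a p) = \<tau> p" if "poly_vars p \<subseteq> X" for p
  proof -
    have "poly_vars (Scal \<i> * p) \<subseteq> X"
      using that by (intro poly_vars_closed)
    then have "f (\<i> *\<^sub>C eval_poly a p) = - Im (\<tau> p)"
      using f_eval[of "Scal \<i> * p"] by (simp add: tau_sc eval_poly_Scal_mult)
    then show ?thesis
      using f_eval[OF that] by (simp add: \<phi>_def complexify_def complex_eq_iff)
  qed
  have "bounded_linear f"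
  proof (rule bounded_linear_intro[of f 1])
    show "norm (f x) \<le> norm x * 1" for x
      using f(2)[of x] f(2)[of "- x"] neg[of x] by simp
  qed (auto simp: add scale)
  then have cont_f: "continuous_on UNIV f"
    by (rule linear_continuous_on)
  \<comment> \<open>Positivity is a closed condition, so it passes from the dense set
    \<open>D\<close> to all elements.\<close>
  have "continuous_on UNIV (\<lambda>x. \<phi> (star x * x))"
    unfolding \<phi>_def complexify_def Complex_eq
    by (intro continuous_intros continuous_on_compose2[OF cont_f] continuous_on_star
        continuous_on_compose2[OF continuous_on_scaleC]) auto
  then have "closed {x. \<phi> (star x * x) \<in> \<real>\<^sub>\<ge>\<^sub>0}"
    using continuous_closed_vimage[OF closed_nonneg_Reals_complex]
    by (auto simp: vimage_def continuous_on_eq_continuous_at)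
  moreover have "\<phi> (star x * x) \<in> \<real>\<^sub>\<ge>\<^sub>0" if x: "x \<in> D" for x
  proof -
    obtain p where p: "x = eval_poly a p" "poly_vars p \<subseteq> X"
      using x by (auto simp: D_def)
    have "poly_vars (star p * p) \<subseteq> X"
      using p(2) by (intro poly_vars_closed)
    then show ?thesis
      using phi_eval[of "star p * p"] tau_pos[of p] by (simp add: p(1) eval_poly_mult eval_poly_star)
  qed
  ultimately have "\<phi> (star x * x) \<in> \<real>\<^sub>\<ge>\<^sub>0" for x
    using closed_induct[of x D "\<lambda>x. \<phi> (star x * x) \<in> \<real>\<^sub>\<ge>\<^sub>0"] D by blast
  moreover have "\<phi> 1 = 1"
    using phi_eval[of "Scal 1"] by (simp add: eval_poly_Scal poly_vars_closed(4)) (simp add: Scal_def tau_one)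
  ultimately have "state \<phi>"
    by (simp add: state_def \<phi>_def complexify_linear[OF f(1)])
  then show ?thesis
    using that phi_eval by blast
qed

text \<open>The kernel is a block matrix of ones; the sum over one class is the squared modulus of
  the sum of its coefficients.\<close>

lemma sum_partition_square:
  fixes a :: "'w \<Rightarrow> complex" and cls :: "'w \<Rightarrow> 'c"
  assumes "finite F"
  shows "(\<Sum>v\<in>F. \<Sum>w\<in>F. cnj (a v) * a w * of_bool (cls v = cls w)) \<in> \<real>\<^sub>\<ge>\<^sub>0"
proof -
  define S where "S = (\<lambda>c. \<Sum>v\<in>{v\<in>F. cls v = c}. a v)"
  have "(\<Sum>v\<in>F. \<Sum>w\<in>F. cnj (a v) * a w * of_bool (cls v = cls w)) = (\<Sum>v\<in>F. cnj (a v) * S (cls v))"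
    using assms by (intro sum.cong refl)
      (auto simp: S_def sum_distrib_left of_bool_def split: if_splits intro!: sum.mono_neutral_cong_right)
  also have "\<dots> = (\<Sum>c\<in>cls ` F. \<Sum>v\<in>{v\<in>F. cls v = c}. cnj (a v) * S (cls v))"
    by (rule sum.image_gen[OF assms])
  also have "\<dots> = (\<Sum>c\<in>cls ` F. cnj (S c) * S c)"
    by (auto simp: S_def sum_distrib_right intro!: sum.cong)
  also have "\<dots> = of_real (\<Sum>c\<in>cls ` F. (cmod (S c))\<^sup>2)"
    by (simp add: complex_norm_square mult.commute del: of_real_power)
  also have "\<dots> \<in> \<real>\<^sub>\<ge>\<^sub>0"
    by (simp add: sum_nonneg del: of_real_sum)
  finally show ?thesis .
qed

section \<open>The positive functional of a subgroup\<close>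

context group
begin

text \<open>Letters outside the group are sent to the neutral element, so that word values are
  defined on all words.\<close>

definition word_val :: "'a word \<Rightarrow> 'a" where
  "word_val w = foldr (\<lambda>(x, b) y. (if x \<in> carrier G then if b then inv x else x else \<one>) \<otimes> y)
     (letters w) \<one>"

lemma word_val_Nil: "word_val (Word []) = \<one>"
  by (simp add: word_val_def)

lemma word_val_Cons:
  "word_val (Word ((x, b) # l)) =
    (if x \<in> carrier G then if b then inv x else x else \<one>) \<otimes> word_val (Word l)"
  by (simp add: word_val_def)

lemma word_val_closed [simp]: "word_val w \<in> carrier G"
proof -
  have "word_val (Word l) \<in> carrier G" for l
    by (induction l) (auto simp: word_val_Nil word_val_Cons)
  then show ?thesis
    by (cases w) simp
qed

lemma word_val_zero: "word_val 0 = \<one>"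
  by (simp add: zero_word_def word_val_Nil)

lemma word_val_add: "word_val (v + w) = word_val v \<otimes> word_val w"
proof -
  have "word_val (Word (l @ l')) = word_val (Word l) \<otimes> word_val (Word l')" for l l'
    by (induction l) (auto simp: word_val_Nil word_val_Cons m_assoc)
  then show ?thesis
    by (cases v; cases w) (simp add: plus_word_def)
qed

lemma word_val_star: "word_val (star w) = inv (word_val w)"
proof -
  have "word_val (star (Word l)) = inv (word_val (Word l))" for l
  proof (induction l)
    case (Cons a l)
    obtain x b where a: "a = (x, b)"
      by force
    have "star (Word (a # l)) = star (Word l) + Word [(x, \<not> b)]"
      by (simp add: star_word_def plus_word_def a)
    then show ?case
      using Cons by (simp add: word_val_add word_val_Cons word_val_Nil a inv_mult_group)
  qed (simp add: star_word_def word_val_Nil)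
  then show ?thesis
    by (cases w) simp
qed

text \<open>The characteristic function of \<open>K\<close>, pulled back to words: the vector state
  of the trivial coset in the permutation representation on the left cosets of
  \<open>K\<close>.\<close>

definition subgroup_functional :: "'a set \<Rightarrow> 'a star_poly \<Rightarrow> complex" where
  "subgroup_functional K p =
     (\<Sum>w\<in>Poly_Mapping.keys p. Poly_Mapping.lookup p w * of_bool (word_val w \<in> K))"

lemma subgroup_functional_single [simp]:
  "subgroup_functional K (Poly_Mapping.single w c) = c * of_bool (word_val w \<in> K)"
  by (cases "c = 0") (simp_all add: subgroup_functional_def)

lemma subgroup_functional_add:
  "subgroup_functional K (p + q) = subgroup_functional K p + subgroup_functional K q"
  unfolding subgroup_functional_def
  by (rule setsum_keys_plus_distrib[where f = "\<lambda>w c. c * of_bool (word_val w \<in> K)"])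
    (simp_all add: distrib_right)

lemma subgroup_functional_Scal:
  "subgroup_functional K (Scal c * p) = c * subgroup_functional K p"
  by (induction p rule: poly_mapping_induct_single)
    (simp_all add: Scal_def mult_single distrib_left subgroup_functional_add)

lemma subgroup_functional_zero [simp]: "subgroup_functional K 0 = 0"
  by (simp add: subgroup_functional_def)

lemma subgroup_functional_sum:
  "subgroup_functional K (\<Sum>i\<in>I. p i) = (\<Sum>i\<in>I. subgroup_functional K (p i))"
  by (induction I rule: infinite_finite_induct) (simp_all add: subgroup_functional_add)

text \<open>Words of equal value may be exchanged inside any product. Both the boundedness of the
  functional and the vanishing of the relations rest on this.\<close>

lemma subgroup_functional_cong:
  assumes "word_val v = word_val w"
  shows "subgroup_functional K (p * Poly_Mapping.single v c * q) =
    subgroup_functional K (p * Poly_Mapping.single w c * q)"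
proof (induction p rule: poly_mapping_induct_single)
  case (single u d)
  show ?case
    by (induction q rule: poly_mapping_induct_single)
      (simp_all add: mult_single word_val_add assms distrib_left subgroup_functional_add)
qed (simp add: distrib_right subgroup_functional_add)

lemma subgroup_functional_pos:
  assumes "subgroup K G"
  shows "subgroup_functional K (star p * p) \<in> \<real>\<^sub>\<ge>\<^sub>0"
proof -
  interpret subgroup K G by fact
  \<comment> \<open>The left coset of \<open>word_val w\<close>. The functional takes the value 1 at
    \<open>star v + w\<close> exactly if \<open>v\<close> and \<open>w\<close> have the same
    coset.\<close>
  define cls where "cls = (\<lambda>w. {x \<in> carrier G. inv (word_val w) \<otimes> x \<in> K})"
  have eq: "inv (word_val v) \<otimes> word_val w \<in> K \<longleftrightarrow> cls v = cls w" for v w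
  proof
    assume vw: "inv (word_val v) \<otimes> word_val w \<in> K"
    have "inv (word_val v) \<otimes> x = (inv (word_val v) \<otimes> word_val w) \<otimes> (inv (word_val w) \<otimes> x)"
      "inv (word_val w) \<otimes> x = inv (inv (word_val v) \<otimes> word_val w) \<otimes> (inv (word_val v) \<otimes> x)"
      if "x \<in> carrier G" for x
      using that by (simp_all add: m_assoc inv_mult_group) (simp_all flip: m_assoc)
    then show "cls v = cls w"
      using vw unfolding cls_def by (metis (no_types, lifting) m_closed m_inv_closed)
  next
    assume "cls v = cls w"
    moreover have "word_val w \<in> cls w"
      by (simp add: cls_def)
    ultimately have "word_val w \<in> cls v"
      by simp
    then show "inv (word_val v) \<otimes> word_val w \<in> K"
      by (simp add: cls_def)
  qed
  let ?F = "Poly_Mapping.keys p" and ?a = "Poly_Mapping.lookup p"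
  have p: "p = (\<Sum>w\<in>?F. Poly_Mapping.single w (?a w))"
    by (rule poly_mapping_sum_single)
  have star_sum: "star (\<Sum>w\<in>S. q w) = (\<Sum>w\<in>S. star (q w :: 'a star_poly))" for S q
  proof (induction S rule: infinite_finite_induct)
    case empty
    then show ?case
      using star_poly_add[of 0 "0 :: 'a star_poly"] by simp
  qed (use star_poly_add[of 0 "0 :: 'a star_poly"] in \<open>simp_all add: star_poly_add\<close>)
  have "star p * p = (\<Sum>v\<in>?F. star (Poly_Mapping.single v (?a v))) * (\<Sum>w\<in>?F. Poly_Mapping.single w (?a w))"
    by (subst (1 2) p) (simp only: star_sum)
  then have "subgroup_functional K (star p * p) =
      (\<Sum>v\<in>?F. \<Sum>w\<in>?F. cnj (?a v) * ?a w * of_bool (cls v = cls w))"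
    by (simp add: sum_product star_poly_single mult_single subgroup_functional_sum word_val_add
        word_val_star eq)
  then show ?thesis
    using sum_partition_square[of ?F ?a cls] by simp
qed

text \<open>A monomial acts as a multiple of an isometry, because \<open>star w + w\<close> has the
  value of the empty word. Sums of bounded operators are handled by
  \<open>(a + b)\<^sup>2 \<le> 2 a\<^sup>2 + 2 b\<^sup>2\<close>.\<close>

lemma bounded_positive_functional_subgroup:
  assumes K: "subgroup K G"
  shows "bounded_positive_functional (\<lambda>c p. Scal c * p) star (subgroup_functional K)"
proof -
  interpret positive_functional "\<lambda>c p. Scal c * p" star "subgroup_functional K"
    using star_algebra_star_poly
    by (simp add: positive_functional_def positive_functional_axioms_def subgroup_functional_add
        subgroup_functional_Scal subgroup_functional_pos[OF K])
  show ?thesis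
  proof
    show "subgroup_functional K 1 = 1"
      using subgroup.one_closed[OF K] subgroup_functional_single[of K 0 1] by (simp add: word_val_zero)
    fix x :: "'a star_poly"
    show "\<exists>C. \<forall>y. Re (subgroup_functional K (star (x * y) * (x * y)))
        \<le> C * Re (subgroup_functional K (star y * y))"
    proof (induction x rule: poly_mapping_induct_single)
      case (single w c)
      have "subgroup_functional K (star (Poly_Mapping.single w c * y) * (Poly_Mapping.single w c * y)) =
          of_real ((cmod c)\<^sup>2) * subgroup_functional K (star y * y)" for y
      proof -
        have "star (Poly_Mapping.single w c * y) * (Poly_Mapping.single w c * y) =
            star y * Poly_Mapping.single (star w + w) (cnj c * c) * y"
          by (simp add: star_poly_mult star_poly_single mult.assoc flip: mult_single)
        also have "subgroup_functional K \<dots> = subgroup_functional K (star y * Scal (cnj c * c) * y)"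
          unfolding Scal_def
          by (rule subgroup_functional_cong) (simp add: word_val_add word_val_star word_val_zero)
        also have "star y * Scal (cnj c * c) * y = Scal (cnj c * c) * (star y * y)"
          by (simp add: Scal_mult_commute mult.assoc)
        finally show ?thesis
          using complex_norm_square[of c] by (simp add: subgroup_functional_Scal mult.commute)
      qed
      then show ?case
        by (intro exI[of _ "(cmod c)\<^sup>2"]) (simp del: of_real_power)
    next
      case (add p q)
      then obtain C D where CD:
        "\<And>y. Re (subgroup_functional K (star (p * y) * (p * y))) \<le> C * Re (subgroup_functional K (star y * y))"
        "\<And>y. Re (subgroup_functional K (star (q * y) * (q * y))) \<le> D * Re (subgroup_functional K (star y * y))"
        by blast
      have "Re (subgroup_functional K (star ((p + q) * y) * ((p + q) * y)))
          \<le> (2 * C + 2 * D) * Re (subgroup_functional K (star y * y))" for y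
      proof -
        have "(nrm ((p + q) * y))\<^sup>2 \<le> (nrm (p * y) + nrm (q * y))\<^sup>2"
          by (intro power_mono) (simp_all add: distrib_right nrm_add nrm_nonneg)
        also have "\<dots> \<le> 2 * (nrm (p * y))\<^sup>2 + 2 * (nrm (q * y))\<^sup>2"
          using zero_le_power2[of "nrm (p * y) - nrm (q * y)"] by (simp add: power2_eq_square algebra_simps)
        finally show ?thesis
          using CD(1)[of y] CD(2)[of y] by (simp add: nrm_square distrib_right)
      qed
      then show ?case
        by blast
    qed
  qed
qed

lemma subgroup_functional_gns_relation:
  assumes K: "subgroup K G" and "word_val v = word_val w"
  shows "bounded_positive_functional.gns star (subgroup_functional K)
    (Poly_Mapping.single v 1 - Poly_Mapping.single w 1) = 0"
proof -
  interpret bounded_positive_functional "\<lambda>c p. Scal c * p" star "subgroup_functional K"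
    by (rule bounded_positive_functional_subgroup[OF K])
  let ?r = "Poly_Mapping.single v 1 - Poly_Mapping.single w (1 :: complex)"
  have diff: "subgroup_functional K (p - q) = subgroup_functional K p - subgroup_functional K q" for p q
    using tau_add[of p "- q"] tau_uminus[of q] by simp
  show ?thesis
  proof (rule gns_eq_zero)
    fix y
    have "star (?r * y) * (?r * y) =
        star (?r * y) * Poly_Mapping.single v 1 * y - star (?r * y) * Poly_Mapping.single w 1 * y"
      by (simp add: algebra_simps)
    then show "subgroup_functional K (star (?r * y) * (?r * y)) = 0"
      using subgroup_functional_cong[OF assms(2)] by (simp add: diff)
  qed
qed

theorem exists_subgroup_state:
  assumes "universal_cstar_algebra (carrier G) (group_relations G) \<iota>" and K: "subgroup K G"
  obtains \<omega> where "state \<omega>" "\<And>g. g \<in> carrier G \<Longrightarrow> \<omega> (\<iota> g) = of_bool (g \<in> K)"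
proof -
  have "bounded_positive_functional.gns star (subgroup_functional K) r = 0" if "r \<in> group_relations G" for r
  proof -
    \<comment> \<open>Every group relation is a difference of two words of equal value, hence null
      for the functional of any subgroup.\<close>
    have "\<exists>v w. word_val v = word_val w \<and> r = Poly_Mapping.single v 1 - Poly_Mapping.single w 1"
      using that unfolding group_relations_def
    proof (elim UnE)
      assume "r \<in> {Gen \<one> - 1}"
      then show ?thesis
        by (intro exI[of _ "Word [(\<one>, False)]"] exI[of _ 0])
          (simp add: Gen_def word_val_Cons word_val_Nil word_val_zero)
    next
      assume "r \<in> {Gen g * Gen h - Gen (g \<otimes> h) | g h. g \<in> carrier G \<and> h \<in> carrier G}"
      then obtain g h where gh: "g \<in> carrier G" "h \<in> carrier G" "r = Gen g * Gen h - Gen (g \<otimes> h)"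
        by blast
      then show ?thesis
        by (intro exI[of _ "Word [(g, False), (h, False)]"] exI[of _ "Word [(g \<otimes> h, False)]"])
          (simp add: Gen_def mult_single plus_word_def word_val_Cons word_val_Nil)
    next
      assume "r \<in> {star (Gen g) - Gen (inv g) | g. g \<in> carrier G}"
      then obtain g where g: "g \<in> carrier G" "r = star (Gen g) - Gen (inv g)"
        by blast
      then show ?thesis
        by (intro exI[of _ "Word [(g, True)]"] exI[of _ "Word [(inv g, False)]"])
          (simp add: Gen_def star_poly_single star_word_def word_val_Cons word_val_Nil)
    qed
    then show ?thesis
      using subgroup_functional_gns_relation[OF K] by blast
  qed
  then obtain \<omega> where \<omega>: "state \<omega>"
    "\<And>p. poly_vars p \<subseteq> carrier G \<Longrightarrow> \<omega> (eval_poly \<iota> p) = subgroup_functional K p"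
    using universal_cstar_algebra_state[OF assms(1) bounded_positive_functional_subgroup[OF K]] by blast
  have "\<omega> (\<iota> g) = of_bool (g \<in> K)" if "g \<in> carrier G" for g
    using \<omega>(2)[OF poly_vars_closed(5)[OF that]] that unfolding eval_poly_Gen
    by (simp add: Gen_def word_val_Cons word_val_Nil)
  then show ?thesis
    using that \<omega>(1) by blast
qed

end

section \<open>Slice maps of minimal tensor products\<close>

text \<open>The element \<open>b k\<close> is split off by orthogonalising the other elements of the second family
  against it; if its seminorm is 0, then the Cauchy-Schwarz inequality makes it orthogonal to
  everything, as \<open>x / 0 = 0\<close> requires.\<close>

lemma Schur_product_pos:
  fixes a :: "'i \<Rightarrow> 'a::cstar_algebra" and b :: "'i \<Rightarrow> 'b::cstar_algebra"
  assumes "state \<phi>" "state \<psi>" "finite I"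
  shows "(\<Sum>i\<in>I. \<Sum>j\<in>I. \<phi> (star (a i) * a j) * \<psi> (star (b i) * b j)) \<in> \<real>\<^sub>\<ge>\<^sub>0"
  using assms(3)
proof (induction I arbitrary: b)
  case (insert k I)
  interpret A: positive_functional scaleC star \<phi>
    by (rule positive_functional_state[OF assms(1)])
  interpret B: positive_functional scaleC star \<psi>
    by (rule positive_functional_state[OF assms(2)])
  define Q where "Q = (\<lambda>i j. \<psi> (star (b i) * b j))"
  \<comment> \<open>Gram-Schmidt coefficients. The index \<open>k\<close> is treated apart: if
    \<open>Q k k = 0\<close>, the quotient would be 0 instead of 1, and \<open>c k\<close> would not
    be 0.\<close>
  define q where "q = (\<lambda>i. if i = k then 1 else Q k i / Q k k)"
  define c where "c = (\<lambda>i. if i = k then 0 else b i - q i *\<^sub>C b k)"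
  have Qk: "Q k i = q i * Q k k" for i
  proof (cases "Q k k = 0")
    case True
    then have "B.nrm (b k) = 0"
      by (simp add: B.nrm_def Q_def)
    then have "Q k i = 0"
      using B.Cauchy_Schwarz[of "b k" "b i"] by (simp add: Q_def)
    then show ?thesis
      using True by simp
  qed (simp add: q_def)
  have b_eq: "b i = c i + q i *\<^sub>C b k" for i
    by (simp add: c_def q_def)
  have orth: "\<psi> (star (b k) * c i) = 0" for i
    using Qk[of i] by (simp add: c_def right_diff_distrib state_diff[OF assms(2)] mult_scaleC_right
        B.tau_sc Q_def)
  then have orth': "\<psi> (star (c i) * b k) = 0" for i
    using B.hermitian[of "c i" "b k"] by simp
  define d where "d = Q k k"
  have Q_eq: "Q i j = \<psi> (star (c i) * c j) + cnj (q i) * q j * d" for i j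
    unfolding Q_def by (subst (1 2) b_eq)
      (simp add: star_add star_scaleC distrib_left distrib_right mult_scaleC_left mult_scaleC_right
        B.tau_add B.tau_sc orth orth' scaleC_scaleC d_def Q_def)
  let ?K = "insert k I"
  let ?s = "\<Sum>i\<in>?K. q i *\<^sub>C a i"
  \<comment> \<open>As \<open>c k = 0\<close>, the index \<open>k\<close> drops out, and the
    induction hypothesis is applied to the family \<open>c\<close> in place of
    \<open>b\<close>.\<close>
  have sum1: "(\<Sum>i\<in>?K. \<Sum>j\<in>?K. \<phi> (star (a i) * a j) * \<psi> (star (c i) * c j)) =
      (\<Sum>i\<in>I. \<Sum>j\<in>I. \<phi> (star (a i) * a j) * \<psi> (star (c i) * c j))"
    using insert.hyps by (simp add: c_def)
  have phi_sum: "\<phi> (\<Sum>i\<in>S. f i) = (\<Sum>i\<in>S. \<phi> (f i))" for S :: "'i set" and f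
    by (induction S rule: infinite_finite_induct) (simp_all add: A.tau_add)
  have star_sum: "star (\<Sum>i\<in>S. f i) = (\<Sum>i\<in>S. star (f i :: 'a))" for S :: "'i set" and f
    by (induction S rule: infinite_finite_induct) (simp_all add: star_add)
  have "star ?s * ?s = (\<Sum>i\<in>?K. \<Sum>j\<in>?K. star (q i *\<^sub>C a i) * (q j *\<^sub>C a j))"
    by (simp only: star_sum sum_product)
  then have "\<phi> (star ?s * ?s) = (\<Sum>i\<in>?K. \<Sum>j\<in>?K. q j * cnj (q i) * \<phi> (star (a i) * a j))"
    by (simp only: phi_sum star_scaleC mult_scaleC_left mult_scaleC_right A.tau_sc scaleC_scaleC)
  then have sum2: "(\<Sum>i\<in>?K. \<Sum>j\<in>?K. \<phi> (star (a i) * a j) * (cnj (q i) * q j * d)) =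
      d * \<phi> (star ?s * ?s)"
    by (simp only: sum_distrib_left mult_ac)
  have eq: "(\<Sum>i\<in>?K. \<Sum>j\<in>?K. \<phi> (star (a i) * a j) * Q i j) =
      (\<Sum>i\<in>I. \<Sum>j\<in>I. \<phi> (star (a i) * a j) * \<psi> (star (c i) * c j)) + d * \<phi> (star ?s * ?s)"
    unfolding Q_eq distrib_left sum.distrib sum1 sum2 ..
  have "d * \<phi> (star ?s * ?s) \<in> \<real>\<^sub>\<ge>\<^sub>0"
    unfolding d_def Q_def by (rule nonneg_Reals_mult_I[OF B.tau_pos A.tau_pos])
  then have "(\<Sum>i\<in>?K. \<Sum>j\<in>?K. \<phi> (star (a i) * a j) * Q i j) \<in> \<real>\<^sub>\<ge>\<^sub>0"
    unfolding eq by (rule nonneg_Reals_add_I[OF insert.IH])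
  then show ?case
    unfolding Q_def .
qed simp

section \<open>The inner product of two product states on the algebraic tensor product\<close>

definition tensor_form ::
    "('a::cstar_algebra \<Rightarrow> complex) \<Rightarrow> ('b::cstar_algebra \<Rightarrow> complex) \<Rightarrow>
     ('a \<times> 'b) list \<Rightarrow> ('a \<times> 'b) list \<Rightarrow> complex" where
  "tensor_form \<phi> \<psi> xs ys =
     (\<Sum>(a, b)\<leftarrow>xs. \<Sum>(a', b')\<leftarrow>ys. \<phi> (star a * a') * \<psi> (star b * b'))"

lemma product_functional_tmult_tstar:
  "product_functional \<phi> \<psi> (tmult (tstar xs) ys) = tensor_form \<phi> \<psi> xs ys"
proof (induction xs)
  case (Cons x xs)
  have "product_functional \<phi> \<psi> [(star (fst x) * a', star (snd x) * b'). (a', b') \<leftarrow> ys] =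
      (\<Sum>(a', b')\<leftarrow>ys. \<phi> (star (fst x) * a') * \<psi> (star (snd x) * b'))"
    by (induction ys) (auto simp: product_functional_def)
  then show ?case
    using Cons by (auto simp: tensor_form_def tmult_def tstar_def product_functional_def case_prod_unfold)
qed (simp add: tensor_form_def tmult_def tstar_def product_functional_def)

lemma tensor_form_nth:
  "tensor_form \<phi> \<psi> xs ys = (\<Sum>i<length xs. \<Sum>j<length ys.
     \<phi> (star (fst (xs ! i)) * fst (ys ! j)) * \<psi> (star (snd (xs ! i)) * snd (ys ! j)))"
  by (simp add: tensor_form_def sum_list_sum_nth case_prod_unfold atLeast0LessThan)

lemma tensor_form_append:
  "tensor_form \<phi> \<psi> (xs @ ys) zs = tensor_form \<phi> \<psi> xs zs + tensor_form \<phi> \<psi> ys zs"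
  "tensor_form \<phi> \<psi> zs (xs @ ys) = tensor_form \<phi> \<psi> zs xs + tensor_form \<phi> \<psi> zs ys"
  by (simp_all add: tensor_form_def case_prod_unfold sum_list_addf)

context
  fixes \<phi> :: "'a::cstar_algebra \<Rightarrow> complex" and \<psi> :: "'b::cstar_algebra \<Rightarrow> complex"
  assumes states: "state \<phi>" "state \<psi>"
begin

interpretation A: positive_functional scaleC star \<phi>
  by (rule positive_functional_state[OF states(1)])

interpretation B: positive_functional scaleC star \<psi>
  by (rule positive_functional_state[OF states(2)])

lemma tensor_form_pos: "tensor_form \<phi> \<psi> xs xs \<in> \<real>\<^sub>\<ge>\<^sub>0"
  unfolding tensor_form_nth by (rule Schur_product_pos[OF states]) simp

lemma Re_tensor_form: "0 \<le> Re (tensor_form \<phi> \<psi> xs xs)"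
  using tensor_form_pos[of xs] by (simp add: complex_nonneg_Reals_iff)

text \<open>The parallelogram law without the term of the difference, which is represented by
  negating the first components of \<open>ys\<close>.\<close>

lemma tensor_form_append_le:
  "Re (tensor_form \<phi> \<psi> (xs @ ys) (xs @ ys)) \<le>
    2 * Re (tensor_form \<phi> \<psi> xs xs) + 2 * Re (tensor_form \<phi> \<psi> ys ys)"
proof -
  define zs where "zs = map (\<lambda>(a, b). (- a, b)) ys"
  have neg: "tensor_form \<phi> \<psi> xs zs = - tensor_form \<phi> \<psi> xs ys"
    "tensor_form \<phi> \<psi> zs xs = - tensor_form \<phi> \<psi> ys xs"
    "tensor_form \<phi> \<psi> zs zs = tensor_form \<phi> \<psi> ys ys"
    by (simp_all add: zs_def tensor_form_nth case_prod_unfold A.tau_uminus sum_negf)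
  have "0 \<le> Re (tensor_form \<phi> \<psi> (xs @ zs) (xs @ zs))"
    by (rule Re_tensor_form)
  then show ?thesis
    by (simp add: tensor_form_append neg)
qed

text \<open>The argument of \<open>state_square_le\<close> carried out in the first factor: the
  difference of the two sides is the form at \<open>ys\<close> multiplied by the root
  \<open>h\<close>.\<close>

lemma tensor_form_map_left_le:
  "Re (tensor_form \<phi> \<psi> (map (apfst ((*) x)) ys) (map (apfst ((*) x)) ys))
    \<le> (norm x)\<^sup>2 * Re (tensor_form \<phi> \<psi> ys ys)"
proof -
  have "pos (of_real ((norm x)\<^sup>2) - star x * x)"
    by (rule pos_diff_of_norm_le) (simp_all add: star_mult star_star norm_star_mult)
  then obtain h where h: "pos h" "h * h = of_real ((norm x)\<^sup>2) - star x * x"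
    using pos_sqrt by blast
  have "star (h * y) * (h * z) = of_real ((norm x)\<^sup>2) *\<^sub>C (star y * z) - star (x * y) * (x * z)" for y z
  proof -
    have "star (h * y) * (h * z) = star y * (h * h) * z"
      by (simp add: star_mult pos_selfadjoint[OF h(1)] mult.assoc)
    also have "\<dots> = of_real ((norm x)\<^sup>2) *\<^sub>C (star y * z) - star (x * y) * (x * z)"
      unfolding h(2) scaleC_of_real by (simp add: of_real_def algebra_simps star_mult)
    finally show ?thesis .
  qed
  then have "\<phi> (star (h * y) * (h * z)) =
      of_real ((norm x)\<^sup>2) * \<phi> (star y * z) - \<phi> (star (x * y) * (x * z))" for y z
    by (simp only: state_diff[OF states(1)] A.tau_sc)
  then have "tensor_form \<phi> \<psi> (map (apfst ((*) h)) ys) (map (apfst ((*) h)) ys) =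
      of_real ((norm x)\<^sup>2) * tensor_form \<phi> \<psi> ys ys
      - tensor_form \<phi> \<psi> (map (apfst ((*) x)) ys) (map (apfst ((*) x)) ys)"
    by (simp add: tensor_form_nth left_diff_distrib sum_subtractf sum_distrib_left mult.assoc
        del: of_real_power)
  then show ?thesis
    using Re_tensor_form[of "map (apfst ((*) h)) ys"] by (simp del: of_real_power)
qed

end

lemma tensor_form_swap: "tensor_form \<phi> \<psi> xs ys = tensor_form \<psi> \<phi> (map prod.swap xs) (map prod.swap ys)"
  by (simp add: tensor_form_nth mult.commute)

lemma tensor_form_map_right_le:
  assumes "state \<phi>" "state \<psi>"
  shows "Re (tensor_form \<phi> \<psi> (map (apsnd ((*) x)) ys) (map (apsnd ((*) x)) ys))
    \<le> (norm x)\<^sup>2 * Re (tensor_form \<phi> \<psi> ys ys)"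
proof -
  have "map prod.swap (map (apsnd ((*) x)) ys) = map (apfst ((*) x)) (map prod.swap ys)"
    by (simp add: prod.swap_def)
  then show ?thesis
    using tensor_form_map_left_le[OF assms(2,1), of x "map prod.swap ys"]
    by (simp only: tensor_form_swap[of \<phi> \<psi>])
qed

text \<open>\<open>C\<close> is uniform in the states and in \<open>ys\<close>, so the set whose
  supremum defines \<open>spatial_norm\<close> is bounded above.\<close>

lemma tensor_form_bounded:
  fixes xs :: "('a::cstar_algebra \<times> 'b::cstar_algebra) list"
  obtains C where "\<And>\<phi> \<psi> ys. state \<phi> \<Longrightarrow> state \<psi> \<Longrightarrow>
    Re (tensor_form \<phi> \<psi> (tmult xs ys) (tmult xs ys)) \<le> C * Re (tensor_form \<phi> \<psi> ys ys)"
proof -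
  have "\<exists>C. \<forall>\<phi> \<psi> ys. state \<phi> \<longrightarrow> state \<psi> \<longrightarrow>
    Re (tensor_form \<phi> \<psi> (tmult xs ys) (tmult xs ys)) \<le> C * Re (tensor_form \<phi> \<psi> ys ys)"
  proof (induction xs)
    case Nil
    then show ?case
      by (auto simp: tmult_def tensor_form_def intro!: exI[of _ 0])
  next
    case (Cons x xs)
    then obtain C where C: "\<And>\<phi> \<psi> ys. state \<phi> \<Longrightarrow> state \<psi> \<Longrightarrow>
      Re (tensor_form \<phi> \<psi> (tmult xs ys) (tmult xs ys)) \<le> C * Re (tensor_form \<phi> \<psi> ys ys)"
      by blast
    obtain a b where x: "x = (a, b)"
      by force
    define D where "D = (norm b)\<^sup>2 * (norm a)\<^sup>2"
    have "Re (tensor_form \<phi> \<psi> (tmult (x # xs) ys) (tmult (x # xs) ys))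
        \<le> (2 * D + 2 * C) * Re (tensor_form \<phi> \<psi> ys ys)"
      if st: "state \<phi>" "state \<psi>" for \<phi> :: "'a \<Rightarrow> complex" and \<psi> :: "'b \<Rightarrow> complex" and ys
    proof -
      let ?zs = "map (apfst ((*) a)) ys"
      let ?ws = "map (apsnd ((*) b)) ?zs"
      have "tmult (x # xs) ys = ?ws @ tmult xs ys"
        by (simp add: tmult_def x case_prod_unfold apfst_def apsnd_def map_prod_def)
      moreover have "Re (tensor_form \<phi> \<psi> ?ws ?ws) \<le> (norm b)\<^sup>2 * Re (tensor_form \<phi> \<psi> ?zs ?zs)"
        by (rule tensor_form_map_right_le[OF st])
      moreover have "\<dots> \<le> (norm b)\<^sup>2 * ((norm a)\<^sup>2 * Re (tensor_form \<phi> \<psi> ys ys))"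
        by (intro mult_left_mono tensor_form_map_left_le[OF st]) simp
      ultimately show ?thesis
        using tensor_form_append_le[OF st, of ?ws "tmult xs ys"] C[OF st, of ys]
        by (simp add: D_def algebra_simps)
    qed
    then show ?case
      by blast
  qed
  then show ?thesis
    using that by blast
qed

text \<open>The choice \<open>ys = [(1, 1)]\<close>, the cyclic unit vector, in the
  supremum.\<close>

lemma spatial_norm_ge:
  fixes xs :: "('a::cstar_algebra \<times> 'b::cstar_algebra) list"
  assumes "state \<phi>" "state \<psi>"
  shows "Re (tensor_form \<phi> \<psi> xs xs) \<le> (spatial_norm xs)\<^sup>2"
proof -
  define S where "S = {Re (tensor_form \<phi> \<psi> (tmult xs ys) (tmult xs ys)) / Re (tensor_form \<phi> \<psi> ys ys)
      | \<phi> \<psi> ys. state \<phi> \<and> state \<psi> \<and> tensor_form \<phi> \<psi> ys ys \<noteq> 0}"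
  obtain C where C: "\<And>\<phi> \<psi> ys. state \<phi> \<Longrightarrow> state \<psi> \<Longrightarrow>
    Re (tensor_form \<phi> \<psi> (tmult xs ys) (tmult xs ys)) \<le> C * Re (tensor_form \<phi> \<psi> ys ys)"
    using tensor_form_bounded[of xs] by blast
  have bdd: "bdd_above S"
  proof (rule bdd_aboveI)
    fix r assume "r \<in> S"
    then obtain \<phi> \<psi> ys where st: "state \<phi>" "state \<psi>" "tensor_form \<phi> \<psi> ys ys \<noteq> 0"
      and r: "r = Re (tensor_form \<phi> \<psi> (tmult xs ys) (tmult xs ys)) / Re (tensor_form \<phi> \<psi> ys ys)"
      by (auto simp: S_def)
    have "0 < Re (tensor_form \<phi> \<psi> ys ys)"
      using tensor_form_pos[OF st(1,2), of ys] st(3)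
      by (auto simp: complex_nonneg_Reals_iff complex_eq_iff less_le)
    then show "r \<le> C"
      using C[OF st(1,2), of ys] by (simp add: r field_simps)
  qed
  have "tmult xs [(1, 1)] = xs"
    by (induction xs) (auto simp: tmult_def)
  moreover have "tensor_form \<phi> \<psi> [(1, 1)] [(1, 1)] = 1"
    using assms by (simp add: tensor_form_def state_def)
  ultimately have mem: "Re (tensor_form \<phi> \<psi> xs xs) \<in> S"
    unfolding S_def using assms by (intro CollectI exI[of _ \<phi>] exI[of _ \<psi>] exI[of _ "[(1, 1)]"]) simp
  have "Re (tensor_form \<phi> \<psi> xs xs) \<le> Sup S"
    by (rule cSup_upper[OF mem bdd])
  moreover have "0 \<le> Sup S"
    using calculation Re_tensor_form[OF assms, of xs] by linarith
  moreover have "spatial_norm xs = sqrt (Sup S)"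
    by (simp add: spatial_norm_def product_functional_tmult_tstar S_def)
  ultimately show ?thesis
    by simp
qed

text \<open>A variance argument: centring every \<open>a\<close> to
  \<open>a - \<omega> a *\<^sub>C 1\<close> lowers the form of \<open>xs\<close> by exactly
  \<open>\<phi> (star s * s)\<close>, and the form of the centred list is still nonnegative. A
  norming state \<open>\<phi>\<close> turns this into the norm of the slice.\<close>

theorem norm_slice_le:
  fixes t :: "'h::cstar_algebra \<Rightarrow> 'a::cstar_algebra \<Rightarrow> 't::cstar_algebra"
  assumes t: "min_tensor t" and \<omega>: "state \<omega>"
  shows "norm (\<Sum>(a, b)\<leftarrow>xs. \<omega> a *\<^sub>C b) \<le> norm (\<Sum>(a, b)\<leftarrow>xs. t a b)"
proof -
  define s where "s = (\<Sum>(a, b)\<leftarrow>xs. \<omega> a *\<^sub>C b)"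
  obtain \<phi> where \<phi>: "state \<phi>" "\<phi> (star s * s) = (norm s)\<^sup>2"
    by (rule exists_norming_state)
  interpret A: positive_functional scaleC star \<omega>
    by (rule positive_functional_state[OF \<omega>])
  interpret B: positive_functional scaleC star \<phi>
    by (rule positive_functional_state[OF \<phi>(1)])
  define ys where "ys = map (apfst (\<lambda>a. a - \<omega> a *\<^sub>C 1)) xs"
  have one: "\<omega> 1 = 1" and star: "\<omega> (star a) = cnj (\<omega> a)" for a
    using \<omega> A.hermitian[of a 1] by (simp_all add: state_def)
  have center: "\<omega> (star (a - \<omega> a *\<^sub>C 1) * (b - \<omega> b *\<^sub>C 1)) = \<omega> (star a * b) - cnj (\<omega> a) * \<omega> b" for a b
    by (simp add: star_diff star_scaleC left_diff_distrib right_diff_distrib state_diff[OF \<omega>]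
        mult_scaleC_left mult_scaleC_right A.tau_sc one star)
  have s: "s = (\<Sum>i<length xs. \<omega> (fst (xs ! i)) *\<^sub>C snd (xs ! i))"
    by (simp add: s_def sum_list_sum_nth case_prod_unfold atLeast0LessThan)
  have phi_sum: "\<phi> (\<Sum>i\<in>S. f i) = (\<Sum>i\<in>S. \<phi> (f i))" for S :: "nat set" and f
    by (induction S rule: infinite_finite_induct) (simp_all add: B.tau_add)
  have star_sum: "star (\<Sum>i\<in>S. f i) = (\<Sum>i\<in>S. star (f i :: 'a))" for S :: "nat set" and f
    by (induction S rule: infinite_finite_induct) (simp_all add: star_add)
  have "\<phi> (star s * s) = (\<Sum>i<length xs. \<Sum>j<length xs. cnj (\<omega> (fst (xs ! i))) * \<omega> (fst (xs ! j)) *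
      \<phi> (star (snd (xs ! i)) * snd (xs ! j)))"
    unfolding s star_sum sum_product phi_sum
    by (simp add: star_scaleC mult_scaleC_left mult_scaleC_right B.tau_sc scaleC_scaleC mult_ac)
  then have "tensor_form \<omega> \<phi> ys ys = tensor_form \<omega> \<phi> xs xs - \<phi> (star s * s)"
    by (simp add: ys_def tensor_form_nth center left_diff_distrib sum_subtractf)
  then have "(norm s)\<^sup>2 \<le> Re (tensor_form \<omega> \<phi> xs xs)"
    using Re_tensor_form[OF \<omega> \<phi>(1), of ys] \<phi>(2) by simp
  also have "\<dots> \<le> (spatial_norm xs)\<^sup>2"
    by (rule spatial_norm_ge[OF \<omega> \<phi>(1)])
  also have "spatial_norm xs = norm (\<Sum>(a, b)\<leftarrow>xs. t a b)"
    using t by (simp add: min_tensor_def)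
  finally show ?thesis
    unfolding s_def by (rule power2_le_imp_le) simp
qed

section \<open>The universality of the free unitary quantum group\<close>

text \<open>The entrywise form, in which the relations can be evaluated; the last two families
  belong to the transpose.\<close>

lemma biunitary_relations_eq:
  "biunitary_relations n = (\<Union>i\<in>{..<n}. \<Union>j\<in>{..<n}.
    {(\<Sum>l<n. Gen (i, l) * star (Gen (j, l))) - Scal (of_bool (i = j)),
     (\<Sum>l<n. star (Gen (l, i)) * Gen (l, j)) - Scal (of_bool (i = j)),
     (\<Sum>l<n. Gen (l, i) * star (Gen (l, j))) - Scal (of_bool (i = j)),
     (\<Sum>l<n. star (Gen (i, l)) * Gen (j, l)) - Scal (of_bool (i = j))})"
proof -
  have elements: "elements_mat A = (\<Union>i\<in>{..<n}. \<Union>j\<in>{..<n}. {A $$ (i, j)})"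
    if "A \<in> carrier_mat n n" for A :: "(nat \<times> nat) star_poly mat"
    using that by (fastforce intro: elements_matI)
  have rel: "elements_mat (w * adjoint_mat w - 1\<^sub>m n) \<union> elements_mat (adjoint_mat w * w - 1\<^sub>m n) =
      (\<Union>i\<in>{..<n}. \<Union>j\<in>{..<n}.
        {(\<Sum>l<n. w $$ (i, l) * star (w $$ (j, l))) - Scal (of_bool (i = j)),
         (\<Sum>l<n. star (w $$ (l, i)) * w $$ (l, j)) - Scal (of_bool (i = j))})"
    if w: "w \<in> carrier_mat n n" for w :: "(nat \<times> nat) star_poly mat"
  proof -
    have aw: "adjoint_mat w \<in> carrier_mat n n"
      using w by (simp add: adjoint_mat_def)
    have one: "(A - 1\<^sub>m n) $$ (i, j) = A $$ (i, j) - (Scal (of_bool (i = j)) :: (nat \<times> nat) star_poly)"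
      if "i < n" "j < n" for A i j
      using that by (simp add: Scal_def)
    have "(w * adjoint_mat w - 1\<^sub>m n) $$ (i, j) =
        (\<Sum>l<n. w $$ (i, l) * star (w $$ (j, l))) - Scal (of_bool (i = j))"
      and "(adjoint_mat w * w - 1\<^sub>m n) $$ (i, j) =
        (\<Sum>l<n. star (w $$ (l, i)) * w $$ (l, j)) - Scal (of_bool (i = j))"
      if "i < n" "j < n" for i j
      unfolding one[OF that] using that w aw
      by (simp_all add: scalar_prod_def adjoint_mat_def atLeast0LessThan)
    then have "(\<Union>i\<in>{..<n}. \<Union>j\<in>{..<n}. {(w * adjoint_mat w - 1\<^sub>m n) $$ (i, j)}) =
        (\<Union>i\<in>{..<n}. \<Union>j\<in>{..<n}. {(\<Sum>l<n. w $$ (i, l) * star (w $$ (j, l))) - Scal (of_bool (i = j))})"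
      and "(\<Union>i\<in>{..<n}. \<Union>j\<in>{..<n}. {(adjoint_mat w * w - 1\<^sub>m n) $$ (i, j)}) =
        (\<Union>i\<in>{..<n}. \<Union>j\<in>{..<n}. {(\<Sum>l<n. star (w $$ (l, i)) * w $$ (l, j)) - Scal (of_bool (i = j))})"
      by auto
    moreover have "w * adjoint_mat w - 1\<^sub>m n \<in> carrier_mat n n" "adjoint_mat w * w - 1\<^sub>m n \<in> carrier_mat n n"
      by auto
    ultimately show ?thesis
      by (simp only: elements) blast
  qed
  have "Matrix.mat n n Gen \<in> carrier_mat n n" "transpose_mat (Matrix.mat n n Gen) \<in> carrier_mat n n"
    by auto
  then show ?thesis
    unfolding biunitary_relations_def Let_def UN_insert UN_empty rel[OF \<open>Matrix.mat n n Gen \<in> _\<close>]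
      rel[OF \<open>transpose_mat (Matrix.mat n n Gen) \<in> _\<close>]
    by (auto simp: transpose_mat_def)
qed

lemma eval_poly_sum: "eval_poly a (\<Sum>i\<in>I. p i) = (\<Sum>i\<in>I. eval_poly a (p i))"
  by (induction I rule: infinite_finite_induct)
    (simp_all add: eval_poly_add, simp_all add: eval_poly_def)

lemma extend_mat_index:
  assumes "v \<in> carrier_mat k k" "k \<le> n" "i < n" "j < n"
  shows "extend_mat k n v $$ (i, j) = (if i < k \<and> j < k then v $$ (i, j) else of_bool (i = j))"
  using assms by (auto simp: extend_mat_def)

text \<open>Replacing the generators outside the upper left block by 0 and 1 turns a *-polynomial in the
  entries of \<open>u\<close> into one in the entries of \<open>v\<close>, without changing its image under \<open>f\<close> modulo the null
  ideal of \<open>gns\<close>.\<close>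

theorem free_unitary_factor:
  fixes u :: "'u::cstar_algebra mat" and v :: "'v::cstar_algebra mat"
    and f :: "'u \<Rightarrow> 'a::cstar_algebra"
  assumes u: "universal_cstar_algebra ({..<n} \<times> {..<n}) (biunitary_relations n) (\<lambda>ij. u $$ ij)"
    and v: "universal_cstar_algebra ({..<k} \<times> {..<k}) (biunitary_relations k) (\<lambda>ij. v $$ ij)"
    and carrier: "u \<in> carrier_mat n n" "v \<in> carrier_mat k k" and k: "k \<le> n"
    and p: "star_hom p" "map_mat p u = extend_mat k n v"
    and f: "star_hom f" and \<omega>: "state \<omega>"
    and id: "\<And>i j. i < n \<Longrightarrow> j < n \<Longrightarrow> k \<le> i \<or> k \<le> j \<Longrightarrow>
      bounded_positive_functional.gns star \<omega> (f (u $$ (i, j)) - of_bool (i = j)) = 0"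
  shows "bounded_positive_functional.gns star \<omega> (f z) \<le> norm (p z)"
proof -
  interpret bounded_positive_functional scaleC star \<omega>
    by (rule bounded_positive_functional_state[OF \<omega>])
  note f_hom = f[unfolded star_hom_def]
  note p_hom = p(1)[unfolded star_hom_def]
  have f_diff: "f (x - y) = f x - f y" for x y
    by (rule star_hom_diff[OF f])
  have p_diff: "p (x - y) = p x - p y" for x y
    by (rule star_hom_diff[OF p(1)])
  have null_add: "gns (x + y) = 0" if "gns x = 0" "gns y = 0" for x y
    using gns_add[of x y] gns_nonneg[of "x + y"] that by simp
  have null_sc: "gns (c *\<^sub>C x) = 0" if "gns x = 0" for c x
    using that by (simp add: gns_sc)
  have null_diff: "gns (x - y) = 0" if "gns x = 0" "gns y = 0" for x y
    using null_add[of x "(- 1) *\<^sub>C y"] null_sc[of y "- 1"] that by (simp add: scaleC_minus_left)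
  have null_left: "gns (y * x) = 0" if "gns x = 0" for x y
    using gns_mult[of y x] gns_nonneg[of "y * x"] that by simp
  have null_right: "gns (x * y) = 0" if "gns x = 0" for x y
    using gns_mult[of x y] gns_nonneg[of "x * y"] that by simp
  have null_star: "gns (star x) = 0" if "gns x = 0" for x
    using gns_star_mult[of "star x"] null_left[OF that, of 1] null_right[OF that, of "star x"]
    by (simp add: star_star)
  have null_zero: "gns 0 = 0"
    using gns_sc[of 0 0] by simp
  have null_sum: "gns (\<Sum>i\<in>S. g i) = 0" if "\<And>i. i \<in> S \<Longrightarrow> gns (g i) = 0" for S :: "nat set" and g
    using that by (induction S rule: infinite_finite_induct) (simp_all add: null_zero null_add)
  define b where "b = (\<lambda>ij. f (u $$ ij))"
  have rel_n: "eval_poly b r = 0" if "r \<in> biunitary_relations n" for r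
    using u that eval_poly_star_hom[OF f, of "\<lambda>ij. u $$ ij" r] star_hom_zero[OF f]
    by (simp add: universal_cstar_algebra_def b_def)
  have rel_k: "gns (eval_poly b r) = 0" if r: "r \<in> biunitary_relations k" for r
  proof -
    \<comment> \<open>A relation of size \<open>n\<close> holds exactly for the images of
      \<open>u\<close>. For indices below \<open>k\<close> its terms with \<open>l \<ge> k\<close>
      are null, so the relation of size \<open>k\<close> holds modulo the null ideal.\<close>
    have reduce: "gns ((\<Sum>l<k. F l) - c) = 0"
      if "(\<Sum>l<n. F l) - c = 0" "\<And>l. k \<le> l \<Longrightarrow> l < n \<Longrightarrow> gns (F l) = 0" for F and c :: 'a
    proof -
      have "(\<Sum>l<n. F l) = (\<Sum>l<k. F l) + (\<Sum>l\<in>{k..<n}. F l)"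
        using k by (metis add.commute atLeast0LessThan sum.atLeastLessThan_concat zero_le)
      then have "(\<Sum>l<k. F l) - c = 0 - (\<Sum>l\<in>{k..<n}. F l)"
        using that(1) by (simp add: algebra_simps)
      then show ?thesis
        using null_diff[OF null_zero null_sum[of "{k..<n}" F]] that(2) by simp
    qed
    have bk: "gns (b (i, l)) = 0" "gns (b (l, i)) = 0" if "i < k" "k \<le> l" "l < n" for i l
      using id[of i l] id[of l i] that k by (auto simp: b_def)
    obtain i j where ij: "i < k" "j < k" and
      r: "r = (\<Sum>l<k. Gen (i, l) * star (Gen (j, l))) - Scal (of_bool (i = j)) \<or>
          r = (\<Sum>l<k. star (Gen (l, i)) * Gen (l, j)) - Scal (of_bool (i = j)) \<or>
          r = (\<Sum>l<k. Gen (l, i) * star (Gen (l, j))) - Scal (of_bool (i = j)) \<or>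
          r = (\<Sum>l<k. star (Gen (i, l)) * Gen (j, l)) - Scal (of_bool (i = j))"
      using r unfolding biunitary_relations_eq by blast
    have in_n:
      "(\<Sum>l<n. Gen (i, l) * star (Gen (j, l))) - Scal (of_bool (i = j)) \<in> biunitary_relations n"
      "(\<Sum>l<n. star (Gen (l, i)) * Gen (l, j)) - Scal (of_bool (i = j)) \<in> biunitary_relations n"
      "(\<Sum>l<n. Gen (l, i) * star (Gen (l, j))) - Scal (of_bool (i = j)) \<in> biunitary_relations n"
      "(\<Sum>l<n. star (Gen (i, l)) * Gen (j, l)) - Scal (of_bool (i = j)) \<in> biunitary_relations n"
      unfolding biunitary_relations_eq using ij k
      by (intro UN_I[of i] UN_I[of j]; simp)+
    note eval = eval_poly_diff eval_poly_sum eval_poly_mult eval_poly_star eval_poly_Gen eval_poly_Scal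
    show ?thesis
      using r
    proof (elim disjE)
      assume r: "r = (\<Sum>l<k. Gen (i, l) * star (Gen (j, l))) - Scal (of_bool (i = j))"
      show ?thesis
        using rel_n[OF in_n(1)] ij unfolding r eval by (elim reduce) (simp add: null_right bk)
    next
      assume r: "r = (\<Sum>l<k. star (Gen (l, i)) * Gen (l, j)) - Scal (of_bool (i = j))"
      show ?thesis
        using rel_n[OF in_n(2)] ij unfolding r eval by (elim reduce) (simp add: null_left bk)
    next
      assume r: "r = (\<Sum>l<k. Gen (l, i) * star (Gen (l, j))) - Scal (of_bool (i = j))"
      show ?thesis
        using rel_n[OF in_n(3)] ij unfolding r eval by (elim reduce) (simp add: null_right bk)
    next
      assume r: "r = (\<Sum>l<k. star (Gen (i, l)) * Gen (j, l)) - Scal (of_bool (i = j))"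
      show ?thesis
        using rel_n[OF in_n(4)] ij unfolding r eval by (elim reduce) (simp add: null_left bk)
    qed
  qed
  have "cstar_seminorm (\<lambda>q. gns (eval_poly b q))"
    unfolding cstar_seminorm_def
    by (auto simp: gns_nonneg gns_add eval_poly_add eval_poly_Scal gns_sc eval_poly_mult gns_mult
        eval_poly_star gns_star_mult mult_scaleC_left)
  then have le_v: "gns (eval_poly b q) \<le> norm (eval_poly (\<lambda>ij. v $$ ij) q)"
    if "poly_vars q \<subseteq> {..<k} \<times> {..<k}" for q
    using v rel_k that unfolding universal_cstar_algebra_def by meson
  \<comment> \<open>\<open>q\<close> represents \<open>z\<close> on both sides at once: exactly
    under \<open>p\<close>, and modulo the null ideal under \<open>f\<close>. For such
    \<open>z\<close> the universal bound on \<open>q\<close> is the claim, so it remains to see that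
    they are dense.\<close>
  define lift where "lift = (\<lambda>q z. poly_vars q \<subseteq> {..<k} \<times> {..<k} \<and>
    eval_poly (\<lambda>ij. v $$ ij) q = p z \<and> gns (eval_poly b q - f z) = 0)"
  define D where "D = {z. \<exists>q. lift q z}"
  have lift_Scal: "lift (Scal c) (c *\<^sub>C 1)" for c
    using f_hom p_hom by (simp add: lift_def poly_vars_closed(4) eval_poly_Scal null_zero)
  have lift_add: "lift (q + q') (z + z')" if "lift q z" "lift q' z'" for q q' z z'
    using that f_hom p_hom null_add[of "eval_poly b q - f z" "eval_poly b q' - f z'"]
    by (simp add: lift_def poly_vars_closed(1) eval_poly_add algebra_simps)
  have lift_mult: "lift (q * q') (z * z')" if "lift q z" "lift q' z'" for q q' z z'
  proof -
    have "eval_poly b (q * q') - f (z * z') =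
        (eval_poly b q - f z) * eval_poly b q' + f z * (eval_poly b q' - f z')"
      using f_hom by (simp add: eval_poly_mult algebra_simps)
    then show ?thesis
      using that p_hom by (simp add: lift_def poly_vars_closed(2) null_add null_left null_right)
        (simp add: eval_poly_mult)
  qed
  have lift_star: "lift (star q) (star z)" if "lift q z" for q z
    using that f_hom p_hom null_star[of "eval_poly b q - f z"]
    by (simp add: lift_def poly_vars_closed(3) eval_poly_star star_diff)
  have "star_subalgebra D"
    unfolding star_subalgebra_def csubspace_def
  proof (intro conjI ballI allI)
    show "0 \<in> D" "1 \<in> D"
      using lift_Scal[of 0] lift_Scal[of 1] by (auto simp: D_def)
    show "x + y \<in> D" "x * y \<in> D" if "x \<in> D" "y \<in> D" for x y
      using that lift_add lift_mult unfolding D_def by blast+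
    show "star x \<in> D" if "x \<in> D" for x
      using that lift_star unfolding D_def by blast
    show "c *\<^sub>C x \<in> D" if x: "x \<in> D" for c x
    proof -
      obtain q where "lift q x"
        using x D_def by blast
      then have "lift (Scal c * q) (c *\<^sub>C 1 * x)"
        by (intro lift_mult lift_Scal)
      then show ?thesis
        unfolding D_def by (auto simp: mult_scaleC_left)
    qed
  qed
  moreover have "u $$ (i, j) \<in> D" if ij: "i < n" "j < n" for i j
  proof -
    have p_u: "p (u $$ (i, j)) = (if i < k \<and> j < k then v $$ (i, j) else of_bool (i = j))"
      using ij carrier extend_mat_index[OF carrier(2) k ij] arg_cong[OF p(2), of "\<lambda>A. A $$ (i, j)"] by simp
    show ?thesis
    proof (cases "i < k \<and> j < k")
      case True
      then have "lift (Gen (i, j)) (u $$ (i, j))"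
        by (simp add: lift_def poly_vars_closed(5) eval_poly_Gen p_u b_def null_zero)
      then show ?thesis
        unfolding D_def by blast
    next
      case False
      then have "gns (of_bool (i = j) - f (u $$ (i, j))) = 0"
        using null_diff[OF null_zero id[OF ij]] by auto
      moreover have "p (u $$ (i, j)) = of_bool (i = j)"
        using False p_u by auto
      ultimately have "lift (Scal (of_bool (i = j))) (u $$ (i, j))"
        by (cases "i = j") (simp_all add: lift_def poly_vars_closed(4) eval_poly_Scal)
      then show ?thesis
        unfolding D_def by blast
    qed
  qed
  ultimately have "generated_cstar ((\<lambda>ij. u $$ ij) ` ({..<n} \<times> {..<n})) \<subseteq> closure D"
    using closure_subset by (intro generated_cstar_subset cstar_subalgebra_closure) blast+
  then have "z \<in> closure D"
    using u by (auto simp: universal_cstar_algebra_def)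
  show ?thesis
  proof (rule field_le_epsilon)
    \<comment> \<open>The approximation error enters twice, through \<open>f\<close> and through
      \<open>p\<close>, whence \<open>e / 2\<close>.\<close>
    fix e :: real assume "0 < e"
    then obtain z' where z': "z' \<in> D" "norm (z' - z) < e / 2"
      using \<open>z \<in> closure D\<close> unfolding closure_approachable by (metis dist_norm half_gt_zero)
    obtain q where q: "lift q z'"
      using z'(1) D_def by blast
    have "f z = f (z - z') + (f z' - eval_poly b q) + eval_poly b q"
      by (simp add: f_diff)
    then have "gns (f z) \<le> gns (f (z - z')) + gns (f z' - eval_poly b q) + gns (eval_poly b q)"
      by (metis gns_add order_trans add_right_mono)
    moreover have "gns (f (z - z')) \<le> norm (z' - z)"
      using gns_le_norm[OF \<omega>, of "f (z - z')"] star_hom_norm_le[OF f, of "z - z'"]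
      by (simp add: norm_minus_commute)
    moreover have "gns (f z' - eval_poly b q) = 0"
      using q null_diff[OF null_zero, of "eval_poly b q - f z'"] by (simp add: lift_def)
    moreover have "gns (eval_poly b q) \<le> norm (p z')"
      using q le_v[of q] by (simp add: lift_def)
    moreover have "norm (p z') \<le> norm (p z) + norm (p (z' - z))"
      using norm_triangle_ineq[of "p z" "p (z' - z)"] by (simp add: p_diff)
    moreover have "norm (p (z' - z)) \<le> norm (z' - z)"
      by (rule star_hom_norm_le[OF p(1)])
    ultimately show "gns (f z) \<le> norm (p z) + e"
      using z'(2) by linarith
  qed
qed

section \<open>Spans of group elements\<close>

text \<open>Lists of terms fit the lists on which \<open>min_tensor\<close> prescribes the
  norm.\<close>

definition lin_span :: "('g \<Rightarrow> 'a::cstar_algebra) \<Rightarrow> 'g set \<Rightarrow> 'a set" where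
  "lin_span \<iota> K = {\<Sum>(c, g)\<leftarrow>l. c *\<^sub>C \<iota> g | l. snd ` set l \<subseteq> K}"

lemma lin_span_add: "x \<in> lin_span \<iota> K \<Longrightarrow> y \<in> lin_span \<iota> K \<Longrightarrow> x + y \<in> lin_span \<iota> K"
proof -
  assume "x \<in> lin_span \<iota> K" "y \<in> lin_span \<iota> K"
  then obtain l l' where "x = (\<Sum>(c, g)\<leftarrow>l. c *\<^sub>C \<iota> g)" "snd ` set l \<subseteq> K"
    "y = (\<Sum>(c, g)\<leftarrow>l'. c *\<^sub>C \<iota> g)" "snd ` set l' \<subseteq> K"
    unfolding lin_span_def by blast
  then have "x + y = (\<Sum>(c, g)\<leftarrow>l @ l'. c *\<^sub>C \<iota> g)" "snd ` set (l @ l') \<subseteq> K"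
    by auto
  then show ?thesis
    unfolding lin_span_def by blast
qed

lemma lin_span_zero: "0 \<in> lin_span \<iota> K"
  unfolding lin_span_def by (rule CollectI, rule exI[of _ "[]"]) simp

lemma lin_span_scaleC_generator: "g \<in> K \<Longrightarrow> c *\<^sub>C \<iota> g \<in> lin_span \<iota> K"
  unfolding lin_span_def by (rule CollectI, rule exI[of _ "[(c, g)]"]) simp

lemma lin_span_induct [consumes 1, case_names zero add]:
  assumes "x \<in> lin_span \<iota> K" "P 0" "\<And>c g y. g \<in> K \<Longrightarrow> P y \<Longrightarrow> P (c *\<^sub>C \<iota> g + y)"
  shows "P x"
proof -
  have "P (\<Sum>(c, g)\<leftarrow>l. c *\<^sub>C \<iota> g)" if "snd ` set l \<subseteq> K" for l
    using that by (induction l) (auto intro: assms(2,3))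
  then show ?thesis
    using assms(1) unfolding lin_span_def by blast
qed

lemma lin_span_scaleC: "x \<in> lin_span \<iota> K \<Longrightarrow> c *\<^sub>C x \<in> lin_span \<iota> K"
  by (induction x rule: lin_span_induct)
    (auto simp: scaleC_add_right scaleC_scaleC lin_span_zero intro: lin_span_add lin_span_scaleC_generator)

lemma lin_span_subset:
  assumes "csubspace B" "\<iota> ` K \<subseteq> B"
  shows "lin_span \<iota> K \<subseteq> B"
proof
  fix x assume "x \<in> lin_span \<iota> K"
  then show "x \<in> B"
    by (induction x rule: lin_span_induct) (use assms in \<open>auto simp: csubspace_def\<close>)
qed

lemma linear_functional_eq_zero:
  fixes F :: "'a::cstar_algebra \<Rightarrow> complex"
  assumes add: "\<And>x y. F (x + y) = F x + F y" and scale: "\<And>c x. F (c *\<^sub>C x) = c * F x"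
    and bounded: "\<And>x. cmod (F x) \<le> norm x * C"
    and zero: "\<And>g. g \<in> K \<Longrightarrow> F (\<iota> g) = 0" and x: "x \<in> closure (lin_span \<iota> K)"
  shows "F x = 0"
proof (rule closed_induct[OF x])
  have "bounded_linear F"
  proof (rule bounded_linear_intro[of F C])
    show "F (r *\<^sub>R x) = r *\<^sub>R F x" for r x
      using scale[of "complex_of_real r" x] by (simp add: scaleC_of_real scaleR_conv_of_real)
  qed (simp_all add: add bounded)
  then have "continuous_on UNIV F"
    by (rule linear_continuous_on)
  then show "closed {x. F x = 0}"
    by (intro closed_Collect_eq continuous_on_const)
  have F0: "F 0 = 0"
    using scale[of 0 0] by simp
  show "F x = 0" if "x \<in> lin_span \<iota> K" for x
    using that by (induction x rule: lin_span_induct) (auto simp: F0 add scale zero)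
qed

lemma dual_quantum_group_canonical:
  assumes "group \<Gamma>" "dual_quantum_group \<Gamma> G \<iota>"
  shows "\<iota> \<one>\<^bsub>\<Gamma>\<^esub> = 1"
    and "g \<in> carrier \<Gamma> \<Longrightarrow> h \<in> carrier \<Gamma> \<Longrightarrow> \<iota> (g \<otimes>\<^bsub>\<Gamma>\<^esub> h) = \<iota> g * \<iota> h"
    and "g \<in> carrier \<Gamma> \<Longrightarrow> \<iota> (inv\<^bsub>\<Gamma>\<^esub> g) = star (\<iota> g)"
proof -
  have rel: "eval_poly \<iota> r = 0" if "r \<in> group_relations \<Gamma>" for r
    using assms(2) that by (simp add: dual_quantum_group_def universal_cstar_algebra_def)
  note eval = eval_poly_diff eval_poly_mult eval_poly_star eval_poly_Gen eval_poly_one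
  have "Gen \<one>\<^bsub>\<Gamma>\<^esub> - 1 \<in> group_relations \<Gamma>"
    by (simp add: group_relations_def)
  from rel[OF this] show "\<iota> \<one>\<^bsub>\<Gamma>\<^esub> = 1"
    by (simp add: eval)
  show "\<iota> (g \<otimes>\<^bsub>\<Gamma>\<^esub> h) = \<iota> g * \<iota> h" if "g \<in> carrier \<Gamma>" "h \<in> carrier \<Gamma>"
  proof -
    have "Gen g * Gen h - Gen (g \<otimes>\<^bsub>\<Gamma>\<^esub> h) \<in> group_relations \<Gamma>"
      using that unfolding group_relations_def by blast
    from rel[OF this] show ?thesis
      by (simp add: eval)
  qed
  show "\<iota> (inv\<^bsub>\<Gamma>\<^esub> g) = star (\<iota> g)" if "g \<in> carrier \<Gamma>"
  proof -
    have "star (Gen g) - Gen (inv\<^bsub>\<Gamma>\<^esub> g) \<in> group_relations \<Gamma>"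
      using that unfolding group_relations_def by blast
    from rel[OF this] show ?thesis
      by (simp add: eval)
  qed
qed

lemma star_subalgebra_lin_span:
  assumes "group \<Gamma>" "dual_quantum_group \<Gamma> G \<iota>" "subgroup K \<Gamma>"
  shows "star_subalgebra (lin_span \<iota> K)"
proof -
  interpret group \<Gamma> by fact
  note canonical = dual_quantum_group_canonical[OF assms(1,2)]
  have K: "K \<subseteq> carrier \<Gamma>"
    by (rule subgroup.subset[OF assms(3)])
  have gen_mult: "\<iota> g * x \<in> lin_span \<iota> K" if "x \<in> lin_span \<iota> K" "g \<in> K" for g x
    using that(1)
  proof (induction x rule: lin_span_induct)
    case (add c h y)
    have "\<iota> g * (c *\<^sub>C \<iota> h) = c *\<^sub>C \<iota> (g \<otimes>\<^bsub>\<Gamma>\<^esub> h)"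
      using canonical(2)[OF subsetD[OF K that(2)] subsetD[OF K add(1)]] by (simp add: mult_scaleC_right)
    then show ?case
      using add subgroup.m_closed[OF assms(3) that(2)]
      by (auto simp: distrib_left intro: lin_span_add lin_span_scaleC_generator)
  qed (simp add: lin_span_zero)
  have "x * y \<in> lin_span \<iota> K" if "x \<in> lin_span \<iota> K" "y \<in> lin_span \<iota> K" for x y
    using that(1)
    by (induction x rule: lin_span_induct)
      (auto simp: lin_span_zero distrib_right mult_scaleC_left
        intro!: lin_span_add lin_span_scaleC gen_mult[OF that(2)])
  moreover have "star x \<in> lin_span \<iota> K" if "x \<in> lin_span \<iota> K" for x
    using that
  proof (induction x rule: lin_span_induct)
    case (add c h y)
    have "star (c *\<^sub>C \<iota> h) = cnj c *\<^sub>C \<iota> (inv\<^bsub>\<Gamma>\<^esub> h)"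
      using canonical(3)[OF subsetD[OF K add(1)]] by (simp add: star_scaleC)
    then show ?case
      using add subgroup.m_inv_closed[OF assms(3)]
      by (auto simp: star_add intro!: lin_span_add lin_span_scaleC_generator)
  qed (simp add: lin_span_zero)
  moreover have "1 \<in> lin_span \<iota> K"
    using lin_span_scaleC_generator[OF subgroup.one_closed[OF assms(3)], of 1 \<iota>] canonical(1) by simp
  ultimately show ?thesis
    by (simp add: star_subalgebra_def csubspace_def lin_span_add lin_span_scaleC lin_span_zero)
qed

lemma closure_lin_span_carrier:
  assumes "group \<Gamma>" "dual_quantum_group \<Gamma> G \<iota>"
  shows "closure (lin_span \<iota> (carrier \<Gamma>)) = UNIV"
proof -
  have "\<iota> ` carrier \<Gamma> \<subseteq> lin_span \<iota> (carrier \<Gamma>)"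
    using lin_span_scaleC_generator[of _ "carrier \<Gamma>" 1 \<iota>] by auto
  then have "generated_cstar (\<iota> ` carrier \<Gamma>) \<subseteq> closure (lin_span \<iota> (carrier \<Gamma>))"
    using closure_subset group.subgroup_self[OF assms(1)]
    by (intro generated_cstar_subset cstar_subalgebra_closure star_subalgebra_lin_span[OF assms]) blast+
  then show ?thesis
    using assms(2) by (auto simp: dual_quantum_group_def universal_cstar_algebra_def)
qed

text \<open>The state of \<open>K\<close> is translated by the inverse of \<open>y\<close>. The
  translate takes the value 1 at \<open>\<iota> y\<close>, and it vanishes on
  \<open>\<iota> g\<close> for \<open>g \<in> K\<close> if \<open>y \<notin> K\<close>.\<close>

lemma mem_if_closure_lin_span:
  assumes \<Gamma>: "group \<Gamma>" and G: "dual_quantum_group \<Gamma> G \<iota>" and K: "subgroup K \<Gamma>"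
    and y: "y \<in> carrier \<Gamma>" "\<iota> y \<in> closure (lin_span \<iota> K)"
  shows "y \<in> K"
proof (rule ccontr)
  assume "y \<notin> K"
  interpret group \<Gamma> by fact
  note canonical = dual_quantum_group_canonical[OF \<Gamma> G]
  obtain \<omega> where \<omega>: "state \<omega>" "\<And>g. g \<in> carrier \<Gamma> \<Longrightarrow> \<omega> (\<iota> g) = of_bool (g \<in> K)"
    using exists_subgroup_state[of \<iota> K] G K by (auto simp: dual_quantum_group_def)
  define F where "F = (\<lambda>x. \<omega> (\<iota> (inv\<^bsub>\<Gamma>\<^esub> y) * x))"
  have "F (\<iota> y) = 0"
  proof (rule linear_functional_eq_zero[OF _ _ _ _ y(2), where C = "norm (\<iota> (inv\<^bsub>\<Gamma>\<^esub> y))"])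
    show "F (x + x') = F x + F x'" "F (c *\<^sub>C x) = c * F x" for x x' c
      using \<omega>(1) by (simp_all add: F_def distrib_left mult_scaleC_right state_def)
    show "cmod (F x) \<le> norm x * norm (\<iota> (inv\<^bsub>\<Gamma>\<^esub> y))" for x
      using state_norm_le[OF \<omega>(1)] norm_mult_ineq[of "\<iota> (inv\<^bsub>\<Gamma>\<^esub> y)" x] order_trans
      unfolding F_def by (metis mult.commute)
    show "F (\<iota> g) = 0" if "g \<in> K" for g
    proof -
      have g: "g \<in> carrier \<Gamma>"
        using that subgroup.subset[OF K] by blast
      have "inv\<^bsub>\<Gamma>\<^esub> y \<otimes>\<^bsub>\<Gamma>\<^esub> g \<notin> K"
      proof
        assume "inv\<^bsub>\<Gamma>\<^esub> y \<otimes>\<^bsub>\<Gamma>\<^esub> g \<in> K"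
        then have "g \<otimes>\<^bsub>\<Gamma>\<^esub> inv\<^bsub>\<Gamma>\<^esub> (inv\<^bsub>\<Gamma>\<^esub> y \<otimes>\<^bsub>\<Gamma>\<^esub> g) \<in> K"
          using that K by (simp add: subgroup.m_closed subgroup.m_inv_closed)
        moreover have "g \<otimes>\<^bsub>\<Gamma>\<^esub> inv\<^bsub>\<Gamma>\<^esub> (inv\<^bsub>\<Gamma>\<^esub> y \<otimes>\<^bsub>\<Gamma>\<^esub> g) = y"
          using g y(1) by (simp add: inv_mult_group flip: m_assoc)
        ultimately show False
          using \<open>y \<notin> K\<close> by simp
      qed
      then show ?thesis
        using \<omega>(2)[of "inv\<^bsub>\<Gamma>\<^esub> y \<otimes>\<^bsub>\<Gamma>\<^esub> g"] g y(1) by (simp add: F_def canonical(2))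
    qed
  qed
  moreover have "F (\<iota> y) = \<omega> 1"
    using y(1) canonical(2)[of "inv\<^bsub>\<Gamma>\<^esub> y" y] by (simp add: F_def canonical(1))
  ultimately show False
    using \<omega>(1) by (simp add: state_def)
qed

section \<open>The fundamental matrix of a group dual\<close>

lemma scaleC_sum_left: "(\<Sum>i\<in>I. c i) *\<^sub>C x = (\<Sum>i\<in>I. c i *\<^sub>C (x::'a::cstar_algebra))"
  by (induction I rule: infinite_finite_induct) (simp_all add: scaleC_add_left)

lemma scaleC_sum_right: "c *\<^sub>C (\<Sum>i\<in>I. x i) = (\<Sum>i\<in>I. c *\<^sub>C (x i::'a::cstar_algebra))"
  by (induction I rule: infinite_finite_induct) (simp_all add: scaleC_add_right)

lemma unitary_mat_orthonormal:
  assumes "unitary_mat n (J :: complex mat)" "r < n" "s < n"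
  shows "(\<Sum>l<n. J $$ (r, l) * cnj (J $$ (s, l))) = of_bool (r = s)"
    and "(\<Sum>l<n. cnj (J $$ (l, r)) * J $$ (l, s)) = of_bool (r = s)"
proof -
  have J: "J \<in> carrier_mat n n" "J * adjoint_mat J = 1\<^sub>m n" "adjoint_mat J * J = 1\<^sub>m n"
    using assms(1) by (auto simp: unitary_mat_def)
  have "(J * adjoint_mat J) $$ (r, s) = (\<Sum>l<n. J $$ (r, l) * cnj (J $$ (s, l)))"
    using assms(2,3) J(1) by (simp add: adjoint_mat_def scalar_prod_def atLeast0LessThan star_complex_def)
  then show "(\<Sum>l<n. J $$ (r, l) * cnj (J $$ (s, l))) = of_bool (r = s)"
    unfolding J(2) using assms(2,3) by (cases "r = s") simp_all
  have "(adjoint_mat J * J) $$ (r, s) = (\<Sum>l<n. cnj (J $$ (l, r)) * J $$ (l, s))"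
    using assms(2,3) J(1) by (simp add: adjoint_mat_def scalar_prod_def atLeast0LessThan star_complex_def)
  then show "(\<Sum>l<n. cnj (J $$ (l, r)) * J $$ (l, s)) = of_bool (r = s)"
    unfolding J(3) using assms(2,3) by (cases "r = s") simp_all
qed

lemma conjugated_diagonal_index:
  fixes d :: "nat \<Rightarrow> 'a::cstar_algebra"
  assumes "J \<in> carrier_mat n n" "i < n" "j < n"
  shows "(scalar_mat J * mat_diag n d * adjoint_mat (scalar_mat J)) $$ (i, j) =
    (\<Sum>r<n. (J $$ (i, r) * cnj (J $$ (j, r))) *\<^sub>C d r)"
proof -
  have "scalar_mat J * mat_diag n d = Matrix.mat n n (\<lambda>(i, j). scalar_mat J $$ (i, j) * d j)"
    by (rule mat_diag_mult_right) (use assms in \<open>simp add: scalar_mat_def\<close>)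
  then show ?thesis
    using assms by (simp add: scalar_mat_def adjoint_mat_def scalar_prod_def atLeast0LessThan
        mult_scaleC_left mult_scaleC_right star_scaleC scaleC_scaleC mult.commute)
qed

lemma conjugated_diagonal_combination:
  fixes d :: "nat \<Rightarrow> 'a::cstar_algebra"
  assumes "unitary_mat n J" "s < n"
    and w: "\<And>j. j < n \<Longrightarrow> w j = (\<Sum>r<n. (J $$ (i, r) * cnj (J $$ (j, r))) *\<^sub>C d r)"
  shows "(\<Sum>j<n. J $$ (j, s) *\<^sub>C w j) = J $$ (i, s) *\<^sub>C d s"
proof -
  have "(\<Sum>j<n. J $$ (j, s) *\<^sub>C w j) =
      (\<Sum>j<n. \<Sum>r<n. (J $$ (i, r) * (cnj (J $$ (j, r)) * J $$ (j, s))) *\<^sub>C d r)"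
    by (simp add: w scaleC_sum_right scaleC_scaleC mult_ac)
  also have "\<dots> = (\<Sum>r<n. (J $$ (i, r) * (\<Sum>j<n. cnj (J $$ (j, r)) * J $$ (j, s))) *\<^sub>C d r)"
    by (subst sum.swap) (simp add: sum_distrib_left scaleC_sum_left)
  also have "\<dots> = (\<Sum>r<n. if r = s then J $$ (i, s) *\<^sub>C d s else 0)"
    by (intro sum.cong refl) (simp add: unitary_mat_orthonormal(2)[OF assms(1) _ assms(2)])
  finally show ?thesis
    using assms(2) by simp
qed

definition last_rows_support :: "complex mat \<Rightarrow> (nat \<Rightarrow> 'g) \<Rightarrow> nat \<Rightarrow> nat \<Rightarrow> 'g set" where
  "last_rows_support J g k n = {g r | r. r < n \<and> (\<exists>i. k \<le> i \<and> i < n \<and> J $$ (i, r) \<noteq> 0)}"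

text \<open>Row \<open>i\<close> involves only the \<open>g r\<close> with
  \<open>J $$ (i, r) \<noteq> 0\<close>; conversely \<open>conjugated_diagonal_combination\<close>
  isolates each of them after division by this entry.\<close>

lemma row_algebra_group_dual:
  assumes \<Gamma>: "group \<Gamma>" "g ` {..<n} \<subseteq> carrier \<Gamma>" and J: "unitary_mat n J"
    and G: "dual_quantum_group \<Gamma> G \<iota>"
    and w: "\<And>i j. i < n \<Longrightarrow> j < n \<Longrightarrow>
      w $$ (i, j) = (\<Sum>r<n. (J $$ (i, r) * cnj (J $$ (j, r))) *\<^sub>C \<iota> (g r))"
  shows "row_algebra k n w = closure (lin_span \<iota> (generate \<Gamma> (last_rows_support J g k n)))"
proof
  interpret group \<Gamma> by fact
  note canonical = dual_quantum_group_canonical[OF \<Gamma>(1) G]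
  let ?S = "last_rows_support J g k n"
  let ?L = "generate \<Gamma> ?S"
  have S: "?S \<subseteq> carrier \<Gamma>"
    using \<Gamma>(2) by (auto simp: last_rows_support_def)
  have L: "subgroup ?L \<Gamma>"
    by (rule generate_is_subgroup[OF S])
  have "w $$ (i, j) \<in> lin_span \<iota> ?L" if "k \<le> i" "i < n" "j < n" for i j
  proof -
    have "(\<Sum>r\<in>R. (J $$ (i, r) * cnj (J $$ (j, r))) *\<^sub>C \<iota> (g r)) \<in> lin_span \<iota> ?L"
      if "R \<subseteq> {..<n}" for R
      using finite_subset[OF that finite_lessThan] that
    proof (induction R)
      case (insert r R)
      have "(J $$ (i, r) * cnj (J $$ (j, r))) *\<^sub>C \<iota> (g r) \<in> lin_span \<iota> ?L"
      proof (cases "J $$ (i, r) = 0")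
        case False
        then have "g r \<in> ?L"
          using \<open>k \<le> i\<close> \<open>i < n\<close> insert.prems
          by (intro generate.incl) (auto simp: last_rows_support_def)
        then show ?thesis
          by (rule lin_span_scaleC_generator)
      qed (simp add: lin_span_zero)
      then show ?case
        using insert by (simp add: lin_span_add)
    qed (simp add: lin_span_zero)
    then show ?thesis
      using that by (simp add: w)
  qed
  then have "{w $$ (i, j) | i j. k \<le> i \<and> i < n \<and> j < n} \<subseteq> closure (lin_span \<iota> ?L)"
    using closure_subset by blast
  then show "row_algebra k n w \<subseteq> closure (lin_span \<iota> ?L)"
    unfolding row_algebra_def
    by (intro generated_cstar_subset cstar_subalgebra_closure star_subalgebra_lin_span[OF \<Gamma>(1) G L])
  define B where "B = row_algebra k n w"
  have B: "cstar_subalgebra B"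
    unfolding B_def row_algebra_def by (rule cstar_subalgebra_generated)
  note B' = B[unfolded cstar_subalgebra_def csubspace_def]
  have w_B: "w $$ (i, j) \<in> B" if "k \<le> i" "i < n" "j < n" for i j
  proof -
    have "w $$ (i, j) \<in> {w $$ (i, j) | i j. k \<le> i \<and> i < n \<and> j < n}"
      using that by blast
    then show ?thesis
      unfolding B_def row_algebra_def by (rule subsetD[OF generated_cstar_superset])
  qed
  have gen: "\<iota> h \<in> B" if h: "h \<in> ?S" for h
  proof -
    obtain s i where s: "h = g s" "s < n" "k \<le> i" "i < n" "J $$ (i, s) \<noteq> 0"
      using h by (auto simp: last_rows_support_def)
    have "(\<Sum>j\<in>R. J $$ (j, s) *\<^sub>C w $$ (i, j)) \<in> B" if "R \<subseteq> {..<n}" for R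
      using finite_subset[OF that finite_lessThan] that
      by (induction R) (use B' w_B s in \<open>auto\<close>)
    moreover have "(\<Sum>j<n. J $$ (j, s) *\<^sub>C w $$ (i, j)) = J $$ (i, s) *\<^sub>C \<iota> (g s)"
      by (rule conjugated_diagonal_combination[OF J s(2) w[OF s(4)]])
    ultimately have "J $$ (i, s) *\<^sub>C \<iota> (g s) \<in> B"
      by (metis order_refl)
    then have "(1 / J $$ (i, s)) *\<^sub>C J $$ (i, s) *\<^sub>C \<iota> (g s) \<in> B"
      using B' by blast
    then show ?thesis
      using s by (simp add: scaleC_scaleC)
  qed
  have "\<iota> x \<in> B" if "x \<in> ?L" for x
    using that
  proof (induction x rule: generate.induct)
    case (inv h)
    then show ?case
      using gen B' canonical(3)[of h] S by auto
  next
    case (eng h1 h2)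
    then show ?case
      using B' canonical(2)[of h1 h2] generate_in_carrier[OF S] by auto
  qed (use gen canonical(1) B' in auto)
  then have "lin_span \<iota> ?L \<subseteq> B"
    using B by (intro lin_span_subset) (auto simp: cstar_subalgebra_def)
  then show "closure (lin_span \<iota> ?L) \<subseteq> row_algebra k n w"
    using B' unfolding B_def by (intro closure_minimal) auto
qed

section \<open>The quotient algebra of a group dual\<close>

lemma closed_subspace_quotient_algebra:
  assumes "star_hom (comult G)" "star_hom \<pi>id" "star_hom (t 1)"
  shows "closed (quotient_algebra G t \<pi>id)" and "csubspace (quotient_algebra G t \<pi>id)"
proof -
  note homs = assms[unfolded star_hom_def]
  have "star_hom (\<lambda>f. \<pi>id (comult G f))"
    using assms unfolding star_hom_def by simp
  then show "closed (quotient_algebra G t \<pi>id)"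
    unfolding quotient_algebra_def
    by (intro closed_Collect_eq star_hom_continuous assms(3))
  show "csubspace (quotient_algebra G t \<pi>id)"
    using homs star_hom_zero[OF assms(1)] star_hom_zero[OF assms(2)] star_hom_zero[OF assms(3)]
    by (simp add: csubspace_def quotient_algebra_def)
qed

lemma star_hom_min_tensor_right: "min_tensor t \<Longrightarrow> star_hom (t 1)"
  unfolding min_tensor_def star_hom_def by (metis mult.right_neutral star_one)

lemma mem_quotient_algebra_group_dual:
  assumes G: "dual_quantum_group \<Gamma> G \<iota>" and t: "tensor_map (tens G) t \<pi> id \<pi>id"
    and y: "y \<in> carrier \<Gamma>" "\<pi> (\<iota> y) = 1"
  shows "\<iota> y \<in> quotient_algebra G t \<pi>id"
  using assms by (simp add: quotient_algebra_def dual_quantum_group_def tensor_map_def)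

text \<open>The state \<open>\<omega>\<close> of \<open>C(H)\<close> plays the role of the canonical trace of the group algebra of
  \<open>\<Gamma> / \<Lambda>\<close>, so that \<open>(\<omega> \<otimes> id) \<Delta>\<close> is the conditional expectation onto the closed span of \<open>\<Lambda>\<close>.\<close>

lemma quotient_algebra_subset:
  fixes t :: "'h::cstar_algebra \<Rightarrow> 'a::cstar_algebra \<Rightarrow> 't::cstar_algebra"
    and G :: "('a, 'aa::cstar_algebra, 'aaa::cstar_algebra) cqg"
  assumes \<Gamma>: "group \<Gamma>" and G: "dual_quantum_group \<Gamma> G \<iota>"
    and t: "min_tensor t" "tensor_map (tens G) t \<pi> id \<pi>id"
    and \<omega>: "state \<omega>" "\<And>g. g \<in> carrier \<Gamma> \<Longrightarrow> \<omega> (\<pi> (\<iota> g)) = of_bool (g \<in> K)"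
  shows "quotient_algebra G t \<pi>id \<subseteq> closure (lin_span \<iota> K)"
proof
  fix f assume f: "f \<in> quotient_algebra G t \<pi>id"
  define E where "E = (\<lambda>x. \<pi>id (comult G x))"
  have comult: "star_hom (comult G)" "star_hom \<pi>id"
    using G t(2) by (auto simp: dual_quantum_group_def compact_quantum_group_def tensor_map_def)
  have E: "star_hom E"
    using comult unfolding E_def star_hom_def by simp
  have t1: "star_hom (t 1)"
    by (rule star_hom_min_tensor_right[OF t(1)])
  have t_add: "t (x + x') y = t x y + t x' y" and t_scale: "t (c *\<^sub>C x) y = c *\<^sub>C t x y" for x x' y c
    using t(1) by (auto simp: min_tensor_def)
  have t_diff: "t (x - x') y = t x y - t x' y" for x x' y
    using t_add[of "x - x'" x' y] by simp
  have E_gen: "E (\<iota> g) = t (\<pi> (\<iota> g)) (\<iota> g)" if "g \<in> carrier \<Gamma>" for g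
    using that G t(2) by (simp add: E_def dual_quantum_group_def tensor_map_def)
  note \<omega>_lin = \<omega>(1)[unfolded state_def]
  \<comment> \<open>On a finite sum the slice by \<open>\<omega>\<close> deletes the terms outside
    \<open>K\<close>, so the defect of the fixed-point equation bounds the distance to the truncated
    sum.\<close>
  have approx: "\<exists>x'\<in>lin_span \<iota> K. norm (x - x') \<le> norm (E x - t 1 x)"
    if x: "x \<in> lin_span \<iota> (carrier \<Gamma>)" for x
  proof -
    obtain l where l: "x = (\<Sum>(c, g)\<leftarrow>l. c *\<^sub>C \<iota> g)" "snd ` set l \<subseteq> carrier \<Gamma>"
      using x unfolding lin_span_def by blast
    define x' where "x' = (\<Sum>(c, g)\<leftarrow>filter (\<lambda>(c, g). g \<in> K) l. c *\<^sub>C \<iota> g)"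
    \<comment> \<open>A representative of \<open>E x - t 1 x\<close>, whose slice is
      \<open>x' - x\<close>.\<close>
    define xs where "xs = map (\<lambda>(c, g). (c *\<^sub>C (\<pi> (\<iota> g) - 1), \<iota> g)) l"
    have "E (\<Sum>(c, g)\<leftarrow>l. c *\<^sub>C \<iota> g) - t 1 (\<Sum>(c, g)\<leftarrow>l. c *\<^sub>C \<iota> g) =
        (\<Sum>(a, b)\<leftarrow>map (\<lambda>(c, g). (c *\<^sub>C (\<pi> (\<iota> g) - 1), \<iota> g)) l. t a b)"
      using l(2) by (induction l) (use E t1 star_hom_zero[OF E] star_hom_zero[OF t1] in
        \<open>auto simp: star_hom_def t_scale t_diff E_gen scaleC_diff_right algebra_simps\<close>)
    then have 1: "E x - t 1 x = (\<Sum>(a, b)\<leftarrow>xs. t a b)"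
      by (simp only: l(1) xs_def)
    have "(\<Sum>(a, b)\<leftarrow>map (\<lambda>(c, g). (c *\<^sub>C (\<pi> (\<iota> g) - 1), \<iota> g)) l. \<omega> a *\<^sub>C b) =
        (\<Sum>(c, g)\<leftarrow>filter (\<lambda>(c, g). g \<in> K) l. c *\<^sub>C \<iota> g) - (\<Sum>(c, g)\<leftarrow>l. c *\<^sub>C \<iota> g)"
      using l(2) by (induction l) (use \<omega>_lin in
        \<open>auto simp: state_diff[OF \<omega>(1)] \<omega>(2) scaleC_minus_left algebra_simps\<close>)
    then have 2: "(\<Sum>(a, b)\<leftarrow>xs. \<omega> a *\<^sub>C b) = x' - x"
      by (simp only: l(1) xs_def x'_def)
    have "norm (x - x') \<le> norm (E x - t 1 x)"
      using norm_slice_le[OF t(1) \<omega>(1), of xs] by (simp add: 1 2 norm_minus_commute)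
    moreover have "x' \<in> lin_span \<iota> K"
      unfolding lin_span_def x'_def by (intro CollectI exI[of _ "filter (\<lambda>(c, g). g \<in> K) l"]) auto
    ultimately show ?thesis
      by blast
  qed
  show "f \<in> closure (lin_span \<iota> K)"
    unfolding closure_approachable
  proof (intro allI impI)
    fix e :: real assume "0 < e"
    moreover have "f \<in> closure (lin_span \<iota> (carrier \<Gamma>))"
      using closure_lin_span_carrier[OF \<Gamma> G] by simp
    ultimately obtain x where x: "x \<in> lin_span \<iota> (carrier \<Gamma>)" "norm (x - f) < e / 3"
      unfolding closure_approachable dist_norm by (meson zero_less_divide_iff zero_less_numeral)
    obtain x' where x': "x' \<in> lin_span \<iota> K" "norm (x - x') \<le> norm (E x - t 1 x)"
      using approx[OF x(1)] by blast
    \<comment> \<open>\<open>E\<close> and \<open>t 1\<close> are contractive and agree at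
      \<open>f\<close>, so the defect at \<open>x\<close> is at most twice the distance from
      \<open>x\<close> to \<open>f\<close>; this accounts for the thirds of
      \<open>e\<close>.\<close>
    have "E f = t 1 f"
      using f by (simp add: quotient_algebra_def E_def)
    then have "E x - t 1 x = E (x - f) - t 1 (x - f)"
      by (simp add: star_hom_diff[OF E] star_hom_diff[OF t1])
    then have "norm (E x - t 1 x) \<le> norm (E (x - f)) + norm (t 1 (x - f))"
      by (simp add: norm_triangle_ineq4)
    also have "\<dots> \<le> norm (x - f) + norm (x - f)"
      by (intro add_mono star_hom_norm_le E t1)
    finally have "norm (x - x') < 2 * e / 3"
      using x(2) x'(2) by simp
    moreover have "norm (x' - f) \<le> norm (x - x') + norm (x - f)"
      using norm_triangle_ineq[of "x' - x" "x - f"] by (simp add: norm_minus_commute)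
    ultimately have "dist x' f < e"
      using x(2) by (simp add: dist_norm)
    then show "\<exists>y\<in>lin_span \<iota> K. dist y f < e"
      using x'(1) by blast
  qed
qed

text \<open>Normality enters here: moving \<open>h\<close> to the left of \<open>a\<close> replaces
  it by a conjugate in \<open>K\<close>, so \<open>a h b\<close> and \<open>a b\<close> lie in
  \<open>K\<close> together. Hence \<open>\<omega>\<close> vanishes on the whole two-sided ideal
  generated by \<open>\<iota> h - 1\<close>.\<close>

lemma gns_subgroup_state_eq_zero:
  assumes \<Gamma>: "group \<Gamma>" and G: "dual_quantum_group \<Gamma> G \<iota>" and K: "K \<lhd> \<Gamma>"
    and \<omega>: "state \<omega>" "\<And>g. g \<in> carrier \<Gamma> \<Longrightarrow> \<omega> (\<iota> g) = of_bool (g \<in> K)"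
    and h: "h \<in> K"
  shows "bounded_positive_functional.gns star \<omega> (\<iota> h - 1) = 0"
proof -
  interpret \<Gamma>: group \<Gamma> by fact
  interpret N: normal K \<Gamma> by fact
  interpret bounded_positive_functional scaleC star \<omega>
    by (rule bounded_positive_functional_state[OF \<omega>(1)])
  note canonical = dual_quantum_group_canonical[OF \<Gamma> G]
  note \<omega>_lin = \<omega>(1)[unfolded state_def]
  have hc: "h \<in> carrier \<Gamma>"
    using h N.subset by blast
  have dense: "x \<in> closure (lin_span \<iota> (carrier \<Gamma>))" for x
    using closure_lin_span_carrier[OF \<Gamma> G] by simp
  have bound: "cmod (\<omega> (a * x * b)) \<le> norm x * (norm a * norm b)" for a b x
  proof -
    have "norm (a * x * b) \<le> norm a * norm x * norm b"
      by (intro order_trans[OF norm_mult_ineq] mult_right_mono norm_mult_ineq) simp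
    then show ?thesis
      using state_norm_le[OF \<omega>(1), of "a * x * b"] by (simp add: mult_ac)
  qed
  have mem: "a \<otimes>\<^bsub>\<Gamma>\<^esub> h \<otimes>\<^bsub>\<Gamma>\<^esub> b \<in> K \<longleftrightarrow> a \<otimes>\<^bsub>\<Gamma>\<^esub> b \<in> K" if ab: "a \<in> carrier \<Gamma>" "b \<in> carrier \<Gamma>" for a b
  proof -
    define c where "c = a \<otimes>\<^bsub>\<Gamma>\<^esub> h \<otimes>\<^bsub>\<Gamma>\<^esub> inv\<^bsub>\<Gamma>\<^esub> a"
    have c: "c \<in> K" "c \<in> carrier \<Gamma>"
      using N.inv_op_closed2[OF ab(1) h] ab hc by (simp_all add: c_def)
    have eq: "a \<otimes>\<^bsub>\<Gamma>\<^esub> h \<otimes>\<^bsub>\<Gamma>\<^esub> b = c \<otimes>\<^bsub>\<Gamma>\<^esub> (a \<otimes>\<^bsub>\<Gamma>\<^esub> b)"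
      using ab hc by (simp add: c_def \<Gamma>.m_assoc \<Gamma>.inv_solve_left)
    show ?thesis
    proof
      assume "a \<otimes>\<^bsub>\<Gamma>\<^esub> b \<in> K"
      then show "a \<otimes>\<^bsub>\<Gamma>\<^esub> h \<otimes>\<^bsub>\<Gamma>\<^esub> b \<in> K"
        unfolding eq by (rule N.m_closed[OF c(1)])
    next
      assume "a \<otimes>\<^bsub>\<Gamma>\<^esub> h \<otimes>\<^bsub>\<Gamma>\<^esub> b \<in> K"
      then have "inv\<^bsub>\<Gamma>\<^esub> c \<otimes>\<^bsub>\<Gamma>\<^esub> (c \<otimes>\<^bsub>\<Gamma>\<^esub> (a \<otimes>\<^bsub>\<Gamma>\<^esub> b)) \<in> K"
        unfolding eq by (rule N.m_closed[OF N.m_inv_closed[OF c(1)]])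
      then show "a \<otimes>\<^bsub>\<Gamma>\<^esub> b \<in> K"
        using ab c(2) by (simp flip: \<Gamma>.m_assoc)
    qed
  qed
  \<comment> \<open>Extension by linearity and continuity in one factor at a time, first on the
    right.\<close>
  have zero: "\<omega> (x * (\<iota> h - 1) * y) = 0" for x y
  proof -
    have gen: "\<omega> (\<iota> a * (\<iota> h - 1) * \<iota> b) = 0" if "a \<in> carrier \<Gamma>" "b \<in> carrier \<Gamma>" for a b
    proof -
      have "\<iota> a * (\<iota> h - 1) * \<iota> b = \<iota> (a \<otimes>\<^bsub>\<Gamma>\<^esub> h \<otimes>\<^bsub>\<Gamma>\<^esub> b) - \<iota> (a \<otimes>\<^bsub>\<Gamma>\<^esub> b)"
        using that hc by (simp add: canonical(2) algebra_simps)
      then show ?thesis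
        using that hc by (simp add: state_diff[OF \<omega>(1)] \<omega>(2) mem)
    qed
    have right: "\<omega> (\<iota> a * (\<iota> h - 1) * y) = 0" if "a \<in> carrier \<Gamma>" for a y
    proof (rule linear_functional_eq_zero[OF _ _ _ _ dense[of y],
          where F = "\<lambda>y. \<omega> (\<iota> a * (\<iota> h - 1) * y)" and C = "norm (\<iota> a * (\<iota> h - 1))"])
      show "cmod (\<omega> (\<iota> a * (\<iota> h - 1) * y)) \<le> norm y * norm (\<iota> a * (\<iota> h - 1))" for y
        using bound[of "\<iota> a * (\<iota> h - 1)" y 1] by simp
    qed (use \<omega>_lin gen that in \<open>simp_all add: distrib_left mult_scaleC_right\<close>)
    show ?thesis
    proof (rule linear_functional_eq_zero[OF _ _ _ _ dense[of x],
          where F = "\<lambda>x. \<omega> (x * (\<iota> h - 1) * y)" and C = "norm ((\<iota> h - 1) * y)"])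
      show "cmod (\<omega> (x * (\<iota> h - 1) * y)) \<le> norm x * norm ((\<iota> h - 1) * y)" for x
        using bound[of 1 x "(\<iota> h - 1) * y"] by (simp add: mult.assoc)
    qed (use \<omega>_lin right in \<open>simp_all add: distrib_right mult_scaleC_left\<close>)
  qed
  show ?thesis
    by (rule gns_eq_zero) (metis zero mult.assoc)
qed

theorem theoremA:
  fixes \<Gamma> :: "('g, 'm) monoid_scheme" and g :: "nat \<Rightarrow> 'g"
    and J :: "complex mat" and n k :: nat
    and U :: "('u::cstar_algebra, 'uu::cstar_algebra, 'uuu::cstar_algebra) cqg" and u :: "'u mat"
    and V :: "('v::cstar_algebra, 'vv::cstar_algebra, 'vvv::cstar_algebra) cqg" and v :: "'v mat"
    and G :: "('a::cstar_algebra, 'aa::cstar_algebra, 'aaa::cstar_algebra) cqg" and \<iota> :: "'g \<Rightarrow> 'a"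
    and H :: "('h::cstar_algebra, 'hh::cstar_algebra, 'hhh::cstar_algebra) cqg"
    and \<pi>\<^sub>G :: "'u \<Rightarrow> 'a" and \<pi>\<^sub>V :: "'u \<Rightarrow> 'v" and \<rho> :: "'u \<Rightarrow> 'h" and \<pi> :: "'a \<Rightarrow> 'h"
    and t :: "'h \<Rightarrow> 'a \<Rightarrow> 't::cstar_algebra" and \<pi>id :: "'aa \<Rightarrow> 't"
  assumes \<Gamma>: "group \<Gamma>" "g ` {..<n} \<subseteq> carrier \<Gamma>" "carrier \<Gamma> = generate \<Gamma> (g ` {..<n})"
    and J: "unitary_mat n J"
    and k: "k \<le> n"
    and U: "free_unitary_quantum_group n U u"
    and V: "free_unitary_quantum_group k V v"
    and V_sub: "quantum_subgroup V U \<pi>\<^sub>V" "map_mat \<pi>\<^sub>V u = extend_mat k n v"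
    and G: "dual_quantum_group \<Gamma> G \<iota>"
    and G_sub: "quantum_subgroup G U \<pi>\<^sub>G"
      "map_mat \<pi>\<^sub>G u = scalar_mat J * mat_diag n (\<lambda>r. \<iota> (g r)) * adjoint_mat (scalar_mat J)"
    and H: "quantum_intersection H U \<rho> \<pi>\<^sub>G \<pi>\<^sub>V"
    and H_sub: "quantum_subgroup H G \<pi>" "\<pi> \<circ> \<pi>\<^sub>G = \<rho>"
    and t: "min_tensor t" "tensor_map (tens G) t \<pi> id \<pi>id"
  shows "row_algebra k n (map_mat \<pi>\<^sub>G u) = quotient_algebra G t \<pi>id \<longleftrightarrow>
    generate \<Gamma> {g r | r. r < n \<and> (\<exists>i. k \<le> i \<and> i < n \<and> J $$ (i, r) \<noteq> 0)} \<lhd> \<Gamma>"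
proof -
  interpret group \<Gamma> by fact
  define \<Lambda> where "\<Lambda> = generate \<Gamma> (last_rows_support J g k n)"
  have S: "last_rows_support J g k n \<subseteq> carrier \<Gamma>"
    using \<Gamma>(2) by (auto simp: last_rows_support_def)
  have \<Lambda>: "subgroup \<Lambda> \<Gamma>"
    unfolding \<Lambda>_def by (rule generate_is_subgroup[OF S])
  note canonical = dual_quantum_group_canonical[OF \<Gamma>(1) G]
  have J_carrier: "J \<in> carrier_mat n n"
    using J by (simp add: unitary_mat_def)
  have homs: "star_hom \<pi>\<^sub>V" "star_hom \<pi>\<^sub>G" "star_hom \<pi>" "star_hom (comult G)" "star_hom \<pi>id"
    and surj: "surj \<pi>" "surj \<pi>\<^sub>G"
    using V_sub(1) G_sub(1) H_sub(1) t(2)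
    by (auto simp: quantum_subgroup_def compact_quantum_group_def tensor_map_def)
  have u: "u \<in> carrier_mat n n" and v: "v \<in> carrier_mat k k"
    and u_univ: "universal_cstar_algebra ({..<n} \<times> {..<n}) (biunitary_relations n) (\<lambda>ij. u $$ ij)"
    and v_univ: "universal_cstar_algebra ({..<k} \<times> {..<k}) (biunitary_relations k) (\<lambda>ij. v $$ ij)"
    using U V by (auto simp: free_unitary_quantum_group_def)
  have w: "\<pi>\<^sub>G (u $$ (i, j)) = (\<Sum>r<n. (J $$ (i, r) * cnj (J $$ (j, r))) *\<^sub>C \<iota> (g r))"
    if "i < n" "j < n" for i j
    using conjugated_diagonal_index[OF J_carrier that, of "\<lambda>r. \<iota> (g r)"] that u
    unfolding G_sub(2)[symmetric] by simp
  have row: "row_algebra k n (map_mat \<pi>\<^sub>G u) = closure (lin_span \<iota> \<Lambda>)"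
    unfolding \<Lambda>_def by (rule row_algebra_group_dual[OF \<Gamma>(1,2) J G]) (use w u in simp)
  \<comment> \<open>The last rows of \<open>diag(v, 1)\<close> are those of the identity, so the
    difference is in the kernel of \<open>\<pi>\<^sub>V\<close>, hence in that of
    \<open>\<rho>\<close>.\<close>
  have \<pi>_w: "\<pi> (\<pi>\<^sub>G (u $$ (i, j))) = of_bool (i = j)" if "k \<le> i" "i < n" "j < n" for i j
  proof -
    have one: "\<pi>\<^sub>V (of_bool b) = of_bool b" "\<pi>\<^sub>G (of_bool b) = of_bool b" "\<pi> (of_bool b) = of_bool b" for b
      using homs(1-3) star_hom_zero[OF homs(1)] star_hom_zero[OF homs(2)] star_hom_zero[OF homs(3)]
      by (simp_all add: star_hom_def)
    have "\<pi>\<^sub>V (u $$ (i, j)) = of_bool (i = j)"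
      using that u extend_mat_index[OF v k, of i j] arg_cong[OF V_sub(2), of "\<lambda>A. A $$ (i, j)"] by simp
    then have "u $$ (i, j) - of_bool (i = j) \<in> hom_kernel \<pi>\<^sub>V"
      by (simp only: hom_kernel_def mem_Collect_eq star_hom_diff[OF homs(1)] one) simp
    moreover have "0 \<in> hom_kernel \<pi>\<^sub>G"
      by (simp add: hom_kernel_def star_hom_zero[OF homs(2)])
    ultimately have "0 + (u $$ (i, j) - of_bool (i = j)) \<in> hom_kernel \<rho>"
      using H unfolding quantum_intersection_def by blast
    then have "\<rho> (u $$ (i, j) - of_bool (i = j)) = 0"
      by (simp add: hom_kernel_def)
    then show ?thesis
      unfolding H_sub(2)[symmetric]
      by (simp only: comp_apply star_hom_diff[OF homs(2)] star_hom_diff[OF homs(3)] one) simp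
  qed
  \<comment> \<open>After applying \<open>\<pi>\<close>, row \<open>i\<close> is a row of the
    identity, and the combination that isolates \<open>\<iota> (g s)\<close> reduces to
    \<open>J $$ (i, s)\<close> on the other side.\<close>
  have \<pi>_gen: "\<pi> (\<iota> (g s)) = 1" if s: "s < n" "k \<le> i" "i < n" "J $$ (i, s) \<noteq> 0" for s i
  proof -
    have "\<pi> (\<Sum>j\<in>R. c j *\<^sub>C x j) = (\<Sum>j\<in>R. c j *\<^sub>C \<pi> (x j))" for R :: "nat set" and c x
      using homs(3) star_hom_zero[OF homs(3)]
      by (induction R rule: infinite_finite_induct) (simp_all add: star_hom_def)
    then have "(\<Sum>j<n. J $$ (j, s) *\<^sub>C of_bool (i = j)) = \<pi> (\<Sum>j<n. J $$ (j, s) *\<^sub>C \<pi>\<^sub>G (u $$ (i, j)))"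
      using s \<pi>_w by simp
    also have "\<dots> = J $$ (i, s) *\<^sub>C \<pi> (\<iota> (g s))"
      using conjugated_diagonal_combination[OF J s(1), of "\<lambda>j. \<pi>\<^sub>G (u $$ (i, j))" i "\<lambda>r. \<iota> (g r)"] w s homs(3)
      by (simp add: star_hom_def)
    also have "(\<Sum>j<n. J $$ (j, s) *\<^sub>C of_bool (i = j)) = (\<Sum>j<n. if i = j then J $$ (i, s) *\<^sub>C (1::'h) else 0)"
      by (intro sum.cong) auto
    also have "\<dots> = J $$ (i, s) *\<^sub>C 1"
      using s by simp
    finally have "(1 / J $$ (i, s)) *\<^sub>C J $$ (i, s) *\<^sub>C (1::'h) = (1 / J $$ (i, s)) *\<^sub>C J $$ (i, s) *\<^sub>C \<pi> (\<iota> (g s))"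
      by simp
    then show ?thesis
      using s by (simp add: scaleC_scaleC)
  qed
  have \<pi>_mult: "\<pi> (x * y) = \<pi> x * \<pi> y" "\<pi> (star x) = star (\<pi> x)" "\<pi> 1 = 1" for x y
    using homs(3) by (auto simp: star_hom_def)
  have \<pi>_\<Lambda>: "\<pi> (\<iota> x) = 1" if "x \<in> \<Lambda>" for x
    using that unfolding \<Lambda>_def
  proof (induction x rule: generate.induct)
    case (incl h)
    then show ?case
      using \<pi>_gen by (auto simp: last_rows_support_def)
  next
    case (inv h)
    then have "\<pi> (\<iota> h) = 1"
      using \<pi>_gen by (auto simp: last_rows_support_def)
    moreover have "h \<in> carrier \<Gamma>"
      using inv S by blast
    ultimately show ?case
      by (simp add: canonical(3) \<pi>_mult)
  next
    case (eng h1 h2)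
    then show ?case
      using generate_in_carrier[OF S] by (simp add: canonical(2) \<pi>_mult)
  qed (simp add: canonical(1) \<pi>_mult)
  have "row_algebra k n (map_mat \<pi>\<^sub>G u) = quotient_algebra G t \<pi>id \<longleftrightarrow> \<Lambda> \<lhd> \<Gamma>"
  proof
    assume eq: "row_algebra k n (map_mat \<pi>\<^sub>G u) = quotient_algebra G t \<pi>id"
    have "x \<otimes>\<^bsub>\<Gamma>\<^esub> h \<otimes>\<^bsub>\<Gamma>\<^esub> inv\<^bsub>\<Gamma>\<^esub> x \<in> \<Lambda>" if x: "x \<in> carrier \<Gamma>" and h: "h \<in> \<Lambda>" for x h
    proof -
      have hc: "h \<in> carrier \<Gamma>"
        using h subgroup.subset[OF \<Lambda>] by blast
      have "\<iota> x * star (\<iota> x) = 1"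
        using canonical(2)[of x "inv\<^bsub>\<Gamma>\<^esub> x"] canonical(1,3) x by simp
      then have "\<pi> (\<iota> x) * star (\<pi> (\<iota> x)) = 1"
        by (metis \<pi>_mult)
      then have "\<pi> (\<iota> (x \<otimes>\<^bsub>\<Gamma>\<^esub> h \<otimes>\<^bsub>\<Gamma>\<^esub> inv\<^bsub>\<Gamma>\<^esub> x)) = 1"
        using x hc by (simp add: canonical(2,3) \<pi>_mult \<pi>_\<Lambda>[OF h])
      then have "\<iota> (x \<otimes>\<^bsub>\<Gamma>\<^esub> h \<otimes>\<^bsub>\<Gamma>\<^esub> inv\<^bsub>\<Gamma>\<^esub> x) \<in> closure (lin_span \<iota> \<Lambda>)"
        using mem_quotient_algebra_group_dual[OF G t(2)] x hc by (simp add: row[symmetric] eq)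
      then show ?thesis
        using x hc by (intro mem_if_closure_lin_span[OF \<Gamma>(1) G \<Lambda>]) simp_all
    qed
    then show "\<Lambda> \<lhd> \<Gamma>"
      using \<Lambda> by (simp add: normal_inv_iff)
  next
    assume normal: "\<Lambda> \<lhd> \<Gamma>"
    obtain \<omega> where \<omega>: "state \<omega>" "\<And>g. g \<in> carrier \<Gamma> \<Longrightarrow> \<omega> (\<iota> g) = of_bool (g \<in> \<Lambda>)"
      using exists_subgroup_state[of \<iota> \<Lambda>] G \<Lambda> by (auto simp: dual_quantum_group_def)
    interpret bounded_positive_functional scaleC star \<omega>
      by (rule bounded_positive_functional_state[OF \<omega>(1)])
    have null_gen: "gns (c *\<^sub>C (\<iota> (g r) - 1)) = 0" if "c = 0 \<or> g r \<in> \<Lambda>" for c r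
      using that gns_subgroup_state_eq_zero[OF \<Gamma>(1) G normal \<omega>] by (auto simp: gns_sc)
    \<comment> \<open>Orthonormality of the rows of \<open>J\<close> absorbs the identity matrix
      into the sum. A nonzero coefficient requires both \<open>J $$ (i, r)\<close> and
      \<open>J $$ (j, r)\<close> to be nonzero, so one index at least \<open>k\<close> suffices for
      \<open>g r \<in> \<Lambda>\<close>; this gives the last columns as well as the last
      rows.\<close>
    have w_id: "gns (\<pi>\<^sub>G (u $$ (i, j)) - of_bool (i = j)) = 0" if ij: "i < n" "j < n" "k \<le> i \<or> k \<le> j" for i j
    proof -
      have "(\<Sum>r<n. J $$ (i, r) * cnj (J $$ (j, r))) *\<^sub>C 1 = (of_bool (i = j) :: 'a)"
        using unitary_mat_orthonormal(1)[OF J ij(1,2)] by simp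
      then have eq: "\<pi>\<^sub>G (u $$ (i, j)) - of_bool (i = j) =
          (\<Sum>r<n. (J $$ (i, r) * cnj (J $$ (j, r))) *\<^sub>C (\<iota> (g r) - 1))"
        using w[OF ij(1,2)] by (simp add: scaleC_sum_left scaleC_diff_right sum_subtractf)
      have "gns (\<Sum>r\<in>R. (J $$ (i, r) * cnj (J $$ (j, r))) *\<^sub>C (\<iota> (g r) - 1)) = 0" if "R \<subseteq> {..<n}" for R
        using finite_subset[OF that finite_lessThan] that
      proof (induction R)
        case empty
        then show ?case
          using gns_sc[of 0 0] by simp
      next
        case (insert r R)
        have "J $$ (i, r) * cnj (J $$ (j, r)) = 0 \<or> g r \<in> \<Lambda>"
          using insert.prems ij unfolding \<Lambda>_def last_rows_support_def
          by (auto intro!: generate.incl)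
        then have "gns ((J $$ (i, r) * cnj (J $$ (j, r))) *\<^sub>C (\<iota> (g r) - 1)) = 0"
          by (rule null_gen)
        moreover have "gns (\<Sum>r\<in>R. (J $$ (i, r) * cnj (J $$ (j, r))) *\<^sub>C (\<iota> (g r) - 1)) = 0"
          using insert by simp
        ultimately show ?case
          using insert.hyps gns_nonneg gns_add by (metis (no_types, lifting) sum.insert add_0 order_antisym)
      qed
      then show ?thesis
        unfolding eq by simp
    qed
    have factor: "gns (\<pi>\<^sub>G z) \<le> norm (\<pi>\<^sub>V z)" for z
      by (rule free_unitary_factor[OF u_univ v_univ u v k homs(1) V_sub(2) homs(2) \<omega>(1) w_id])
    \<comment> \<open>A preimage of \<open>x\<close> splits along the two kernels:
      \<open>\<pi>\<^sub>G\<close> kills the first part, and \<open>factor\<close> makes the image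
      of the second part null.\<close>
    have kernel: "\<omega> x = 0" if x: "\<pi> x = 0" for x
    proof -
      obtain z where z: "x = \<pi>\<^sub>G z"
        using surj(2) by (rule surjE)
      have "z \<in> hom_kernel \<rho>"
        using x z by (simp add: hom_kernel_def H_sub(2)[symmetric])
      moreover have "hom_kernel \<rho> = {x + y | x y. x \<in> hom_kernel \<pi>\<^sub>G \<and> y \<in> hom_kernel \<pi>\<^sub>V}"
        using H by (simp add: quantum_intersection_def)
      ultimately obtain z1 z2 where "z = z1 + z2" "z1 \<in> hom_kernel \<pi>\<^sub>G" "z2 \<in> hom_kernel \<pi>\<^sub>V"
        by blast
      then have zz: "z = z1 + z2" "\<pi>\<^sub>G z1 = 0" "\<pi>\<^sub>V z2 = 0"
        by (simp_all add: hom_kernel_def)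
      then have "x = \<pi>\<^sub>G z2"
        using z homs(2) by (simp add: star_hom_def)
      then have "gns x \<le> 0"
        using factor[of z2] zz(3) by simp
      then have "cmod (\<omega> x) \<le> 0"
        using tau_le_gns[of x] by linarith
      then show ?thesis
        by simp
    qed
    \<comment> \<open>By \<open>kernel\<close> the value does not depend on the chosen
      preimage.\<close>
    define \<omega>' where "\<omega>' = (\<lambda>y. \<omega> (inv_into UNIV \<pi> y))"
    have \<omega>': "\<omega>' (\<pi> x) = \<omega> x" for x
    proof -
      have "\<pi> (inv_into UNIV \<pi> (\<pi> x) - x) = 0"
        using surj(1) by (simp add: star_hom_diff[OF homs(3)] surj_f_inv_f)
      then have "\<omega> (inv_into UNIV \<pi> (\<pi> x) - x) = 0"
        by (rule kernel)
      then show ?thesis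
        by (simp add: \<omega>'_def state_diff[OF \<omega>(1)])
    qed
    have "state \<omega>'"
      unfolding state_def
    proof (intro conjI allI)
      fix x y c
      obtain x0 y0 where xy: "x = \<pi> x0" "y = \<pi> y0"
        using surj(1) by (metis surjE)
      have image: "\<pi> x0 + \<pi> y0 = \<pi> (x0 + y0)" "c *\<^sub>C \<pi> x0 = \<pi> (c *\<^sub>C x0)"
        "star (\<pi> x0) * \<pi> x0 = \<pi> (star x0 * x0)"
        using homs(3) by (simp_all add: star_hom_def)
      show "\<omega>' (x + y) = \<omega>' x + \<omega>' y" "\<omega>' (c *\<^sub>C x) = c * \<omega>' x" "\<omega>' (star x * x) \<in> \<real>\<^sub>\<ge>\<^sub>0"
        unfolding xy image \<omega>' using \<omega>(1) by (simp_all add: state_def)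
      show "\<omega>' 1 = 1"
        using \<omega>'[of 1] \<omega>(1) by (simp add: \<pi>_mult state_def)
    qed
    then have "quotient_algebra G t \<pi>id \<subseteq> closure (lin_span \<iota> \<Lambda>)"
      by (rule quotient_algebra_subset[OF \<Gamma>(1) G t]) (simp add: \<omega>' \<omega>(2))
    moreover have "closure (lin_span \<iota> \<Lambda>) \<subseteq> quotient_algebra G t \<pi>id"
    proof (rule closure_minimal)
      note quotient = closed_subspace_quotient_algebra[where t = t, OF homs(4,5) star_hom_min_tensor_right[OF t(1)]]
      show "closed (quotient_algebra G t \<pi>id)"
        by (rule quotient)
      show "lin_span \<iota> \<Lambda> \<subseteq> quotient_algebra G t \<pi>id"
        using mem_quotient_algebra_group_dual[OF G t(2)] \<pi>_\<Lambda> subgroup.subset[OF \<Lambda>]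
        by (intro lin_span_subset quotient) blast
    qed
    ultimately show "row_algebra k n (map_mat \<pi>\<^sub>G u) = quotient_algebra G t \<pi>id"
      unfolding row by blast
  qed
  then show ?thesis
    unfolding \<Lambda>_def last_rows_support_def .
qed

end
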